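(* (ZF) For every set $k$, $\tau_{|k|}<\theta_{\mathcal{P}({}^{\omega>}k)}$. That is, there is an ordinal $\alpha$ which is the image of a function from $\mathcal{P}({}^{\omega>}k)$ onto $\alpha$ such that $\tau_G<\alpha$ for every centerless group $G$ with $|G|\le|k|$.
   Context: Work in ZF (no axiom of choice). For sets $X,Y$, $|X|\le|Y|$ means there is an injection from $X$ into $Y$. ${}^{\omega>}k$ denotes the set of finite sequences of elements of $k$. For a set $A$, $\theta_A$ is the least ordinal $\alpha>0$ such that there is no function from $A$ onto $\alpha$. For a centerless group $G$, the automorphism tower $\langle G^\alpha:\alpha\in\mathbf{Ord}\rangle$ is defined by $G^0=G$, $G^{\alpha+1}=\mathrm{Aut}(G^\alpha)$, where $G^\alpha$ is identified with its group of inner automorphisms $\mathrm{Inn}(G^\alpha)\le \mathrm{Aut}(G^\alpha)$ (possible since each $G^\alpha$ is centerless), and $G^\delta=\bigcup_{\alpha<\delta}G^\alpha$ for limit $\delta$. $\tau_G=\min\{\alpha: G^{\alpha+1}=G^\alpha\}$. For a set $k$, $\tau_{|k|}$ is the smallest ordinal $\alpha$ such that $\alpha>\tau_G$ for every centerless group $G$ with $|G|\le|k|$. *)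

theory Defs
  imports "HOL-Algebra.Group"
begin

text \<open>
  HOL has the axiom of choice, so a statement about HOL sets would be a statement of ZFC.
  Instead the theorem is stated in an arbitrary model of first-order ZF: the class \<open>zf\<close> below
  consists of the models of ZF, with a HOL type as universe.  Separation and Replacement range
  only over first-order formulas with parameters from the model, hence Hilbert's choice operator
  of HOL does not make the models satisfy the axiom of choice.  All notions below are interpreted
  inside the model: every set, function, sequence, ordinal, group, automorphism and tower is an
  element of the model, and so every quantifier ranges over elements of the model.
\<close>

datatype fm = Mem nat nat | Eq nat nat | Neg fm | Conj fm fm | All nat fm

text \<open>\<open>elts x\<close> is the HOL set of the members of \<open>x\<close>, so the membership relation of the model is
  \<open>y \<in> elts x\<close>.\<close>

primrec sat :: "('v \<Rightarrow> 'v set) \<Rightarrow> (nat \<Rightarrow> 'v) \<Rightarrow> fm \<Rightarrow> bool" where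
  "sat elts s (Mem i j) \<longleftrightarrow> s i \<in> elts (s j)"
| "sat elts s (Eq i j) \<longleftrightarrow> s i = s j"
| "sat elts s (Neg \<phi>) \<longleftrightarrow> \<not> sat elts s \<phi>"
| "sat elts s (Conj \<phi> \<psi>) \<longleftrightarrow> sat elts s \<phi> \<and> sat elts s \<psi>"
| "sat elts s (All i \<phi>) \<longleftrightarrow> (\<forall>x. sat elts (s(i := x)) \<phi>)"

class zf =
  fixes elts :: "'a \<Rightarrow> 'a set"
  assumes extensionality: "elts x = elts y \<Longrightarrow> x = y"
    and foundation: "elts x \<noteq> {} \<Longrightarrow> \<exists>y\<in>elts x. elts y \<inter> elts x = {}"
    and pairing: "\<exists>z. elts z = {x, y}"
    and union: "\<exists>z. elts z = (\<Union>y\<in>elts x. elts y)"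
    and powerset: "\<exists>z. elts z = {y. elts y \<subseteq> elts x}"
    and infinity: "\<exists>z. (\<exists>e\<in>elts z. elts e = {}) \<and>
                       (\<forall>y\<in>elts z. \<exists>y'\<in>elts z. elts y' = insert y (elts y))"
    and separation: "\<exists>z. elts z = {y \<in> elts x. sat elts (s(0 := y)) \<phi>}"
    and replacement: "(\<forall>y\<in>elts x. \<exists>!w. sat elts (s(0 := y, 1 := w)) \<phi>) \<Longrightarrow>
                      \<exists>z. elts z = {w. \<exists>y\<in>elts x. sat elts (s(0 := y, 1 := w)) \<phi>}"

text \<open>\<open>vset X\<close> is the element of the model whose members form \<open>X\<close>.  It is meaningful only for those
  HOL sets \<open>X\<close> that are represented in the model; for every use below this follows from the axioms.\<close>

definition vset :: "'v::zf set \<Rightarrow> 'v" where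
  "vset X = (THE x. elts x = X)"

definition opair :: "'v::zf \<Rightarrow> 'v \<Rightarrow> 'v" where
  "opair x y = vset {vset {x}, vset {x, y}}"

definition vfst :: "'v::zf \<Rightarrow> 'v" where
  "vfst p = (THE x. \<exists>y. p = opair x y)"

definition vsnd :: "'v::zf \<Rightarrow> 'v" where
  "vsnd p = (THE y. \<exists>x. p = opair x y)"

definition vprod :: "'v::zf \<Rightarrow> 'v \<Rightarrow> 'v" where
  "vprod A B = vset {opair x y | x y. x \<in> elts A \<and> y \<in> elts B}"

definition VPow :: "'v::zf \<Rightarrow> 'v" where
  "VPow A = vset {B. elts B \<subseteq> elts A}"

definition fun_on :: "'v::zf \<Rightarrow> 'v \<Rightarrow> bool" where
  "fun_on f A \<longleftrightarrow> (\<forall>p\<in>elts f. \<exists>x\<in>elts A. \<exists>y. p = opair x y) \<and>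
                 (\<forall>x\<in>elts A. \<exists>!y. opair x y \<in> elts f)"

definition app :: "'v::zf \<Rightarrow> 'v \<Rightarrow> 'v" where
  "app f x = (THE y. opair x y \<in> elts f)"

definition maps :: "'v::zf \<Rightarrow> 'v \<Rightarrow> 'v \<Rightarrow> bool" where
  "maps f A B \<longleftrightarrow> fun_on f A \<and> app f ` elts A \<subseteq> elts B"

definition maps_onto :: "'v::zf \<Rightarrow> 'v \<Rightarrow> 'v \<Rightarrow> bool" where
  "maps_onto f A B \<longleftrightarrow> fun_on f A \<and> app f ` elts A = elts B"

definition card_le :: "'v::zf \<Rightarrow> 'v \<Rightarrow> bool" where
  "card_le A B \<longleftrightarrow> (\<exists>f. maps f A B \<and> inj_on (app f) (elts A))"

definition vlam :: "'v::zf \<Rightarrow> ('v \<Rightarrow> 'v) \<Rightarrow> 'v" where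
  "vlam A F = vset ((\<lambda>x. opair x (F x)) ` elts A)"

text \<open>Well-foundedness of membership is the axiom of foundation.\<close>

definition Ord :: "'v::zf \<Rightarrow> bool" where
  "Ord a \<longleftrightarrow> (\<forall>x\<in>elts a. elts x \<subseteq> elts a) \<and>
             (\<forall>x\<in>elts a. \<forall>y\<in>elts a. x \<in> elts y \<or> x = y \<or> y \<in> elts x)"

definition vzero :: "'v::zf" where
  "vzero = vset {}"

definition vsucc :: "'v::zf \<Rightarrow> 'v" where
  "vsucc a = vset (insert a (elts a))"

definition Limit_Ord :: "'v::zf \<Rightarrow> bool" where
  "Limit_Ord a \<longleftrightarrow> Ord a \<and> a \<noteq> vzero \<and> (\<forall>b\<in>elts a. vsucc b \<in> elts a)"

text \<open>The members of an ordinal are exactly the smaller ordinals.\<close>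

definition least_Ord :: "('v::zf \<Rightarrow> bool) \<Rightarrow> 'v \<Rightarrow> bool" where
  "least_Ord P a \<longleftrightarrow> Ord a \<and> P a \<and> (\<forall>b\<in>elts a. \<not> P b)"

definition vomega :: "'v::zf" where
  "vomega = (THE a. least_Ord Limit_Ord a)"

definition fin_seqs :: "'v::zf \<Rightarrow> 'v" where
  "fin_seqs k = vset {s. \<exists>n\<in>elts vomega. maps s n k}"

definition is_theta :: "'v::zf \<Rightarrow> 'v \<Rightarrow> bool" where
  "is_theta A h \<longleftrightarrow> least_Ord (\<lambda>a. a \<noteq> vzero \<and> \<not> (\<exists>f. maps_onto f A a)) h"

text \<open>A group of the model is a pair of a carrier and a multiplication function.  Its members,
  seen from HOL, form a structure of HOL-Algebra.\<close>

definition struct :: "'v::zf \<Rightarrow> 'v monoid" where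
  "struct G =
    \<lparr>carrier = elts (vfst G),
     monoid.mult = (\<lambda>x y. app (vsnd G) (opair x y)),
     one = (THE e. e \<in> elts (vfst G) \<and>
                   (\<forall>x\<in>elts (vfst G). app (vsnd G) (opair e x) = x \<and> app (vsnd G) (opair x e) = x))\<rparr>"

definition is_group :: "'v::zf \<Rightarrow> bool" where
  "is_group G \<longleftrightarrow> (\<exists>c m. G = opair c m \<and> maps m (vprod c c) c) \<and> group (struct G)"

definition centerless_group :: "'v::zf \<Rightarrow> bool" where
  "centerless_group G \<longleftrightarrow> is_group G \<and>
     (\<forall>z\<in>carrier (struct G).
        (\<forall>x\<in>carrier (struct G). z \<otimes>\<^bsub>struct G\<^esub> x = x \<otimes>\<^bsub>struct G\<^esub> z) \<longrightarrow> z = \<one>\<^bsub>struct G\<^esub>)"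

text \<open>The carrier contains only the automorphisms that are elements of the model, so \<open>AutoGroup\<close>
  from HOL-Algebra cannot be used.\<close>

definition Aut :: "'v::zf \<Rightarrow> 'v monoid" where
  "Aut G =
    \<lparr>carrier = {f. maps f (vfst G) (vfst G) \<and> app f \<in> iso (struct G) (struct G)},
     monoid.mult = (\<lambda>f g. vlam (vfst G) (\<lambda>x. app f (app g x))),
     one = vlam (vfst G) (\<lambda>x. x)\<rparr>"

definition inner_aut :: "'v::zf \<Rightarrow> 'v \<Rightarrow> 'v" where
  "inner_aut G g = vlam (vfst G) (\<lambda>x. g \<otimes>\<^bsub>struct G\<^esub> x \<otimes>\<^bsub>struct G\<^esub> inv\<^bsub>struct G\<^esub> g)"

text \<open>\<open>H\<close> is \<open>Aut G\<close>, where each \<open>x\<close> in \<open>G\<close> is identified with the inner automorphism it induces: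
  the isomorphism \<open>j\<close> undoes the identification.  That \<open>G\<close> is a subgroup of \<open>H\<close> follows.\<close>

definition is_Aut_over :: "'v::zf \<Rightarrow> 'v \<Rightarrow> bool" where
  "is_Aut_over G H \<longleftrightarrow> is_group H \<and> elts (vfst G) \<subseteq> elts (vfst H) \<and>
     (\<exists>j. fun_on j (vfst H) \<and> app j \<in> iso (struct H) (Aut G) \<and>
          (\<forall>x\<in>elts (vfst G). app j x = inner_aut G x))"

text \<open>\<open>T\<close> is an initial segment of the automorphism tower of \<open>G\<close>, consisting of the groups with
  index less than \<open>d\<close>.  Because of the identifications it is determined by \<open>G\<close> and \<open>d\<close> up to an
  isomorphism over \<open>G\<close>.\<close>

definition aut_tower :: "'v::zf \<Rightarrow> 'v \<Rightarrow> 'v \<Rightarrow> bool" where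
  "aut_tower G d T \<longleftrightarrow> Ord d \<and> fun_on T d \<and>
     (vzero \<in> elts d \<longrightarrow> app T vzero = G) \<and>
     (\<forall>a. vsucc a \<in> elts d \<longrightarrow> is_Aut_over (app T a) (app T (vsucc a))) \<and>
     (\<forall>a\<in>elts d. Limit_Ord a \<longrightarrow>
        app T a = opair (vset (\<Union>b\<in>elts a. elts (vfst (app T b))))
                        (vset (\<Union>b\<in>elts a. elts (vsnd (app T b)))))"

text \<open>\<open>t\<close> is \<open>\<tau>\<^sub>G\<close>.  A tower with indices up to \<open>t + 1\<close> suffices to decide this.\<close>

definition is_tau :: "'v::zf \<Rightarrow> 'v \<Rightarrow> bool" where
  "is_tau G t \<longleftrightarrow> Ord t \<and>
     (\<exists>T. aut_tower G (vsucc (vsucc t)) T \<and>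
          app T (vsucc t) = app T t \<and>
          (\<forall>a\<in>elts t. app T (vsucc a) \<noteq> app T a))"

definition bounds_taus :: "'v::zf \<Rightarrow> 'v \<Rightarrow> bool" where
  "bounds_taus k a \<longleftrightarrow>
     (\<forall>G. centerless_group G \<and> card_le (vfst G) k \<longrightarrow> (\<exists>t. is_tau G t \<and> t \<in> elts a))"

definition is_tau_card :: "'v::zf \<Rightarrow> 'v \<Rightarrow> bool" where
  "is_tau_card k t \<longleftrightarrow> least_Ord (bounds_taus k) t"

end

theory Submission
  imports Defs
begin

text \<open>
  For the tower \<open>G\<^sup>\<alpha>\<close> of a centerless group \<open>G\<close>, the centralizer of \<open>G\<close> in \<open>G\<^sup>\<alpha>\<close> is trivial.  An
  element \<open>x\<close> of \<open>G\<^sup>\<alpha>\<close> is therefore determined by the map \<open>g \<mapsto> x g x\<inverse>\<close> on \<open>G\<close>, and for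
  \<open>x \<in> G\<^sup>\<beta>\<^sup>+\<^sup>1\<close> its values lie in \<open>G\<^sup>\<beta>\<close>.  Put \<open>x\<^sub>(\<^sub>) = x\<close> and let \<open>x\<^sub>s\<^sub>g\<close> be the conjugate of \<open>g\<close> by
  \<open>x\<^sub>s\<close>, for finite sequences \<open>s\<close> in \<open>G\<close>.  By induction on the level, \<open>x\<close> is determined by the
  set of those pairs \<open>(s, g)\<close> with \<open>x\<^sub>s = g \<in> G\<close>.  If the universe of \<open>G\<close> is a subset of \<open>k\<close>, this set
  and the multiplication table of \<open>G\<close> are coded by a single subset \<open>X\<close> of the finite sequences of
  elements of \<open>k\<close>.  Mapping \<open>X\<close> to the level at which the coded \<open>x\<close> appears is a map from
  \<open>\<P>(\<^sup>\<omega>\<^sup>>k)\<close> whose range contains every \<open>\<alpha>\<close> with \<open>G\<^sup>\<alpha>\<^sup>+\<^sup>1 \<noteq> G\<^sup>\<alpha>\<close>.  Hence all towers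
  stop, by Replacement, and the supremum of their heights is an image of \<open>\<P>(\<^sup>\<omega>\<^sup>>k)\<close>.

  Since the model has only first-order Separation and Replacement, every predicate used in a
  recursion or an induction inside the model is shown to be definable with parameters.
\<close>

section \<open>Definability\<close>

text \<open>The trivial centralizer does not follow by composing steps, since \<open>G\<close> need
  not be normal beyond the next group. It comes from commutators: if \<open>z\<close> in level a+1
  centralizes \<open>G\<close> and level b, with b below a, then the commutator of \<open>z\<close>
  with any \<open>y\<close> of level b+1 lies in level a and centralizes level b, so it is trivial
  by the hypothesis on level a. Thus \<open>z\<close> centralizes ever higher levels, up to level a,
  and is the identity automorphism.

  The multiplication table belongs to the code because one map must serve all groups at once: from
  \<open>X\<close> alone come first the group, then its tower, then the element and its level. The
  level is not coded; elements of different levels with equal codes are shown to be equal inside the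
  larger group.

  The definition of the height asks for a tower that starts with \<open>G\<close> itself and whose
  groups are literal subsets of each other, while only a copy of \<open>G\<close> lies inside
  \<open>k\<close>. The tower of the copy is built by explicit recursion, with fresh names supplied
  by foundation, and is carried back by an injective renaming; no choices are made.\<close>

primrec fm_vars :: "fm \<Rightarrow> nat set" where
  "fm_vars (Mem i j) = {i, j}"
| "fm_vars (Eq i j) = {i, j}"
| "fm_vars (Neg \<phi>) = fm_vars \<phi>"
| "fm_vars (Conj \<phi> \<psi>) = fm_vars \<phi> \<union> fm_vars \<psi>"
| "fm_vars (All i \<phi>) = insert i (fm_vars \<phi>)"

lemma finite_fm_vars: "finite (fm_vars \<phi>)"
  by (induction \<phi>) auto

lemma sat_cong:
  assumes "\<And>i. i \<in> fm_vars \<phi> \<Longrightarrow> s i = t i"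
  shows "sat E s \<phi> = sat E t \<phi>"
  using assms
proof (induction \<phi> arbitrary: s t)
  case (All i \<phi>)
  have "sat E (s(i := x)) \<phi> = sat E (t(i := x)) \<phi>" for x
    by (rule All.IH) (use All.prems in auto)
  then show ?case by simp
next
  case (Neg \<phi>)
  then show ?case by (metis fm_vars.simps(3) sat.simps(3))
next
  case (Conj \<phi> \<psi>)
  then show ?case by (metis UnCI fm_vars.simps(4) sat.simps(4))
qed auto

text \<open>The map \<open>\<rho>\<close> need not be injective. Capture is avoided by giving each
  bound variable a name \<open>j\<close> outside the image under \<open>\<rho>\<close> of the
  variables of its body; such a name exists because a formula has finitely many variables.\<close>

lemma sat_rename: "\<exists>\<phi>'. \<forall>s. sat E s \<phi>' = sat E (\<lambda>n. s (\<rho> n)) \<phi>"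
proof (induction \<phi> arbitrary: \<rho>)
  case (Mem i j)
  show ?case by (rule exI[of _ "Mem (\<rho> i) (\<rho> j)"]) simp
next
  case (Eq i j)
  show ?case by (rule exI[of _ "Eq (\<rho> i) (\<rho> j)"]) simp
next
  case (Neg \<phi>)
  then show ?case by (metis sat.simps(3))
next
  case (Conj \<phi> \<psi>)
  then show ?case by (metis sat.simps(4))
next
  case (All i \<phi>)
  obtain j where j: "j \<notin> \<rho> ` fm_vars \<phi>"
    using ex_new_if_finite[OF infinite_UNIV_nat] finite_fm_vars by blast
  obtain \<phi>' where "\<forall>s. sat E s \<phi>' = sat E (\<lambda>n. s ((\<rho>(i := j)) n)) \<phi>"
    using All.IH by blast
  moreover have "sat E (\<lambda>n. (s(j := x)) ((\<rho>(i := j)) n)) \<phi> = sat E ((\<lambda>n. s (\<rho> n))(i := x)) \<phi>"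
    for s x by (rule sat_cong) (use j in auto)
  ultimately have "\<forall>s. sat E s (All j \<phi>') = sat E (\<lambda>n. s (\<rho> n)) (All i \<phi>)"
    by simp
  then show ?case by blast
qed

text \<open>Environments are de Bruijn style: the variables of a predicate sit at the even positions of
  the assignment, parameters from the model at the odd positions.\<close>

definition interleave :: "(nat \<Rightarrow> 'a) \<Rightarrow> (nat \<Rightarrow> 'a) \<Rightarrow> nat \<Rightarrow> 'a" where
  "interleave s p = (\<lambda>n. if even n then s (n div 2) else p (n div 2))"

definition definable :: "((nat \<Rightarrow> 'v::zf) \<Rightarrow> bool) \<Rightarrow> bool" where
  "definable P \<longleftrightarrow> (\<exists>\<phi> p. \<forall>s. sat elts (interleave s p) \<phi> = P s)"

definition definable_fn :: "((nat \<Rightarrow> 'v::zf) \<Rightarrow> 'v) \<Rightarrow> bool" where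
  "definable_fn F \<longleftrightarrow> definable (\<lambda>s. s 0 = F (\<lambda>n. s (Suc n)))"

named_theorems def_intro

lemma interleave_simps [simp]:
  "interleave s p (2 * n) = s n" "interleave s p (Suc (2 * n)) = p n"
  by (auto simp: interleave_def)

lemma definableI:
  fixes P :: "(nat \<Rightarrow> 'v::zf) \<Rightarrow> bool"
  assumes "\<And>s. sat elts (\<lambda>n. interleave s p (\<rho> n)) \<phi> = P s"
  shows "definable P"
proof -
  obtain \<phi>' where "\<forall>s :: nat \<Rightarrow> 'v. sat elts s \<phi>' = sat elts (\<lambda>n. s (\<rho> n)) \<phi>"
    using sat_rename by blast
  then have "\<forall>s. sat elts (interleave s p) \<phi>' = P s" by (simp add: assms)
  then show ?thesis unfolding definable_def by blast
qed

section \<open>Closure under connectives, quantifiers and change of variables\<close>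

lemma definable_const [def_intro]: "definable (\<lambda>s. c)"
proof (cases c)
  case True
  show ?thesis unfolding definable_def by (rule exI[of _ "Eq 0 0"]) (simp add: True)
next
  case False
  show ?thesis unfolding definable_def by (rule exI[of _ "Neg (Eq 0 0)"]) (simp add: False)
qed

lemma definable_not [def_intro]:
  assumes "definable P" shows "definable (\<lambda>s. \<not> P s)"
proof -
  obtain \<phi> p where p: "\<And>s. sat elts (interleave s p) \<phi> = P s"
    using assms unfolding definable_def by metis
  then have "\<forall>s. sat elts (interleave s p) (Neg \<phi>) = (\<not> P s)" by simp
  then show ?thesis unfolding definable_def by blast
qed

text \<open>The two formulas may come with different parameters. The parameter lists are interleaved
  once more, and each formula is renamed so as to read its own half: parameter \<open>m\<close> of
  \<open>p\<close> becomes parameter \<open>2 * m\<close>, that of \<open>q\<close> becomes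
  parameter \<open>2 * m + 1\<close>.\<close>

lemma definable_conj [def_intro]:
  fixes P Q :: "(nat \<Rightarrow> 'v::zf) \<Rightarrow> bool"
  assumes "definable P" "definable Q" shows "definable (\<lambda>s. P s \<and> Q s)"
proof -
  obtain \<phi> p where p: "\<And>s. sat elts (interleave s p) \<phi> = P s"
    using assms(1) unfolding definable_def by metis
  obtain \<psi> q where q: "\<And>s. sat elts (interleave s q) \<psi> = Q s"
    using assms(2) unfolding definable_def by metis
  let ?r = "interleave p q"
  let ?\<rho> = "\<lambda>n. if even n then n else Suc (2 * (2 * (n div 2)))"
  let ?\<sigma> = "\<lambda>n. if even n then n else Suc (2 * Suc (2 * (n div 2)))"
  have \<rho>: "(\<lambda>n. interleave s ?r (?\<rho> n)) = interleave s p" for s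
  proof
    fix n
    show "interleave s ?r (?\<rho> n) = interleave s p n"
      by (cases "even n") (simp_all only: interleave_simps if_True if_False interleave_def[of s p],
          simp_all add: interleave_def)
  qed
  have \<sigma>: "(\<lambda>n. interleave s ?r (?\<sigma> n)) = interleave s q" for s
  proof
    fix n
    show "interleave s ?r (?\<sigma> n) = interleave s q n"
      by (cases "even n") (simp_all only: interleave_simps if_True if_False interleave_def[of s q],
          simp_all add: interleave_def)
  qed
  obtain \<phi>' where \<phi>': "\<And>s :: nat \<Rightarrow> 'v. sat elts s \<phi>' = sat elts (\<lambda>n. s (?\<rho> n)) \<phi>"
    using sat_rename[of elts ?\<rho> \<phi>] by blast
  obtain \<psi>' where \<psi>': "\<And>s :: nat \<Rightarrow> 'v. sat elts s \<psi>' = sat elts (\<lambda>n. s (?\<sigma> n)) \<psi>"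
    using sat_rename[of elts ?\<sigma> \<psi>] by blast
  have "sat elts (interleave s ?r) \<phi>' = P s" for s by (simp only: \<phi>' \<rho> p)
  moreover have "sat elts (interleave s ?r) \<psi>' = Q s" for s by (simp only: \<psi>' \<sigma> q)
  ultimately have "\<forall>s. sat elts (interleave s ?r) (Conj \<phi>' \<psi>') = (P s \<and> Q s)"
    by simp
  then show ?thesis unfolding definable_def by blast
qed

lemma definable_disj [def_intro]:
  assumes "definable P" "definable Q" shows "definable (\<lambda>s. P s \<or> Q s)"
proof -
  have "definable (\<lambda>s. \<not> (\<not> P s \<and> \<not> Q s))" by (intro definable_not definable_conj assms)
  then show ?thesis by simp
qed

lemma definable_imp [def_intro]:
  assumes "definable P" "definable Q" shows "definable (\<lambda>s. P s \<longrightarrow> Q s)"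
proof -
  have "definable (\<lambda>s. \<not> P s \<or> Q s)" by (intro definable_not definable_disj assms)
  then show ?thesis by (simp only: imp_conv_disj)
qed

lemma definable_iff [def_intro]:
  assumes "definable P" "definable Q" shows "definable (\<lambda>s. P s \<longleftrightarrow> Q s)"
proof -
  have "definable (\<lambda>s. (P s \<longrightarrow> Q s) \<and> (Q s \<longrightarrow> P s))"
    by (intro definable_imp definable_conj assms)
  then show ?thesis by (simp only: iff_conv_conj_imp)
qed

lemma definable_if_bool [def_intro]:
  assumes "definable P" "definable Q" "definable R" shows "definable (\<lambda>s. if P s then Q s else R s)"
proof -
  have "definable (\<lambda>s. (P s \<longrightarrow> Q s) \<and> (\<not> P s \<longrightarrow> R s))"
    by (intro definable_imp definable_conj definable_not assms)
  then show ?thesis by (simp only: if_bool_eq_conj)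
qed

text \<open>A predicate with an argument \<open>x\<close> is presented with \<open>x\<close> as
  variable 0 and the other variables shifted by one. All rules for binders use this shape, so that
  \<open>def_intro\<close> can pass under them.\<close>

lemma definable_all [def_intro]:
  fixes P :: "(nat \<Rightarrow> 'v::zf) \<Rightarrow> 'v \<Rightarrow> bool"
  assumes "definable (\<lambda>s. P (\<lambda>n. s (Suc n)) (s 0))"
  shows "definable (\<lambda>s. \<forall>x. P s x)"
proof -
  obtain \<phi> p where p: "\<And>s. sat elts (interleave s p) \<phi> = P (\<lambda>n. s (Suc n)) (s 0)"
    using assms unfolding definable_def by metis
  obtain N where N: "\<And>i. i \<in> fm_vars \<phi> \<Longrightarrow> i < N"
    using finite_fm_vars[of \<phi>] finite_nat_set_iff_bounded by auto
  \<comment> \<open>The bound variable is placed at position \<open>2 * N\<close>, beyond every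
    position that the shifted formula reads, and variable \<open>Suc m\<close> moves down to
    variable \<open>m\<close>.\<close>
  let ?\<rho> = "\<lambda>n. if n = 0 then 2 * N else if even n then 2 * (n div 2 - 1) else n"
  obtain \<phi>' where \<phi>': "\<And>s :: nat \<Rightarrow> 'v. sat elts s \<phi>' = sat elts (\<lambda>n. s (?\<rho> n)) \<phi>"
    using sat_rename[of elts ?\<rho> \<phi>] by blast
  have "sat elts (\<lambda>n. ((interleave s p)(2 * N := x)) (?\<rho> n)) \<phi> = P s x" for s x
  proof -
    have "sat elts (\<lambda>n. ((interleave s p)(2 * N := x)) (?\<rho> n)) \<phi>
        = sat elts (interleave (case_nat x s) p) \<phi>"
    proof (rule sat_cong)
      fix i assume "i \<in> fm_vars \<phi>"
      then have "i < N" by (rule N)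
      show "((interleave s p)(2 * N := x)) (?\<rho> i) = interleave (case_nat x s) p i"
      proof (cases "even i")
        case True
        then obtain m where "i = 2 * m" by blast
        then show ?thesis using \<open>i < N\<close> by (cases m) (auto simp: interleave_def)
      next
        case False
        then show ?thesis by (auto simp: interleave_def)
      qed
    qed
    then show ?thesis by (simp add: p)
  qed
  then have "\<forall>s. sat elts (interleave s p) (All (2 * N) \<phi>') = (\<forall>x. P s x)"
    by (simp add: \<phi>' del: fun_upd_apply)
  then show ?thesis unfolding definable_def by blast
qed

lemma definable_ex [def_intro]:
  assumes "definable (\<lambda>s. P (\<lambda>n. s (Suc n)) (s 0))"
  shows "definable (\<lambda>s. \<exists>x. P s x)"
proof -
  have "definable (\<lambda>s. \<not> (\<forall>x. \<not> P s x))" by (intro definable_not definable_all assms)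
  then show ?thesis by simp
qed

lemma definable_rename:
  assumes "definable P" shows "definable (\<lambda>s. P (\<lambda>n. s (\<rho> n)))"
proof -
  obtain \<phi> p where p: "\<And>s. sat elts (interleave s p) \<phi> = P s"
    using assms unfolding definable_def by metis
  let ?\<rho> = "\<lambda>n. if even n then 2 * \<rho> (n div 2) else n"
  have "(\<lambda>n. interleave s p (?\<rho> n)) = interleave (\<lambda>n. s (\<rho> n)) p" for s
    by (rule ext) (simp add: interleave_def)
  then show ?thesis by (intro definableI[where \<phi> = \<phi> and \<rho> = ?\<rho> and p = p]) (simp add: p)
qed

text \<open>The variables from \<open>m\<close> on become parameters with values from
  \<open>t\<close>. Separation and Replacement apply to predicates of one or two variables, while
  the closure rules speak of whole environments; this leads from the latter to the former.\<close>

lemma definable_freeze_from: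
  assumes "definable P" shows "definable (\<lambda>s. P (\<lambda>n. if n < m then s n else t n))"
proof -
  obtain \<phi> p where p: "\<And>s. sat elts (interleave s p) \<phi> = P s"
    using assms unfolding definable_def by metis
  let ?r = "interleave t p"
  let ?\<rho> = "\<lambda>n. if even n then if n div 2 < m then n else Suc (2 * (2 * (n div 2)))
                else Suc (2 * (Suc (2 * (n div 2))))"
  have "interleave s ?r (?\<rho> n) = interleave (\<lambda>n. if n < m then s n else t n) p n" for s n
    by (simp add: interleave_def[of s] interleave_def[of "\<lambda>n. if n < m then s n else t n"])
      (simp add: interleave_def)
  then show ?thesis
    by (intro definableI[where \<phi> = \<phi> and \<rho> = ?\<rho> and p = ?r]) (simp add: p)
qed

lemma definable_freeze:
  assumes "definable (\<lambda>s. P (\<lambda>n. s (Suc n)) (s 0))" shows "definable (\<lambda>s. P t (s 0))"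
proof -
  from definable_freeze_from[OF assms, of 1 "\<lambda>n. t (n - 1)"] show ?thesis by simp
qed

lemma definable_fn_freeze:
  assumes "definable_fn (\<lambda>s. F (\<lambda>n. s (Suc n)) (s 0))" shows "definable_fn (\<lambda>s. F t (s 0))"
proof -
  have "definable (\<lambda>s. s 0 = F (\<lambda>n. s (Suc (Suc n))) (s 1))"
    using assms by (simp add: definable_fn_def)
  from definable_freeze_from[OF this, of 2 "\<lambda>n. t (n - 2)"]
  have "definable (\<lambda>s. s 0 = F t (s 1))" by simp
  then show ?thesis by (simp add: definable_fn_def)
qed

section \<open>Substitution of definable functions\<close>

lemma definable_subst:
  assumes "definable (\<lambda>s. P (\<lambda>n. s (Suc n)) (s 0))" "definable_fn F"
  shows "definable (\<lambda>s. P s (F s))"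
proof -
  have "definable (\<lambda>s. \<exists>x. x = F s \<and> P s x)"
    using assms by (intro definable_ex definable_conj) (simp_all add: definable_fn_def)
  then show ?thesis by simp
qed

lemma definable_fn_rename:
  assumes "definable_fn F" shows "definable_fn (\<lambda>s. F (\<lambda>n. s (\<rho> n)))"
  using definable_rename[of "\<lambda>s. s 0 = F (\<lambda>n. s (Suc n))" "case_nat 0 (\<lambda>n. Suc (\<rho> n))"] assms
  by (simp add: definable_fn_def)

lemma definable_fn_subst:
  assumes "definable_fn (\<lambda>s. H (\<lambda>n. s (Suc n)) (s 0))" "definable_fn F"
  shows "definable_fn (\<lambda>s. H s (F s))"
proof -
  \<comment> \<open>Exchanges the first two variables: the argument of \<open>H\<close> has to be
    variable 0 for \<open>definable_subst\<close>, and the value moves to variable 1.\<close>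
  let ?\<rho> = "\<lambda>n. case n of 0 \<Rightarrow> 1 | Suc 0 \<Rightarrow> 0 | Suc (Suc n) \<Rightarrow> Suc (Suc n)"
  have "definable (\<lambda>s. s 0 = H (\<lambda>n. s (Suc (Suc n))) (s (Suc 0)))"
    using assms(1) by (simp add: definable_fn_def)
  from definable_rename[OF this, of ?\<rho>]
  have "definable (\<lambda>s. (\<lambda>s x. s 0 = H (\<lambda>n. s (Suc n)) x) (\<lambda>n. s (Suc n)) (s 0))" by simp
  from definable_subst[OF this definable_fn_rename[OF assms(2), of Suc]]
  show ?thesis by (simp add: definable_fn_def)
qed

text \<open>In this family of rules \<open>R\<close> and \<open>f\<close> do not see the
  environment. A notion thus has to be unfolded only once, with plain variables as arguments, and is
  then definable for arbitrary definable arguments.\<close>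

lemma definable_sub1:
  assumes "definable (\<lambda>s. R (s 0))" "definable_fn F" shows "definable (\<lambda>s. R (F s))"
  using definable_subst[of "\<lambda>s. R" F] assms by simp

lemma definable_sub2:
  assumes "definable (\<lambda>s. R (s 0) (s 1))" "definable_fn F" "definable_fn G"
  shows "definable (\<lambda>s. R (F s) (G s))"
proof -
  have "definable (\<lambda>s. R (s 1) (s 0))"
    using definable_rename[OF assms(1), of "\<lambda>n. if n = 0 then 1 else 0"] by simp
  then have "definable (\<lambda>s. (\<lambda>s x. R (s 0) x) (\<lambda>n. s (Suc n)) (s 0))" by simp
  from definable_subst[OF this definable_fn_rename[OF assms(3), of Suc]]
  show ?thesis using definable_subst[of "\<lambda>s x. R x (G s)" F] assms(2) by simp
qed

lemma definable_sub3:
  assumes "definable (\<lambda>s. R (s 0) (s 1) (s 2))" "definable_fn F" "definable_fn G" "definable_fn H"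
  shows "definable (\<lambda>s. R (F s) (G s) (H s))"
proof -
  have "definable (\<lambda>s. R (s 1) (s 2) (s 0))"
    using definable_rename[OF assms(1), of "\<lambda>n. if n = 0 then 1 else if n = 1 then 2 else 0"] by simp
  then have "definable (\<lambda>s. R (s 0) (s 1) (H (\<lambda>n. s (Suc (Suc n)))))"
    using definable_subst[of "\<lambda>s x. R (s 0) (s 1) x" "\<lambda>s. H (\<lambda>n. s (Suc (Suc n)))"]
      definable_fn_rename[OF assms(4), of "\<lambda>n. Suc (Suc n)"] by (simp add: numeral_2_eq_2)
  from definable_rename[OF this, of "\<lambda>n. case n of 0 \<Rightarrow> 1 | Suc 0 \<Rightarrow> 0 | Suc (Suc n) \<Rightarrow> Suc (Suc n)"]
  have "definable (\<lambda>s. R (s 1) (s 0) (H (\<lambda>n. s (Suc (Suc n)))))" by simp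
  then have "definable (\<lambda>s. R (s 0) (G (\<lambda>n. s (Suc n))) (H (\<lambda>n. s (Suc n))))"
    using definable_subst[of "\<lambda>s x. R (s 0) x (H (\<lambda>n. s (Suc n)))" "\<lambda>s. G (\<lambda>n. s (Suc n))"]
      definable_fn_rename[OF assms(3), of Suc] by simp
  then show ?thesis using definable_subst[of "\<lambda>s x. R x (G s) (H s)" F] assms(2) by simp
qed

lemma definable_fn_sub1:
  assumes "definable_fn (\<lambda>s. f (s 0))" "definable_fn F" shows "definable_fn (\<lambda>s. f (F s))"
  using definable_fn_subst[of "\<lambda>s. f" F] assms by simp

lemma definable_fn_sub2:
  assumes "definable_fn (\<lambda>s. f (s 0) (s 1))" "definable_fn F" "definable_fn G"
  shows "definable_fn (\<lambda>s. f (F s) (G s))"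
proof -
  have "definable_fn (\<lambda>s. f (s 1) (s 0))"
    using definable_fn_rename[OF assms(1), of "\<lambda>n. if n = 0 then 1 else 0"] by simp
  then have "definable_fn (\<lambda>s. (\<lambda>s x. f (s 0) x) (\<lambda>n. s (Suc n)) (s 0))" by simp
  from definable_fn_subst[OF this definable_fn_rename[OF assms(3), of Suc]]
  show ?thesis using definable_fn_subst[of "\<lambda>s x. f x (G s)" F] assms(2) by simp
qed

lemma definable_fn_sub3:
  assumes "definable_fn (\<lambda>s. f (s 0) (s 1) (s 2))" "definable_fn F" "definable_fn G" "definable_fn H"
  shows "definable_fn (\<lambda>s. f (F s) (G s) (H s))"
proof -
  have "definable_fn (\<lambda>s. f (s 1) (s 2) (s 0))"
    using definable_fn_rename[OF assms(1), of "\<lambda>n. if n = 0 then 1 else if n = 1 then 2 else 0"]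
    by simp
  then have "definable_fn (\<lambda>s. f (s 0) (s 1) (H (\<lambda>n. s (Suc (Suc n)))))"
    using definable_fn_subst[of "\<lambda>s x. f (s 0) (s 1) x" "\<lambda>s. H (\<lambda>n. s (Suc (Suc n)))"]
      definable_fn_rename[OF assms(4), of "\<lambda>n. Suc (Suc n)"] by (simp add: numeral_2_eq_2)
  from definable_fn_rename[OF this, of "\<lambda>n. case n of 0 \<Rightarrow> 1 | Suc 0 \<Rightarrow> 0 | Suc (Suc n) \<Rightarrow> Suc (Suc n)"]
  have "definable_fn (\<lambda>s. f (s 1) (s 0) (H (\<lambda>n. s (Suc (Suc n)))))" by simp
  then have "definable_fn (\<lambda>s. f (s 0) (G (\<lambda>n. s (Suc n))) (H (\<lambda>n. s (Suc n))))"
    using definable_fn_subst[of "\<lambda>s x. f (s 0) x (H (\<lambda>n. s (Suc n)))" "\<lambda>s. G (\<lambda>n. s (Suc n))"]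
      definable_fn_rename[OF assms(3), of Suc] by simp
  then show ?thesis using definable_fn_subst[of "\<lambda>s x. f x (G s) (H s)" F] assms(2) by simp
qed

section \<open>Atomic formulas, bounded quantifiers and definite descriptions\<close>

lemma definable_fn_var [def_intro]: "definable_fn (\<lambda>s :: nat \<Rightarrow> 'v::zf. s i)"
proof -
  let ?\<rho> = "\<lambda>n::nat. if n = 0 then 0 else 2 * Suc i"
  have "interleave s p (?\<rho> 0) = s 0" "interleave s p (?\<rho> 1) = s (Suc i)" for s p :: "nat \<Rightarrow> 'v"
    using interleave_simps(1)[of s p 0] interleave_simps(1)[of s p "Suc i"] by auto
  then show ?thesis
    unfolding definable_fn_def
    by (intro definableI[where \<phi> = "Eq 0 1" and \<rho> = ?\<rho> and p = undefined]) simp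
qed

lemma definable_fn_const [def_intro]: "definable_fn (\<lambda>s. c :: 'v::zf)"
proof -
  have "interleave s p 0 = s 0" "interleave s p 1 = p 0" for s p :: "nat \<Rightarrow> 'v"
    using interleave_simps[of s p 0] by auto
  then show ?thesis
    unfolding definable_fn_def
    by (intro definableI[where \<phi> = "Eq 0 1" and \<rho> = id and p = "\<lambda>_. c"]) simp
qed

lemma definable_mem [def_intro]:
  fixes F :: "(nat \<Rightarrow> 'v::zf) \<Rightarrow> 'v"
  assumes "definable_fn F" "definable_fn G" shows "definable (\<lambda>s. F s \<in> elts (G s))"
proof (rule definable_sub2[OF _ assms])
  have "interleave s p 0 = s 0" "interleave s p 2 = s 1" for s p :: "nat \<Rightarrow> 'v"
    using interleave_simps(1)[of s p 0] interleave_simps(1)[of s p 1] by auto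
  then show "definable (\<lambda>s :: nat \<Rightarrow> 'v. s 0 \<in> elts (s 1))"
    by (intro definableI[where \<phi> = "Mem 0 2" and \<rho> = id and p = undefined]) simp
qed

lemma definable_eq [def_intro]:
  fixes F :: "(nat \<Rightarrow> 'v::zf) \<Rightarrow> 'v"
  assumes "definable_fn F" "definable_fn G" shows "definable (\<lambda>s. F s = G s)"
proof (rule definable_sub2[OF _ assms])
  have "interleave s p 0 = s 0" "interleave s p 2 = s 1" for s p :: "nat \<Rightarrow> 'v"
    using interleave_simps(1)[of s p 0] interleave_simps(1)[of s p 1] by auto
  then show "definable (\<lambda>s :: nat \<Rightarrow> 'v. s 0 = s 1)"
    by (intro definableI[where \<phi> = "Eq 0 2" and \<rho> = id and p = undefined]) simp
qed

lemma definable_ball [def_intro]: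
  assumes "definable_fn A" "definable (\<lambda>s. P (\<lambda>n. s (Suc n)) (s 0))"
  shows "definable (\<lambda>s. \<forall>x\<in>elts (A s). P s x)"
  unfolding Ball_def
  by (intro def_intro assms definable_fn_rename[OF assms(1), of Suc])

lemma definable_bex [def_intro]:
  assumes "definable_fn A" "definable (\<lambda>s. P (\<lambda>n. s (Suc n)) (s 0))"
  shows "definable (\<lambda>s. \<exists>x\<in>elts (A s). P s x)"
  unfolding Bex_def
  by (intro def_intro assms definable_fn_rename[OF assms(1), of Suc])

lemma definable_subset [def_intro]:
  assumes "definable_fn A" "definable_fn B" shows "definable (\<lambda>s. elts (A s) \<subseteq> elts (B s))"
  unfolding subset_iff
  by (intro def_intro assms[THEN definable_fn_rename, of Suc])

lemma definable_ex1 [def_intro]: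
  assumes "definable (\<lambda>s. P (\<lambda>n. s (Suc n)) (s 0))"
  shows "definable (\<lambda>s. \<exists>!x. P s x)"
proof -
  have *: "definable (\<lambda>s. P (\<lambda>n. s (Suc (Suc n))) (s 0))"
    using definable_rename[OF assms, of "case_nat 0 (\<lambda>n. Suc (Suc n))"] by simp
  have "definable (\<lambda>s. \<exists>x. \<forall>y. P s y \<longleftrightarrow> y = x)"
    by (intro def_intro *)
  moreover have "(\<exists>!x. P s x) \<longleftrightarrow> (\<exists>x. \<forall>y. P s y \<longleftrightarrow> y = x)" for s by auto
  ultimately show ?thesis by simp
qed

text \<open>\<open>THE\<close> takes an unspecified value when there is no unique witness, and the
  way this value varies with \<open>P\<close> need not be definable. A fixed default makes the
  operator definable.\<close>

definition the_or :: "('v::zf \<Rightarrow> bool) \<Rightarrow> 'v" where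
  "the_or P = (if \<exists>!x. P x then THE x. P x else vzero)"

lemma the_or_eq: "P x \<Longrightarrow> (\<And>y. P y \<Longrightarrow> y = x) \<Longrightarrow> the_or P = x"
  unfolding the_or_def by (metis (mono_tags, lifting) the_equality)

lemma the_orI: "\<exists>!x. P x \<Longrightarrow> P (the_or P)"
  unfolding the_or_def by (simp add: theI')

lemma definable_fn_the_or [def_intro]:
  assumes "definable (\<lambda>s. P (\<lambda>n. s (Suc n)) (s 0))"
  shows "definable_fn (\<lambda>s. the_or (P s))"
proof -
  have *: "definable (\<lambda>s. P (\<lambda>n. s (Suc (Suc n))) (s 0))"
    using definable_rename[OF assms, of "case_nat 0 (\<lambda>n. Suc (Suc n))"] by simp
  have "x = the_or Q \<longleftrightarrow> (\<exists>!y. Q y) \<and> Q x \<or> \<not> (\<exists>!y. Q y) \<and> x = vzero" for x and Q :: "'a \<Rightarrow> bool"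
    using the_orI[of Q] by (auto simp: the_or_def)
  then show ?thesis
    unfolding definable_fn_def by (simp only:) (intro def_intro * assms)
qed

lemma definable_fn_if [def_intro]:
  assumes "definable P" "definable_fn F" "definable_fn G"
  shows "definable_fn (\<lambda>s. if P s then F s else G s)"
proof -
  have "definable (\<lambda>s. if P (\<lambda>n. s (Suc n)) then s 0 = F (\<lambda>n. s (Suc n)) else s 0 = G (\<lambda>n. s (Suc n)))"
    by (intro def_intro definable_rename[OF assms(1)]
        assms(2,3)[THEN definable_fn_rename])
  then show ?thesis
    unfolding definable_fn_def by (rule back_subst[of definable]) auto
qed

abbreviation definable1 :: "('v::zf \<Rightarrow> bool) \<Rightarrow> bool" where
  "definable1 P \<equiv> definable (\<lambda>s. P (s 0))"

abbreviation definable_fn1 :: "('v::zf \<Rightarrow> 'v) \<Rightarrow> bool" where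
  "definable_fn1 F \<equiv> definable_fn (\<lambda>s. F (s 0))"

section \<open>Sets\<close>

definition small :: "'v::zf set \<Rightarrow> bool" where
  "small X \<longleftrightarrow> (\<exists>x. elts x = X)"

lemma vset_elts [simp]: "vset (elts x) = x"
  unfolding vset_def by (rule the_equality) (auto intro: extensionality)

lemma elts_vset [simp]: "small X \<Longrightarrow> elts (vset X) = X"
  by (auto simp: small_def)

lemma eq_vset_iff: "small X \<Longrightarrow> x = vset X \<longleftrightarrow> elts x = X"
  by (metis elts_vset vset_elts)

lemma small_pair [simp]: "small {x, y}"
  using pairing by (simp add: small_def)

lemma small_single [simp]: "small {x}"
  using small_pair[of x x] by simp

lemma small_Union [simp]: "small (\<Union>y\<in>elts x. elts y)"
  using union by (simp add: small_def)

lemma small_Pow [simp]: "small {y. elts y \<subseteq> elts x}"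
  using powerset by (simp add: small_def)

lemma interleave_upd0: "(interleave s p)(0 := y) = interleave (s(0 := y)) p"
  by (rule ext) (auto simp: interleave_def elim: evenE)

lemma small_sep:
  fixes x :: "'v::zf"
  assumes "definable1 P" shows "small {y \<in> elts x. P y}"
proof -
  obtain \<phi> p where p: "\<And>s. sat elts (interleave s p) \<phi> = P (s 0)"
    using assms unfolding definable_def by metis
  then show ?thesis
    using separation[of x "interleave undefined p" \<phi>] by (simp add: small_def interleave_upd0)
qed

lemma small_subset:
  assumes "definable1 P" "\<And>y. P y \<Longrightarrow> y \<in> elts x" shows "small {y. P y}"
  using small_sep[OF assms(1), of x] assms(2) by (metis (no_types, lifting) Collect_cong)

lemma small_image:
  fixes x :: "'v::zf"
  assumes "definable_fn1 F" shows "small (F ` elts x)"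
proof -
  have "definable (\<lambda>s. s 0 = F (s 1))" using assms by (simp add: definable_fn_def)
  then obtain \<phi> p where p: "\<And>s. sat elts (interleave s p) \<phi> \<longleftrightarrow> s 0 = F (s 1)"
    unfolding definable_def by metis
  \<comment> \<open>\<open>replacement\<close> expects the argument at position 0 and the value at
    position 1, while the formula for the graph of \<open>F\<close> has its value at position 0 and
    its argument at position 2. All other positions are filled from \<open>p\<close> and move up by
    two, which keeps 0 and 1 free.\<close>
  let ?\<rho> = "\<lambda>n. if n = 0 then 1 else if n = 2 then 0 else n + 2"
  obtain \<phi>' where \<phi>': "\<And>s :: nat \<Rightarrow> 'v. sat elts s \<phi>' = sat elts (\<lambda>n. s (?\<rho> n)) \<phi>"
    using sat_rename[of elts ?\<rho> \<phi>] by blast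
  let ?e = "\<lambda>n. p ((n - 2) div 2)"
  have "sat elts (?e(0 := y, 1 := w)) \<phi>' \<longleftrightarrow> w = F y" for y w
  proof -
    let ?s = "\<lambda>i. if i = 0 then w else if i = 1 then y else p i"
    have "(?e(0 := y, 1 := w)) (?\<rho> n) = interleave ?s p n" for n
      by (auto simp: interleave_def elim!: evenE)
    then show ?thesis by (simp add: \<phi>' p del: fun_upd_apply)
  qed
  then show ?thesis
    using replacement[of x ?e \<phi>'] by (auto simp: small_def image_def)
qed

lemma small_UN:
  assumes "definable_fn1 F" shows "small (\<Union>x\<in>elts A. elts (F x))"
  using small_Union[of "vset (F ` elts A)"] small_image[OF assms, of A] by simp

lemma small_Un [simp]: "small (elts a \<union> elts b)"
  using small_Union[of "vset {a, b}"] by simp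

lemma small_insert [simp]: "small (insert x (elts a))"
  using small_Un[of "vset {x}" a] by simp

lemma small_empty [simp]: "small {}"
  using small_sep[of "\<lambda>_. False" undefined] by (simp add: definable_const)

lemma not_mem_self: "x \<notin> elts x"
  using foundation[of "vset {x}"] by auto

lemma mem_asym: "x \<in> elts y \<Longrightarrow> y \<notin> elts x"
  using foundation[of "vset {x, y}"] by auto

lemma mem_cycle3: "x \<in> elts y \<Longrightarrow> y \<in> elts z \<Longrightarrow> z \<notin> elts x"
  using foundation[of "vset {x, y, z}"] small_insert[of x "vset {y, z}"] by auto

lemma elts_vzero [simp]: "elts vzero = {}"
  by (simp add: vzero_def)

lemma elts_eq_empty: "elts x = {} \<longleftrightarrow> x = vzero"
  by (metis elts_vzero extensionality)

lemma elts_vsucc [simp]: "elts (vsucc a) = insert a (elts a)"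
  by (simp add: vsucc_def)

lemma vpair_eq_iff: "vset {x, y} = vset {z, w} \<longleftrightarrow> {x, y} = {z, w}"
  by (metis elts_vset small_pair)

lemma opair_eq [simp]: "opair x y = opair z w \<longleftrightarrow> x = z \<and> y = w"
  unfolding opair_def using vpair_eq_iff[of x x z z] vpair_eq_iff
  by (auto simp: vpair_eq_iff doubleton_eq_iff) (metis insert_absorb2 vpair_eq_iff doubleton_eq_iff)+

lemma elts_opair: "elts (opair x y) = {vset {x}, vset {x, y}}"
  by (simp add: opair_def)

text \<open>Otherwise \<open>x\<close>, its singleton and the pair would form a membership cycle.
  This supplies elements outside a given set wherever new names are needed.\<close>

lemma opair_not_mem: "opair x y \<notin> elts x"
  using mem_cycle3[of x "vset {x}" "opair x y"] by (auto simp: elts_opair)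

lemma vfst_opair [simp]: "vfst (opair x y) = x"
  by (simp add: vfst_def)

lemma vsnd_opair [simp]: "vsnd (opair x y) = y"
  by (simp add: vsnd_def)

lemma elts_VPow [simp]: "elts (VPow A) = {B. elts B \<subseteq> elts A}"
  by (simp add: VPow_def)

section \<open>Definability of set operations\<close>

text \<open>\<open>vset\<close> is given by \<open>THE\<close>, so it is under control only where
  the set exists in the model; under the first assumption it is characterised by its
  members.\<close>

lemma definable_fn_vset:
  assumes "\<And>s. small {y. P s y}" "definable (\<lambda>s. P (\<lambda>n. s (Suc n)) (s 0))"
  shows "definable_fn (\<lambda>s. vset {y. P s y})"
proof -
  have *: "definable (\<lambda>s. P (\<lambda>n. s (Suc (Suc n))) (s 0))"
    using definable_rename[OF assms(2), of "case_nat 0 (\<lambda>n. Suc (Suc n))"] by simp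
  have "definable (\<lambda>s. \<forall>y. y \<in> elts (s 0) \<longleftrightarrow> P (\<lambda>n. s (Suc n)) y)"
    by (intro def_intro *)
  moreover have "x = vset {y. P s y} \<longleftrightarrow> (\<forall>y. y \<in> elts x \<longleftrightarrow> P s y)" for x s
    using eq_vset_iff[OF assms(1)] by blast
  ultimately show ?thesis by (simp add: definable_fn_def)
qed

definition vsep :: "'v::zf \<Rightarrow> ('v \<Rightarrow> bool) \<Rightarrow> 'v" where
  "vsep A P = vset {x \<in> elts A. P x}"

definition vimg :: "'v::zf \<Rightarrow> ('v \<Rightarrow> 'v) \<Rightarrow> 'v" where
  "vimg A F = vset (F ` elts A)"

definition vUN :: "'v::zf \<Rightarrow> ('v \<Rightarrow> 'v) \<Rightarrow> 'v" where
  "vUN A F = vset (\<Union>x\<in>elts A. elts (F x))"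

definition vun :: "'v::zf \<Rightarrow> 'v \<Rightarrow> 'v" where
  "vun A B = vset (elts A \<union> elts B)"

lemma elts_vsep: "definable1 P \<Longrightarrow> elts (vsep A P) = {x \<in> elts A. P x}"
  by (simp add: vsep_def small_sep)

lemma elts_vimg: "definable_fn1 F \<Longrightarrow> elts (vimg A F) = F ` elts A"
  by (simp add: vimg_def small_image)

lemma elts_vUN: "definable_fn1 F \<Longrightarrow> elts (vUN A F) = (\<Union>x\<in>elts A. elts (F x))"
  by (simp add: vUN_def small_UN)

lemma elts_vun [simp]: "elts (vun A B) = elts A \<union> elts B"
  by (simp add: vun_def)

lemma definable_fn_vsep [def_intro]:
  assumes "definable_fn A" "definable (\<lambda>s. P (\<lambda>n. s (Suc n)) (s 0))"
  shows "definable_fn (\<lambda>s. vsep (A s) (P s))"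
  unfolding vsep_def
  by (rule definable_fn_vset[OF small_sep[OF definable_freeze]])
    (intro def_intro assms assms(1)[THEN definable_fn_rename, of Suc])+

lemma definable_fn_vimg [def_intro]:
  assumes "definable_fn A" "definable_fn (\<lambda>s. F (\<lambda>n. s (Suc n)) (s 0))"
  shows "definable_fn (\<lambda>s. vimg (A s) (F s))"
proof -
  have *: "definable_fn (\<lambda>s. F (\<lambda>n. s (Suc (Suc n))) (s 0))"
    using definable_fn_rename[OF assms(2), of "case_nat 0 (\<lambda>n. Suc (Suc n))"] by simp
  have "F s ` elts (A s) = {y. \<exists>x\<in>elts (A s). y = F s x}" for s by auto
  moreover have "small (F s ` elts (A s))" for s
    by (rule small_image[OF definable_fn_freeze[OF assms(2)]])
  ultimately show ?thesis
    unfolding vimg_def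
    by (simp only:) (rule definable_fn_vset,
        simp, intro def_intro * assms(1)[THEN definable_fn_rename, of Suc])
qed

lemma definable_fn_vUN [def_intro]:
  assumes "definable_fn A" "definable_fn (\<lambda>s. F (\<lambda>n. s (Suc n)) (s 0))"
  shows "definable_fn (\<lambda>s. vUN (A s) (F s))"
proof -
  have *: "definable_fn (\<lambda>s. F (\<lambda>n. s (Suc (Suc n))) (s 0))"
    using definable_fn_rename[OF assms(2), of "case_nat 0 (\<lambda>n. Suc (Suc n))"] by simp
  have "(\<Union>x\<in>elts (A s). elts (F s x)) = {y. \<exists>x\<in>elts (A s). y \<in> elts (F s x)}" for s by auto
  moreover have "small (\<Union>x\<in>elts (A s). elts (F s x))" for s
    by (rule small_UN[OF definable_fn_freeze[OF assms(2)]])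
  ultimately show ?thesis
    unfolding vUN_def
    by (simp only:) (rule definable_fn_vset,
        simp, intro def_intro * assms(1)[THEN definable_fn_rename, of Suc])
qed

lemma definable_fn_vun [def_intro]:
  assumes "definable_fn A" "definable_fn B" shows "definable_fn (\<lambda>s. vun (A s) (B s))"
proof (rule definable_fn_sub2[OF _ assms])
  have "vun a b = vset {y. y \<in> elts a \<or> y \<in> elts b}" for a b :: 'a
    by (simp add: vun_def Un_def)
  moreover have "small {y. y \<in> elts a \<or> y \<in> elts b}" for a b :: 'a
    using small_Un[of a b] by (simp add: Un_def)
  ultimately show "definable_fn (\<lambda>s :: nat \<Rightarrow> 'a. vun (s 0) (s 1))"
    by (simp only:) (rule definable_fn_vset, simp, intro def_intro)
qed

lemma definable_fn_vpair [def_intro]: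
  assumes "definable_fn A" "definable_fn B" shows "definable_fn (\<lambda>s. vset {A s, B s})"
proof (rule definable_fn_sub2[OF _ assms])
  have *: "{a, b} = {y. y = a \<or> y = b}" for a b :: 'a by auto
  show "definable_fn (\<lambda>s :: nat \<Rightarrow> 'a. vset {s 0, s 1})"
    unfolding * by (rule definable_fn_vset, simp only: *[symmetric] small_pair, intro def_intro)
qed

lemma definable_fn_opair [def_intro]:
  assumes "definable_fn A" "definable_fn B" shows "definable_fn (\<lambda>s. opair (A s) (B s))"
proof -
  have "opair x y = vset {vset {x, x}, vset {x, y}}" for x y :: 'a by (simp add: opair_def)
  then show ?thesis by (simp only:) (intro def_intro assms)
qed

lemma definable_fn_vsucc [def_intro]:
  assumes "definable_fn A" shows "definable_fn (\<lambda>s. vsucc (A s))"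
proof -
  have "vsucc a = vun (vset {a, a}) a" for a :: 'a by (simp add: vsucc_def vun_def)
  then show ?thesis by (simp only:) (intro def_intro assms)
qed

lemma definable_fn_VPow [def_intro]:
  assumes "definable_fn A" shows "definable_fn (\<lambda>s. VPow (A s))"
proof (rule definable_fn_sub1[OF _ assms])
  show "definable_fn (\<lambda>s :: nat \<Rightarrow> 'a. VPow (s 0))"
    unfolding VPow_def by (rule definable_fn_vset, simp, intro def_intro)
qed

text \<open>In this form the existence of the product comes from Replacement and Union, and its
  definability from the rules already proved.\<close>

lemma vprod_eq: "vprod A B = vUN A (\<lambda>x. vimg B (opair x))"
proof -
  have "elts (vimg B (opair x)) = opair x ` elts B" for x
    by (rule elts_vimg) (intro def_intro)
  then show ?thesis unfolding vprod_def vUN_def by (auto intro!: arg_cong[of _ _ vset])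
qed

lemma definable_fn_vprod [def_intro]:
  assumes "definable_fn A" "definable_fn B" shows "definable_fn (\<lambda>s. vprod (A s) (B s))"
  by (rule definable_fn_sub2[OF _ assms], unfold vprod_eq, intro def_intro)

lemma elts_vprod [simp]: "elts (vprod A B) = {opair x y | x y. x \<in> elts A \<and> y \<in> elts B}"
proof -
  have "definable_fn1 (\<lambda>x. vimg B (opair x))" by (intro def_intro)
  moreover have "elts (vimg B (opair x)) = opair x ` elts B" for x
    by (rule elts_vimg) (intro def_intro)
  ultimately show ?thesis unfolding vprod_eq by (subst elts_vUN) auto
qed

text \<open>\<open>vfst\<close> and \<open>vsnd\<close> are unspecified outside the pairs; these
  projections take the value \<open>vzero\<close> there and so become definable.\<close>

definition pfst :: "'v::zf \<Rightarrow> 'v" where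
  "pfst p = the_or (\<lambda>x. \<exists>y. p = opair x y)"

definition psnd :: "'v::zf \<Rightarrow> 'v" where
  "psnd p = the_or (\<lambda>y. \<exists>x. p = opair x y)"

lemma pfst_opair [simp]: "pfst (opair x y) = x"
  by (auto simp: pfst_def intro: the_or_eq)

lemma psnd_opair [simp]: "psnd (opair x y) = y"
  by (auto simp: psnd_def intro: the_or_eq)

lemma definable_fn_pfst [def_intro]:
  assumes "definable_fn A" shows "definable_fn (\<lambda>s. pfst (A s))"
  by (rule definable_fn_sub1[OF _ assms], unfold pfst_def, intro def_intro)

lemma definable_fn_psnd [def_intro]:
  assumes "definable_fn A" shows "definable_fn (\<lambda>s. psnd (A s))"
  by (rule definable_fn_sub1[OF _ assms], unfold psnd_def, intro def_intro)

section \<open>Functions\<close>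

text \<open>Unlike \<open>app\<close>, the following variant is definable, since it has a definable junk value.\<close>

definition appl :: "'v::zf \<Rightarrow> 'v \<Rightarrow> 'v" where
  "appl f x = the_or (\<lambda>y. opair x y \<in> elts f)"

lemma definable_fn_appl [def_intro]:
  assumes "definable_fn A" "definable_fn B" shows "definable_fn (\<lambda>s. appl (A s) (B s))"
  by (rule definable_fn_sub2[OF _ assms], unfold appl_def, intro def_intro)

lemma definable_fun_on [def_intro]:
  assumes "definable_fn A" "definable_fn B" shows "definable (\<lambda>s. fun_on (A s) (B s))"
  by (rule definable_sub2[OF _ assms], unfold fun_on_def, intro def_intro)

lemma fun_on_ex1: "fun_on f A \<Longrightarrow> x \<in> elts A \<Longrightarrow> \<exists>!y. opair x y \<in> elts f"
  by (simp add: fun_on_def)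

lemma app_mem: "fun_on f A \<Longrightarrow> x \<in> elts A \<Longrightarrow> opair x (app f x) \<in> elts f"
  unfolding app_def by (rule theI'[OF fun_on_ex1])

lemma app_eqI: "fun_on f A \<Longrightarrow> opair x y \<in> elts f \<Longrightarrow> app f x = y"
  using the1_equality[of "\<lambda>y. opair x y \<in> elts f"] by (force simp: app_def fun_on_def)

lemma appl_eq: "fun_on f A \<Longrightarrow> x \<in> elts A \<Longrightarrow> appl f x = app f x"
  by (simp add: appl_def app_def the_or_def fun_on_ex1)

lemma mem_fun_iff: "fun_on f A \<Longrightarrow> p \<in> elts f \<longleftrightarrow> (\<exists>x\<in>elts A. p = opair x (app f x))"
proof
  assume f: "fun_on f A" and p: "p \<in> elts f"
  then obtain x y where "x \<in> elts A" "p = opair x y" unfolding fun_on_def by blast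
  with f p show "\<exists>x\<in>elts A. p = opair x (app f x)" using app_eqI by blast
qed (auto simp: app_mem)

lemma fun_ext:
  assumes "fun_on f A" "fun_on g A" "\<And>x. x \<in> elts A \<Longrightarrow> app f x = app g x"
  shows "f = g"
  by (rule extensionality) (use assms in \<open>auto simp: mem_fun_iff\<close>)

lemma maps_app: "maps f A B \<Longrightarrow> x \<in> elts A \<Longrightarrow> app f x \<in> elts B"
  by (auto simp: maps_def)

lemma maps_fun_on: "maps f A B \<Longrightarrow> fun_on f A"
  by (simp add: maps_def)

lemma maps_iff: "maps f A B \<longleftrightarrow> fun_on f A \<and> (\<forall>x\<in>elts A. appl f x \<in> elts B)"
  by (auto simp: maps_def appl_eq)

lemma definable_maps [def_intro]:
  assumes "definable_fn F" "definable_fn A" "definable_fn B"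
  shows "definable (\<lambda>s. maps (F s) (A s) (B s))"
  by (rule definable_sub3[OF _ assms], unfold maps_iff, intro def_intro)

lemma vlam_eq: "vlam A F = vimg A (\<lambda>x. opair x (F x))"
  by (simp add: vlam_def vimg_def)

lemma definable_fn_vlam [def_intro]:
  assumes "definable_fn A" "definable_fn (\<lambda>s. F (\<lambda>n. s (Suc n)) (s 0))"
  shows "definable_fn (\<lambda>s. vlam (A s) (F s))"
  unfolding vlam_eq by (intro def_intro assms)

lemma vlam_cong: "(\<And>x. x \<in> elts A \<Longrightarrow> F x = G x) \<Longrightarrow> vlam A F = vlam A G"
  unfolding vlam_def by (metis (no_types, lifting) image_cong)

lemma elts_vlam: "definable_fn1 F \<Longrightarrow> elts (vlam A F) = (\<lambda>x. opair x (F x)) ` elts A"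
  unfolding vlam_eq by (rule elts_vimg) (intro def_intro)

lemma fun_on_vlam: "definable_fn1 F \<Longrightarrow> fun_on (vlam A F) A"
  by (auto simp: fun_on_def elts_vlam)

lemma app_vlam: "definable_fn1 F \<Longrightarrow> x \<in> elts A \<Longrightarrow> app (vlam A F) x = F x"
  by (rule app_eqI[OF fun_on_vlam]) (auto simp: elts_vlam)

lemma appl_vlam: "definable_fn1 F \<Longrightarrow> x \<in> elts A \<Longrightarrow> appl (vlam A F) x = F x"
  by (simp add: appl_eq[OF fun_on_vlam] app_vlam)

lemma maps_vlam:
  "definable_fn1 F \<Longrightarrow> (\<And>x. x \<in> elts A \<Longrightarrow> F x \<in> elts B) \<Longrightarrow> maps (vlam A F) A B"
  by (auto simp: maps_def fun_on_vlam app_vlam)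

lemma fun_on_domain_unique:
  assumes "fun_on f A" "fun_on f B" shows "A = B"
proof (rule extensionality)
  have "x \<in> elts A \<longleftrightarrow> (\<exists>y. opair x y \<in> elts f)" if "fun_on f A" for x and A
    using that unfolding fun_on_def by fastforce
  then show "elts A = elts B" using assms by blast
qed

lemma fun_subset_prod: "maps f A B \<Longrightarrow> elts f \<subseteq> elts (vprod A B)"
  by (auto simp: maps_def mem_fun_iff image_subset_iff)

section \<open>Ordinals\<close>

lemma Ord_trans: "Ord a \<Longrightarrow> x \<in> elts y \<Longrightarrow> y \<in> elts a \<Longrightarrow> x \<in> elts a"
  by (auto simp: Ord_def)

lemma Ord_mem:
  assumes "Ord a" "x \<in> elts a" shows "Ord x"
  unfolding Ord_def
proof (intro conjI ballI subsetI)
  fix y z assume *: "y \<in> elts x" "z \<in> elts y"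
  then have "z \<in> elts a" using assms by (blast intro: Ord_trans)
  then have "x \<in> elts z \<or> x = z \<or> z \<in> elts x" using assms by (auto simp: Ord_def)
  then show "z \<in> elts x" using * mem_cycle3[of z y x] mem_asym[of z y] by blast
next
  fix y z assume "y \<in> elts x" "z \<in> elts x"
  then have "y \<in> elts a" "z \<in> elts a" using assms by (blast intro: Ord_trans)+
  then show "y \<in> elts z \<or> y = z \<or> z \<in> elts y" using assms by (auto simp: Ord_def)
qed

lemma definable_Ord [def_intro]:
  assumes "definable_fn A" shows "definable (\<lambda>s. Ord (A s))"
  by (rule definable_sub1[OF _ assms], unfold Ord_def, intro def_intro)

lemma Ord_vzero [simp]: "Ord vzero"
  by (simp add: Ord_def)

lemma Ord_vsucc: "Ord a \<Longrightarrow> Ord (vsucc a)"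
  by (auto simp: Ord_def)

lemma Ord_least:
  assumes P: "definable1 P" and a: "Ord a" "P a"
  obtains b where "least_Ord P b" "b \<in> elts (vsucc a)"
proof -
  let ?S = "vsep (vsucc a) P"
  have S: "elts ?S = {x \<in> elts (vsucc a). P x}" by (rule elts_vsep[OF P])
  then have "elts ?S \<noteq> {}" using a by auto
  then obtain b where b: "b \<in> elts ?S" "elts b \<inter> elts ?S = {}" using foundation by blast
  have "Ord b" using b S Ord_mem[OF Ord_vsucc[OF a(1)]] by auto
  moreover have "\<not> P c" if "c \<in> elts b" for c
    using that b S Ord_trans[OF Ord_vsucc[OF a(1)] that] by auto
  ultimately show thesis using that[of b] b S by (auto simp: least_Ord_def)
qed

lemma Ord_induct:
  assumes P: "definable1 P" and a: "Ord a"
    and step: "\<And>b. Ord b \<Longrightarrow> (\<And>c. c \<in> elts b \<Longrightarrow> P c) \<Longrightarrow> P b"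
  shows "P a"
proof (rule ccontr)
  assume "\<not> P a"
  with a obtain b where "least_Ord (\<lambda>x. \<not> P x) b"
    using Ord_least[OF definable_not[OF P]] by blast
  then show False using step[of b] by (auto simp: least_Ord_def)
qed

text \<open>A membership-minimal element of \<open>b\<close> outside \<open>a\<close> has exactly
  the members of \<open>a\<close>, hence equals \<open>a\<close>.\<close>

lemma Ord_psubset_mem:
  assumes "Ord a" "Ord b" "elts a \<subset> elts b" shows "a \<in> elts b"
proof -
  let ?S = "vsep b (\<lambda>x. x \<notin> elts a)"
  have S: "elts ?S = {x \<in> elts b. x \<notin> elts a}" by (rule elts_vsep) (intro def_intro)
  then have "elts ?S \<noteq> {}" using assms(3) by auto
  then obtain c where c: "c \<in> elts ?S" "elts c \<inter> elts ?S = {}" using foundation by blast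
  have "elts c = elts a"
  proof (intro Set.set_eqI iffI)
    fix x assume "x \<in> elts c"
    then show "x \<in> elts a" using c S Ord_trans[OF assms(2), of x c] by auto
  next
    fix x assume x: "x \<in> elts a"
    then have "x \<in> elts c \<or> x = c \<or> c \<in> elts x"
      using assms c S unfolding Ord_def by blast
    then show "x \<in> elts c" using x c S Ord_trans[OF assms(1), of c x] by auto
  qed
  then have "c = a" by (rule extensionality)
  then show ?thesis using c S by auto
qed

text \<open>The common part of \<open>a\<close> and \<open>b\<close> is an initial segment of both.
  If it were proper in both, it would be a member of itself.\<close>

lemma Ord_linear:
  assumes "Ord a" "Ord b" obtains "a \<in> elts b" | "a = b" | "b \<in> elts a"
proof -
  let ?c = "vsep a (\<lambda>x. x \<in> elts b)"
  have "elts ?c = {x \<in> elts a. x \<in> elts b}" by (rule elts_vsep) (intro def_intro)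
  then have c: "elts ?c = elts a \<inter> elts b" by auto
  have "Ord ?c" using assms unfolding Ord_def c by blast
  have 1: "?c = a \<or> ?c \<in> elts a"
    using Ord_psubset_mem[OF \<open>Ord ?c\<close> assms(1)] c extensionality by blast
  have 2: "?c = b \<or> ?c \<in> elts b"
    using Ord_psubset_mem[OF \<open>Ord ?c\<close> assms(2)] c extensionality by blast
  have "?c \<notin> elts a \<inter> elts b" using c not_mem_self by metis
  then show thesis using 1 2 that by auto
qed

lemma Ord_subset_iff:
  assumes "Ord a" "Ord b" shows "elts a \<subseteq> elts b \<longleftrightarrow> a \<in> elts (vsucc b)"
proof
  assume "elts a \<subseteq> elts b"
  then show "a \<in> elts (vsucc b)"
    using Ord_psubset_mem[OF assms] extensionality[of a b] by auto
next
  assume "a \<in> elts (vsucc b)"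
  then show "elts a \<subseteq> elts b" using Ord_trans[OF assms(2), of _ a] by auto
qed

lemma vsucc_mem_vsucc:
  assumes "Ord b" "a \<in> elts b" shows "vsucc a \<in> elts (vsucc b)"
proof -
  have "elts (vsucc a) \<subseteq> elts b" using assms Ord_trans[OF assms(1)] by auto
  then show ?thesis using Ord_subset_iff assms Ord_mem Ord_vsucc by blast
qed

lemma vsucc_inject: "vsucc a = vsucc b \<Longrightarrow> a = b"
  using mem_asym elts_vsucc by (metis insertE insertI1)

lemma Ord_vsucc_D: "Ord (vsucc a) \<Longrightarrow> Ord a"
  using Ord_mem[of "vsucc a" a] by simp

lemma vsucc_mem_D: "Ord d \<Longrightarrow> vsucc a \<in> elts d \<Longrightarrow> a \<in> elts d"
  using Ord_trans[of d a "vsucc a"] by simp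

text \<open>Burali-Forti: otherwise Separation would collect all ordinals into a set, which would
  itself be an ordinal and so a member of itself.\<close>

lemma Ord_not_bounded: "\<exists>a. Ord a \<and> a \<notin> elts A"
proof (rule ccontr)
  assume A: "\<not> ?thesis"
  have e: "elts (vsep A Ord) = {x. Ord x}"
    using elts_vsep[OF definable_Ord[OF definable_fn_var], of A] A by auto
  have "Ord (vsep A Ord)"
    unfolding Ord_def[of "vsep A Ord"] e by (auto intro: Ord_mem elim: Ord_linear)
  then show False using not_mem_self[of "vsep A Ord"] e by blast
qed

section \<open>Limit ordinals and omega\<close>

lemma definable_Limit_Ord [def_intro]:
  assumes "definable_fn A" shows "definable (\<lambda>s. Limit_Ord (A s))"
  by (rule definable_sub1[OF _ assms], unfold Limit_Ord_def, intro def_intro)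

lemma Limit_Ord_not_vsucc: "\<not> Limit_Ord (vsucc a)"
  using not_mem_self[of "vsucc a"] by (auto simp: Limit_Ord_def)

lemma Limit_Ord_not_vzero: "\<not> Limit_Ord vzero"
  by (simp add: Limit_Ord_def)

lemma vsucc_not_vzero [simp]: "vsucc a \<noteq> vzero" "vzero \<noteq> vsucc a"
  by (metis elts_vsucc elts_vzero insert_not_empty)+

lemma Ord_cases3:
  assumes "Ord a" obtains "a = vzero" | b where "Ord b" "a = vsucc b" | "Limit_Ord a"
proof (cases "a = vzero \<or> Limit_Ord a")
  case False
  then obtain b where b: "b \<in> elts a" "vsucc b \<notin> elts a" using assms by (auto simp: Limit_Ord_def)
  have "a = vsucc b" using vsucc_mem_vsucc[OF assms b(1), unfolded elts_vsucc[of a]] b(2) by blast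
  then show ?thesis using that(2) Ord_mem[OF assms b(1)] by blast
qed (use that in blast)

lemma Ord_vzero_mem: "Ord a \<Longrightarrow> a \<noteq> vzero \<Longrightarrow> vzero \<in> elts a"
  using Ord_linear[of a vzero] by auto

lemma vzero_mem_vsucc: "Ord a \<Longrightarrow> vzero \<in> elts (vsucc a)"
  by (auto dest: Ord_vzero_mem)

text \<open>Without limits every ordinal is zero or a successor, so by induction the set given by
  Infinity would contain all ordinals.\<close>

lemma ex_Limit_Ord: "\<exists>a :: 'v::zf. Limit_Ord a"
proof (rule ccontr)
  assume *: "\<nexists>a :: 'v. Limit_Ord a"
  obtain z :: 'v where z: "\<exists>e\<in>elts z. elts e = {}"
    "\<forall>y\<in>elts z. \<exists>y'\<in>elts z. elts y' = insert y (elts y)" using infinity by blast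
  have z0: "vzero \<in> elts z" using z(1) by (simp add: elts_eq_empty)
  have z1: "vsucc y \<in> elts z" if "y \<in> elts z" for y
    using z(2) that extensionality[of "vsucc y"] by (metis elts_vsucc)
  have "a \<in> elts z" if "Ord a" for a
    using _ that
  proof (rule Ord_induct)
    fix b assume b: "Ord b" "\<And>c. c \<in> elts b \<Longrightarrow> c \<in> elts z"
    from b(1) show "b \<in> elts z"
      by (cases rule: Ord_cases3) (use z0 z1 b(2) * in auto)
  qed (intro def_intro)
  then show False using Ord_not_bounded[of z] by blast
qed

lemma least_Ord_unique: "least_Ord P a \<Longrightarrow> least_Ord P b \<Longrightarrow> a = b"
  unfolding least_Ord_def by (metis Ord_linear)

lemma least_Ord_vomega: "least_Ord Limit_Ord vomega"
proof -
  obtain a :: 'a where "Limit_Ord a" using ex_Limit_Ord by blast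
  moreover from this have "Ord a" by (simp add: Limit_Ord_def)
  ultimately obtain b :: 'a where "least_Ord Limit_Ord b"
    using Ord_least[OF definable_Limit_Ord[OF definable_fn_var]] by blast
  then show ?thesis unfolding vomega_def by (rule theI) (metis least_Ord_unique \<open>least_Ord Limit_Ord b\<close>)
qed

lemmas vomega_props = least_Ord_vomega[unfolded least_Ord_def]

lemma Ord_vomega [simp]: "Ord vomega"
  by (rule vomega_props[THEN conjunct1])

lemma Limit_Ord_vomega: "Limit_Ord vomega"
  by (rule vomega_props[THEN conjunct2, THEN conjunct1])

lemma omega_not_Limit_Ord: "n \<in> elts vomega \<Longrightarrow> \<not> Limit_Ord n"
  by (rule vomega_props[THEN conjunct2, THEN conjunct2, THEN bspec])

lemma vzero_omega [simp]: "vzero \<in> elts (vomega :: 'v::zf)"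
  by (rule Ord_vzero_mem) (use Limit_Ord_vomega[where 'a = 'v] in \<open>simp_all add: Limit_Ord_def\<close>)

lemma vsucc_omega: "n \<in> elts (vomega :: 'v::zf) \<Longrightarrow> vsucc n \<in> elts vomega"
  using Limit_Ord_vomega[where 'a = 'v] by (auto simp: Limit_Ord_def)

lemma omega_Ord: "n \<in> elts vomega \<Longrightarrow> Ord n"
  using Ord_mem Ord_vomega by blast

lemma omega_cases:
  assumes "n \<in> elts vomega" obtains "n = vzero" | m where "m \<in> elts vomega" "n = vsucc m"
proof -
  have "\<not> Limit_Ord n" using assms by (rule omega_not_Limit_Ord)
  with omega_Ord[OF assms] show thesis
  proof (cases rule: Ord_cases3)
    case (2 b)
    then show ?thesis using that(2)[of b] vsucc_mem_D[OF Ord_vomega] assms by blast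
  qed (use that in auto)
qed

lemma omega_induct:
  assumes P: "definable1 P" and n: "n \<in> elts vomega" and 0: "P vzero"
    and S: "\<And>n. n \<in> elts vomega \<Longrightarrow> P n \<Longrightarrow> P (vsucc n)"
  shows "P n"
proof -
  have "n \<in> elts vomega \<longrightarrow> P n"
    using _ omega_Ord[OF n]
  proof (rule Ord_induct)
    fix b assume b: "Ord b" "\<And>c. c \<in> elts b \<Longrightarrow> c \<in> elts vomega \<longrightarrow> P c"
    show "b \<in> elts vomega \<longrightarrow> P b"
    proof
      assume "b \<in> elts vomega"
      then show "P b"
        by (cases rule: omega_cases) (use 0 S b(2) in auto)
    qed
  qed (intro def_intro P)
  then show ?thesis using n by blast
qed

section \<open>Transfinite recursion\<close>

text \<open>The parameter \<open>p\<close> is carried along so that the result of the recursion is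
  definable in \<open>p\<close> as well. For towers it is the base group, over which the predicate
  \<open>birth\<close> quantifies.\<close>

definition rec_approx :: "('v::zf \<Rightarrow> 'v \<Rightarrow> 'v \<Rightarrow> 'v) \<Rightarrow> 'v \<Rightarrow> 'v \<Rightarrow> 'v \<Rightarrow> bool" where
  "rec_approx H p a f \<longleftrightarrow> fun_on f a \<and> (\<forall>b\<in>elts a. appl f b = H p b (vlam b (appl f)))"

definition ord_rec :: "('v::zf \<Rightarrow> 'v \<Rightarrow> 'v \<Rightarrow> 'v) \<Rightarrow> 'v \<Rightarrow> 'v \<Rightarrow> 'v" where
  "ord_rec H p a = H p a (the_or (rec_approx H p a))"

lemma definable_fn_ord_rec:
  assumes H: "definable_fn (\<lambda>s. H (s 0) (s 1) (s 2))" and "definable_fn A" "definable_fn B"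
  shows "definable_fn (\<lambda>s. ord_rec H (A s) (B s))"
  by (rule definable_fn_sub2[OF _ assms(2,3)], unfold ord_rec_def rec_approx_def,
      intro def_intro definable_fn_sub3[OF H])

text \<open>Approximations on the same ordinal coincide by induction. A second induction shows that
  the values of \<open>ord_rec\<close> below \<open>a\<close> form an approximation, so this is the
  one which \<open>the_or\<close> selects in the definition.\<close>

lemma ord_rec_eq:
  assumes H: "definable_fn (\<lambda>s. H (s 0) (s 1) (s 2))" and a: "Ord a"
  shows "ord_rec H p a = H p a (vlam a (ord_rec H p))"
proof -
  have R: "definable_fn1 (ord_rec H p)" by (intro def_intro definable_fn_ord_rec[OF H])
  have uniq: "f = g" if "Ord a" and f: "rec_approx H p a f" and g: "rec_approx H p a g" for a f g
  proof -
    have "b \<in> elts a \<longrightarrow> appl f b = appl g b" if "Ord b" for b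
      using _ that
    proof (rule Ord_induct)
      fix b assume b: "Ord b" "\<And>c. c \<in> elts b \<Longrightarrow> c \<in> elts a \<longrightarrow> appl f c = appl g c"
      show "b \<in> elts a \<longrightarrow> appl f b = appl g b"
      proof
        assume "b \<in> elts a"
        then have "vlam b (appl f) = vlam b (appl g)"
          using b(2) Ord_trans[OF \<open>Ord a\<close>] by (blast intro: vlam_cong)
        then show "appl f b = appl g b" using f g \<open>b \<in> elts a\<close> by (simp add: rec_approx_def)
      qed
    qed (intro def_intro)
    moreover have "Ord b" if "b \<in> elts a" for b using Ord_mem that \<open>Ord a\<close> by blast
    ultimately show ?thesis
      using f g appl_eq fun_ext[of f a g] by (metis rec_approx_def)
  qed
  have ex: "rec_approx H p a (vlam a (ord_rec H p))" if "Ord a" for a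
    using _ that
  proof (rule Ord_induct)
    fix a assume a: "Ord a" "\<And>b. b \<in> elts a \<Longrightarrow> rec_approx H p b (vlam b (ord_rec H p))"
    show "rec_approx H p a (vlam a (ord_rec H p))"
      unfolding rec_approx_def
    proof (intro conjI ballI fun_on_vlam R)
      fix b assume b: "b \<in> elts a"
      have "the_or (rec_approx H p b) = vlam b (ord_rec H p)"
        by (rule the_or_eq) (use a(2)[OF b] uniq Ord_mem[OF a(1) b] in blast)+
      moreover have "vlam b (appl (vlam a (ord_rec H p))) = vlam b (ord_rec H p)"
        using Ord_trans[OF a(1) _ b] by (intro vlam_cong) (simp add: appl_vlam[OF R])
      ultimately show "appl (vlam a (ord_rec H p)) b = H p b (vlam b (appl (vlam a (ord_rec H p))))"
        using appl_vlam[OF R b] ord_rec_def[of H p b] by simp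
    qed
  next
    show "definable1 (\<lambda>a. rec_approx H p a (vlam a (ord_rec H p)))"
      unfolding rec_approx_def
      by (intro def_intro definable_fn_sub3[OF H] definable_fn_ord_rec[OF H])
  qed
  have "the_or (rec_approx H p a) = vlam a (ord_rec H p)"
    by (rule the_or_eq) (use ex[OF a] uniq[OF a] in blast)+
  then show ?thesis using ord_rec_def[of H p a] by simp
qed

section \<open>Groups of the model\<close>

abbreviation car :: "'v::zf \<Rightarrow> 'v" where "car \<equiv> pfst"
abbreviation elems :: "'v::zf \<Rightarrow> 'v set" where "elems G \<equiv> elts (car G)"

definition mul :: "'v::zf \<Rightarrow> 'v \<Rightarrow> 'v \<Rightarrow> 'v" where
  "mul G x y = appl (psnd G) (opair x y)"

lemma definable_fn_mul [def_intro]: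
  assumes "definable_fn A" "definable_fn B" "definable_fn C"
  shows "definable_fn (\<lambda>s. mul (A s) (B s) (C s))"
  unfolding mul_def by (intro def_intro assms)

lemma maps_opair:
  assumes "maps m (vprod c c) c" "x \<in> elts c" "y \<in> elts c"
  shows "app m (opair x y) = appl m (opair x y)" "appl m (opair x y) \<in> elts c"
  using assms appl_eq[of m "vprod c c" "opair x y"] by (auto simp: maps_def image_subset_iff)

text \<open>\<open>struct\<close> involves \<open>THE\<close> and HOL functions; this first-order
  rendering of the axioms makes \<open>is_group\<close> definable.\<close>

definition group_ax :: "'v::zf \<Rightarrow> ('v \<Rightarrow> 'v \<Rightarrow> 'v) \<Rightarrow> bool" where
  "group_ax c f \<longleftrightarrow>
     (\<forall>x\<in>elts c. \<forall>y\<in>elts c. f x y \<in> elts c) \<and>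
     (\<forall>x\<in>elts c. \<forall>y\<in>elts c. \<forall>z\<in>elts c. f (f x y) z = f x (f y z)) \<and>
     (\<exists>e\<in>elts c. \<forall>x\<in>elts c. f e x = x \<and> f x e = x \<and> (\<exists>y\<in>elts c. f y x = e \<and> f x y = e))"

lemma group_struct_iff:
  assumes m: "maps m (vprod c c) c"
  shows "group (struct (opair c m)) \<longleftrightarrow> group_ax c (mul (opair c m))"
proof
  let ?G = "struct (opair c m)"
  have [simp]: "carrier ?G = elts c" by (simp add: struct_def)
  have mult: "x \<otimes>\<^bsub>?G\<^esub> y = mul (opair c m) x y" if "x \<in> elts c" "y \<in> elts c" for x y
    using maps_opair(1)[OF m that] by (simp add: struct_def mul_def)
  have closed: "mul (opair c m) x y \<in> elts c" if "x \<in> elts c" "y \<in> elts c" for x y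
    using maps_opair(2)[OF m that] by (simp add: mul_def)
  {
    assume "group ?G"
    then interpret group ?G .
    have assoc: "mul (opair c m) (mul (opair c m) x y) z = mul (opair c m) x (mul (opair c m) y z)"
      if "x \<in> elts c" "y \<in> elts c" "z \<in> elts c" for x y z
      using m_assoc[of x y z] that by (simp add: mult closed)
    have one: "mul (opair c m) \<one>\<^bsub>?G\<^esub> x = x" "mul (opair c m) x \<one>\<^bsub>?G\<^esub> = x"
      "mul (opair c m) (inv\<^bsub>?G\<^esub> x) x = \<one>\<^bsub>?G\<^esub>" "mul (opair c m) x (inv\<^bsub>?G\<^esub> x) = \<one>\<^bsub>?G\<^esub>"
      "inv\<^bsub>?G\<^esub> x \<in> elts c"
      if "x \<in> elts c" for x
      using that mult[of "\<one>\<^bsub>?G\<^esub>" x] mult[of x "\<one>\<^bsub>?G\<^esub>"] mult[of "inv\<^bsub>?G\<^esub> x" x] mult[of x "inv\<^bsub>?G\<^esub> x"]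
        one_closed inv_closed[of x] by simp_all
    have "\<exists>y\<in>elts c. mul (opair c m) y x = \<one>\<^bsub>?G\<^esub> \<and> mul (opair c m) x y = \<one>\<^bsub>?G\<^esub>"
      if "x \<in> elts c" for x
      using one[OF that] by (intro bexI[of _ "inv\<^bsub>?G\<^esub> x"]) simp_all
    then have "\<exists>e\<in>elts c. \<forall>x\<in>elts c. mul (opair c m) e x = x \<and> mul (opair c m) x e = x \<and>
        (\<exists>y\<in>elts c. mul (opair c m) y x = e \<and> mul (opair c m) x y = e)"
      using one one_closed by (intro bexI[of _ "\<one>\<^bsub>?G\<^esub>"]) simp_all
    then show "group_ax c (mul (opair c m))"
      unfolding group_ax_def using closed assoc by simp
  next
    assume ax: "group_ax c (mul (opair c m))"
    then obtain e where e: "e \<in> elts c" "\<And>x. x \<in> elts c \<Longrightarrow> mul (opair c m) e x = x"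
      "\<And>x. x \<in> elts c \<Longrightarrow> mul (opair c m) x e = x"
      "\<And>x. x \<in> elts c \<Longrightarrow> \<exists>y\<in>elts c. mul (opair c m) y x = e"
      unfolding group_ax_def by blast
    have "\<one>\<^bsub>?G\<^esub> = (THE e. e \<in> elts c \<and> (\<forall>x\<in>elts c. mul (opair c m) e x = x \<and> mul (opair c m) x e = x))"
      using maps_opair(1)[OF m]
      by (auto simp: struct_def mul_def intro!: arg_cong[of _ _ The])
    also have "\<dots> = e" by (rule the_equality) (use e in metis)+
    finally have one: "\<one>\<^bsub>?G\<^esub> = e" .
    show "group ?G"
    proof (rule groupI)
      fix x y z assume "x \<in> carrier ?G" "y \<in> carrier ?G" "z \<in> carrier ?G"
      then show "x \<otimes>\<^bsub>?G\<^esub> y \<otimes>\<^bsub>?G\<^esub> z = x \<otimes>\<^bsub>?G\<^esub> (y \<otimes>\<^bsub>?G\<^esub> z)"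
        using ax by (simp add: mult closed group_ax_def)
    qed (use e in \<open>auto simp: one mult closed\<close>)
  }
qed

lemma is_group_iff:
  "is_group G \<longleftrightarrow> (\<exists>c m. G = opair c m \<and> maps m (vprod c c) c \<and> group_ax c (mul G))"
  unfolding is_group_def using group_struct_iff by metis

lemma definable_is_group [def_intro]:
  assumes "definable_fn A" shows "definable (\<lambda>s. is_group (A s))"
  by (rule definable_sub1[OF _ assms], unfold is_group_iff group_ax_def, intro def_intro)

lemma
  assumes "is_group G"
  shows vfst_group: "vfst G = car G" and vsnd_group: "vsnd G = psnd G"
    and group_eta: "opair (car G) (psnd G) = G"
    and maps_psnd: "maps (psnd G) (vprod (car G) (car G)) (car G)"
    and group_struct: "group (struct G)"
    and carrier_struct: "carrier (struct G) = elems G"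
    and group_ax_mul: "group_ax (car G) (mul G)"
proof -
  show "group (struct G)" using assms by (simp add: is_group_def)
  obtain c m where "G = opair c m" "maps m (vprod c c) c" "group_ax c (mul G)"
    using assms is_group_iff by blast
  then show "vfst G = car G" "vsnd G = psnd G" "opair (car G) (psnd G) = G"
    "maps (psnd G) (vprod (car G) (car G)) (car G)" "carrier (struct G) = elems G"
    "group_ax (car G) (mul G)"
    by (simp_all add: struct_def)
qed

lemma mul_closed: "is_group G \<Longrightarrow> x \<in> elems G \<Longrightarrow> y \<in> elems G \<Longrightarrow> mul G x y \<in> elems G"
  using group_ax_mul[of G] by (simp add: group_ax_def)

lemma mult_struct:
  "is_group G \<Longrightarrow> x \<in> elems G \<Longrightarrow> y \<in> elems G \<Longrightarrow> x \<otimes>\<^bsub>struct G\<^esub> y = mul G x y"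
  using maps_opair(1)[OF maps_psnd, of G x y] by (simp add: struct_def vsnd_group mul_def)

lemma group_eqI:
  assumes "is_group G" "is_group H" "car G = car H"
    "\<And>x y. x \<in> elems G \<Longrightarrow> y \<in> elems G \<Longrightarrow> mul G x y = mul H x y"
  shows "G = H"
proof -
  have G: "fun_on (psnd G) (vprod (car G) (car G))" "fun_on (psnd H) (vprod (car G) (car G))"
    using assms maps_psnd[of G] maps_psnd[of H] by (auto simp: maps_def)
  have "psnd G = psnd H"
  proof (rule fun_ext[OF G])
    fix p assume "p \<in> elts (vprod (car G) (car G))"
    then show "app (psnd G) p = app (psnd H) p"
      using assms(4) appl_eq[OF G(1), of p] appl_eq[OF G(2), of p] by (auto simp: mul_def)
  qed
  then show ?thesis using assms group_eta by metis
qed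

lemma mem_psnd_iff:
  assumes "is_group G"
  shows "p \<in> elts (psnd G) \<longleftrightarrow>
    (\<exists>x\<in>elems G. \<exists>y\<in>elems G. p = opair (opair x y) (mul G x y))"
proof -
  have f: "fun_on (psnd G) (vprod (car G) (car G))" using maps_psnd[OF assms] by (simp add: maps_def)
  show ?thesis
    unfolding mem_fun_iff[OF f] mul_def using appl_eq[OF f] by fastforce
qed

definition mk_group :: "'v::zf \<Rightarrow> ('v \<Rightarrow> 'v \<Rightarrow> 'v) \<Rightarrow> 'v" where
  "mk_group c f = opair c (vlam (vprod c c) (\<lambda>p. f (pfst p) (psnd p)))"

lemma car_mk_group [simp]: "car (mk_group c f) = c"
  by (simp add: mk_group_def)

lemma
  assumes f: "definable_fn (\<lambda>s. f (s 0) (s 1))"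
  shows mul_mk_group: "x \<in> elts c \<Longrightarrow> y \<in> elts c \<Longrightarrow> mul (mk_group c f) x y = f x y"
    and is_group_mk_group: "group_ax c f \<Longrightarrow> is_group (mk_group c f)"
proof -
  have d: "definable_fn1 (\<lambda>p. f (pfst p) (psnd p))"
    by (intro def_intro definable_fn_sub2[OF f])
  show *: "mul (mk_group c f) x y = f x y" if "x \<in> elts c" "y \<in> elts c" for x y
    using that by (simp add: mul_def mk_group_def appl_vlam[OF d])
  assume ax: "group_ax c f"
  have "maps (vlam (vprod c c) (\<lambda>p. f (pfst p) (psnd p))) (vprod c c) c"
    using ax by (intro maps_vlam d) (auto simp: group_ax_def)
  moreover have "group_ax c (mul (mk_group c f))"
    using ax unfolding group_ax_def by (simp add: * cong: ball_cong bex_cong)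
  ultimately show "is_group (mk_group c f)"
    unfolding is_group_iff by (auto simp: mk_group_def)
qed

section \<open>Automorphisms and conjugation\<close>

definition is_aut :: "'v::zf \<Rightarrow> 'v \<Rightarrow> bool" where
  "is_aut G f \<longleftrightarrow> maps f (car G) (car G) \<and>
     (\<forall>x\<in>elems G. \<forall>y\<in>elems G. appl f (mul G x y) = mul G (appl f x) (appl f y)) \<and>
     (\<forall>x\<in>elems G. \<forall>y\<in>elems G. appl f x = appl f y \<longrightarrow> x = y) \<and>
     (\<forall>y\<in>elems G. \<exists>x\<in>elems G. appl f x = y)"

lemma definable_is_aut [def_intro]:
  assumes "definable_fn A" "definable_fn B" shows "definable (\<lambda>s. is_aut (A s) (B s))"
  by (rule definable_sub2[OF _ assms], unfold is_aut_def, intro def_intro)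

lemma carrier_Aut:
  assumes G: "is_group G" shows "f \<in> carrier (Aut G) \<longleftrightarrow> is_aut G f"
proof (cases "maps f (car G) (car G)")
  case True
  then have a: "app f x = appl f x" "appl f x \<in> elems G" if "x \<in> elems G" for x
    using that maps_iff[of f] appl_eq[of f] by auto
  have "app f \<in> hom (struct G) (struct G) \<longleftrightarrow>
    (\<forall>x\<in>elems G. \<forall>y\<in>elems G. appl f (mul G x y) = mul G (appl f x) (appl f y))"
    using G a by (auto simp: hom_def carrier_struct mult_struct mul_closed)
  moreover have "bij_betw (app f) (elems G) (elems G) \<longleftrightarrow>
     (\<forall>x\<in>elems G. \<forall>y\<in>elems G. appl f x = appl f y \<longrightarrow> x = y) \<and>
     (\<forall>y\<in>elems G. \<exists>x\<in>elems G. appl f x = y)"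
  proof -
    have e: "app f ` elems G = appl f ` elems G" by (simp add: a)
    have "appl f ` elems G \<subseteq> elems G" using a by blast
    moreover have "elems G \<subseteq> appl f ` elems G \<longleftrightarrow> (\<forall>y\<in>elems G. \<exists>x\<in>elems G. appl f x = y)"
      by (simp only: subset_iff image_iff) metis
    ultimately have "app f ` elems G = elems G \<longleftrightarrow> (\<forall>y\<in>elems G. \<exists>x\<in>elems G. appl f x = y)"
      unfolding e by (simp only: set_eq_subset) simp
    then show ?thesis by (simp add: bij_betw_def inj_on_def a)
  qed
  ultimately show ?thesis
    using G True by (auto simp: Aut_def is_aut_def iso_def vfst_group carrier_struct)
next
  case False
  then show ?thesis using G by (simp add: Aut_def is_aut_def vfst_group)
qed

text \<open>Normality is written without inverses: \<open>mul H h x = mul H y h\<close> makes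
  \<open>y\<close> the conjugate of \<open>x\<close> by \<open>h\<close>. Inverse and unit come from
  \<open>struct\<close> with its unspecified values, so predicates that must be definable avoid
  them; in later ones \<open>mul H h h = h\<close> stands for \<open>h\<close> being the
  unit.\<close>

definition normal_ext :: "'v::zf \<Rightarrow> 'v \<Rightarrow> bool" where
  "normal_ext G H \<longleftrightarrow> is_group H \<and> elems G \<subseteq> elems H \<and>
     (\<forall>x\<in>elems G. \<forall>y\<in>elems G. mul H x y = mul G x y) \<and>
     (\<forall>h\<in>elems H. \<forall>x\<in>elems G. \<exists>y\<in>elems G. mul H h x = mul H y h)"

text \<open>Equivalent to \<open>is_Aut_over\<close> if \<open>G\<close> is a group.  It is definable for all arguments, since it
  avoids \<open>app\<close> and its undefined values.\<close>

definition aut_ext :: "'v::zf \<Rightarrow> 'v \<Rightarrow> bool" where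
  "aut_ext G H \<longleftrightarrow> normal_ext G H \<and>
     (\<forall>h\<in>elems H. (\<forall>x\<in>elems G. mul H h x = mul H x h) \<longrightarrow> mul H h h = h) \<and>
     (\<forall>f. is_aut G f \<longrightarrow> (\<exists>h\<in>elems H. \<forall>x\<in>elems G. mul H h x = mul H (appl f x) h))"

lemma definable_aut_ext [def_intro]:
  assumes "definable_fn A" "definable_fn B" shows "definable (\<lambda>s. aut_ext (A s) (B s))"
  by (rule definable_sub2[OF _ assms], unfold aut_ext_def normal_ext_def, intro def_intro)

abbreviation unit :: "'v::zf \<Rightarrow> 'v" where "unit G \<equiv> \<one>\<^bsub>struct G\<^esub>"
abbreviation ginv :: "'v::zf \<Rightarrow> 'v \<Rightarrow> 'v" where "ginv G x \<equiv> inv\<^bsub>struct G\<^esub> x"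

lemma
  assumes G: "is_group G"
  shows mul_assoc: "x \<in> elems G \<Longrightarrow> y \<in> elems G \<Longrightarrow> z \<in> elems G \<Longrightarrow>
      mul G (mul G x y) z = mul G x (mul G y z)"
    and unit_closed: "unit G \<in> elems G"
    and ginv_closed: "x \<in> elems G \<Longrightarrow> ginv G x \<in> elems G"
    and mul_unit_left: "x \<in> elems G \<Longrightarrow> mul G (unit G) x = x"
    and mul_unit_right: "x \<in> elems G \<Longrightarrow> mul G x (unit G) = x"
    and mul_ginv_left: "x \<in> elems G \<Longrightarrow> mul G (ginv G x) x = unit G"
    and mul_ginv_right: "x \<in> elems G \<Longrightarrow> mul G x (ginv G x) = unit G"
proof -
  interpret group "struct G" using G by (rule group_struct)
  show "x \<in> elems G \<Longrightarrow> y \<in> elems G \<Longrightarrow> z \<in> elems G \<Longrightarrow>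
      mul G (mul G x y) z = mul G x (mul G y z)" for x y z
    using group_ax_mul[OF G] by (simp add: group_ax_def)
  note c = carrier_struct[OF G]
  show "unit G \<in> elems G" "x \<in> elems G \<Longrightarrow> ginv G x \<in> elems G" for x
    using one_closed inv_closed c by simp_all
  note [simp] = this mult_struct[OF G, symmetric] mul_closed[OF G]
  show "x \<in> elems G \<Longrightarrow> mul G (unit G) x = x" "x \<in> elems G \<Longrightarrow> mul G x (unit G) = x"
    "x \<in> elems G \<Longrightarrow> mul G (ginv G x) x = unit G" "x \<in> elems G \<Longrightarrow> mul G x (ginv G x) = unit G" for x
    using c by simp_all
qed

lemmas group_simps = mul_assoc mul_closed unit_closed ginv_closed mul_unit_left mul_unit_right
  mul_ginv_left mul_ginv_right

lemma mul_right_cancel: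
  assumes "is_group G" "x \<in> elems G" "y \<in> elems G" "h \<in> elems G"
  shows "mul G x h = mul G y h \<longleftrightarrow> x = y"
proof
  assume "mul G x h = mul G y h"
  then have "mul G (mul G x h) (ginv G h) = mul G (mul G y h) (ginv G h)" by simp
  then show "x = y" using assms by (simp add: group_simps)
qed simp

lemma mul_left_cancel:
  assumes "is_group G" "x \<in> elems G" "y \<in> elems G" "h \<in> elems G"
  shows "mul G h x = mul G h y \<longleftrightarrow> x = y"
proof
  assume "mul G h x = mul G h y"
  then have "mul G (mul G (ginv G h) h) x = mul G (mul G (ginv G h) h) y"
    using assms by (simp only: mul_assoc ginv_closed)
  then show "x = y" using assms by (simp add: group_simps)
qed simp

lemma idem_unit:
  assumes "is_group G" "h \<in> elems G"
  shows "mul G h h = h \<longleftrightarrow> h = unit G"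
  using assms mul_left_cancel[of G h "unit G" h] by (auto simp: group_simps)

text \<open>The conjugate of \<open>x\<close> by \<open>h\<close>, sought in \<open>c\<close> only:
  \<open>h\<close> may belong to a larger group, in which \<open>c\<close> is the carrier of a
  normal subgroup.\<close>

definition conj_in :: "'v::zf \<Rightarrow> 'v \<Rightarrow> 'v \<Rightarrow> 'v \<Rightarrow> 'v" where
  "conj_in c H h x = the_or (\<lambda>y. y \<in> elts c \<and> mul H y h = mul H h x)"

definition conj_map :: "'v::zf \<Rightarrow> 'v \<Rightarrow> 'v \<Rightarrow> 'v" where
  "conj_map c H h = vlam c (conj_in c H h)"

lemma definable_fn_conj_map [def_intro]:
  assumes "definable_fn A" "definable_fn B" "definable_fn C"
  shows "definable_fn (\<lambda>s. conj_map (A s) (B s) (C s))"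
  by (rule definable_fn_sub3[OF _ assms], unfold conj_in_def conj_map_def, intro def_intro)

lemma definable_fn_conj_in [def_intro]: "definable_fn1 (conj_in c H h)"
  unfolding conj_in_def by (intro def_intro)

lemma fun_on_conj_map: "fun_on (conj_map c H h) c"
  unfolding conj_map_def by (rule fun_on_vlam[OF definable_fn_conj_in])

lemma appl_conj_map: "x \<in> elts c \<Longrightarrow> appl (conj_map c H h) x = conj_in c H h x"
  unfolding conj_map_def by (rule appl_vlam[OF definable_fn_conj_in])

lemma conj_in_eqI:
  assumes "is_group H" "elts c \<subseteq> elems H" "h \<in> elems H" "y \<in> elts c" "mul H y h = mul H h x"
  shows "conj_in c H h x = y"
  unfolding conj_in_def
  by (rule the_or_eq) (use assms mul_right_cancel[of H _ y h] in auto)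

lemma conj_in_self:
  assumes "is_group G" "h \<in> elems G" "x \<in> elems G"
  shows "conj_in (car G) G h x = mul G (mul G h x) (ginv G h)"
  using assms by (intro conj_in_eqI) (auto simp: group_simps)

lemma inner_aut_eq:
  assumes "is_group G" "g \<in> elems G"
  shows "inner_aut G g = conj_map (car G) G g"
  unfolding inner_aut_def conj_map_def vfst_group[OF assms(1)]
  using assms by (intro vlam_cong) (simp add: conj_in_self mult_struct group_simps)

lemma maps_conj_in:
  assumes "normal_ext G H" "h \<in> elems H" "x \<in> elems G"
  shows "conj_in (car G) H h x \<in> elems G"
    and "mul H (conj_in (car G) H h x) h = mul H h x"
proof -
  obtain y where y: "y \<in> elems G" "mul H y h = mul H h x"
    using assms unfolding normal_ext_def by metis
  then have "conj_in (car G) H h x = y"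
    using assms by (intro conj_in_eqI) (auto simp: normal_ext_def)
  then show "conj_in (car G) H h x \<in> elems G" "mul H (conj_in (car G) H h x) h = mul H h x"
    using y by simp_all
qed

lemma conj_in_conj_in:
  assumes E: "normal_ext G H" and h: "h \<in> elems H" "h' \<in> elems H" and x: "x \<in> elems G"
  shows "conj_in (car G) H (mul H h h') x = conj_in (car G) H h (conj_in (car G) H h' x)"
proof -
  let ?y = "conj_in (car G) H h' x"
  let ?z = "conj_in (car G) H h ?y"
  have H: "is_group H" "elems G \<subseteq> elems H" using E by (simp_all add: normal_ext_def)
  have y: "?y \<in> elems G" "mul H ?y h' = mul H h' x" by (rule maps_conj_in[OF E h(2) x])+
  have z: "?z \<in> elems G" "mul H ?z h = mul H h ?y" by (rule maps_conj_in[OF E h(1) y(1)])+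
  have "mul H ?z (mul H h h') = mul H (mul H ?z h) h'"
    using H h z by (subst mul_assoc) auto
  also have "\<dots> = mul H (mul H h ?y) h'" by (simp add: z)
  also have "\<dots> = mul H h (mul H ?y h')" using H h y by (subst mul_assoc) auto
  also have "\<dots> = mul H h (mul H h' x)" by (simp add: y)
  also have "\<dots> = mul H (mul H h h') x" using H h x by (subst mul_assoc) auto
  finally show ?thesis using H h z by (intro conj_in_eqI mul_closed) auto
qed

lemma is_aut_conj_map:
  assumes E: "normal_ext G H" and G: "is_group G" and h: "h \<in> elems H"
  shows "is_aut G (conj_map (car G) H h)"
proof -
  have H: "is_group H" and sub: "elems G \<subseteq> elems H"
    and mul: "\<And>x y. x \<in> elems G \<Longrightarrow> y \<in> elems G \<Longrightarrow> mul G x y = mul H x y"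
    using E by (simp_all add: normal_ext_def)
  let ?c = "conj_in (car G) H h"
  have c: "?c x \<in> elems G" "mul H (?c x) h = mul H h x" if "x \<in> elems G" for x
    by (rule maps_conj_in[OF E h that])+
  have in_H: "x \<in> elems H" if "x \<in> elems G" for x using sub that by blast
  have hom: "?c (mul G x y) = mul G (?c x) (?c y)" if xy: "x \<in> elems G" "y \<in> elems G" for x y
  proof (rule conj_in_eqI[OF H sub h])
    show "mul G (?c x) (?c y) \<in> elems G" using c xy G by (intro mul_closed) auto
    have "mul H (mul H (?c x) (?c y)) h = mul H (?c x) (mul H (?c y) h)"
      using H h c xy in_H by (subst mul_assoc) auto
    also have "\<dots> = mul H (?c x) (mul H h y)" using c xy by simp
    also have "\<dots> = mul H (mul H (?c x) h) y" using H h c xy in_H by (subst mul_assoc) auto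
    also have "\<dots> = mul H (mul H h x) y" using c xy by simp
    also have "\<dots> = mul H h (mul H x y)" using H h xy in_H by (subst mul_assoc) auto
    finally show "mul H (mul G (?c x) (?c y)) h = mul H h (mul G x y)"
      using mul c xy by simp
  qed
  have inj: "x = y" if xy: "x \<in> elems G" "y \<in> elems G" and "?c x = ?c y" for x y
    using mul_left_cancel[OF H in_H in_H h, of x y] c(2)[of x] c(2)[of y] that by simp
  have surj: "\<exists>x\<in>elems G. ?c x = y" if y: "y \<in> elems G" for y
  proof -
    have i: "ginv H h \<in> elems H" using H h by (rule ginv_closed)
    have "?c (conj_in (car G) H (ginv H h) y) = conj_in (car G) H (unit H) y"
      using conj_in_conj_in[OF E h i y] H h by (simp add: group_simps)
    also have "\<dots> = y" using H h y sub in_H by (intro conj_in_eqI) (auto simp: group_simps)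
    finally show ?thesis using maps_conj_in(1)[OF E i y] by blast
  qed
  show ?thesis
    unfolding is_aut_def maps_iff
    using hom inj surj c by (simp add: appl_conj_map fun_on_conj_map mul_closed[OF G])
qed

lemma
  assumes G: "is_group G"
  shows mult_Aut: "is_aut G f \<Longrightarrow> is_aut G g \<Longrightarrow> f \<otimes>\<^bsub>Aut G\<^esub> g = vlam (car G) (\<lambda>x. appl f (appl g x))"
    and aut_fun_on: "is_aut G f \<Longrightarrow> fun_on f (car G)"
    and aut_closed: "is_aut G f \<Longrightarrow> x \<in> elems G \<Longrightarrow> appl f x \<in> elems G"
    and aut_mul: "is_aut G f \<Longrightarrow> x \<in> elems G \<Longrightarrow> y \<in> elems G \<Longrightarrow>
      appl f (mul G x y) = mul G (appl f x) (appl f y)"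
proof -
  show *: "fun_on f (car G)" "x \<in> elems G \<Longrightarrow> appl f x \<in> elems G" if "is_aut G f" for f x
    using that by (auto simp: is_aut_def maps_iff)
  show "x \<in> elems G \<Longrightarrow> y \<in> elems G \<Longrightarrow>
      appl f (mul G x y) = mul G (appl f x) (appl f y)" if "is_aut G f" for x y
    using that by (auto simp: is_aut_def)
  show "f \<otimes>\<^bsub>Aut G\<^esub> g = vlam (car G) (\<lambda>x. appl f (appl g x))" if "is_aut G f" "is_aut G g"
    using *[OF that(1)] *[OF that(2)]
    by (simp add: Aut_def vfst_group[OF G]) (intro vlam_cong, simp add: appl_eq[symmetric])
qed

lemma aut_eqI:
  assumes "fun_on f (car G)" "fun_on g (car G)" "\<And>x. x \<in> elems G \<Longrightarrow> appl f x = appl g x"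
  shows "f = g"
  using assms by (intro fun_ext[of f "car G" g]) (auto simp: appl_eq)

text \<open>Via \<open>j\<close> each \<open>h\<close> in \<open>H\<close> is an automorphism
  \<open>A h\<close> of \<open>G\<close>, and an equation in \<open>H\<close> is verified by
  comparing automorphisms on \<open>G\<close>. The key fact is that the inner automorphism of
  \<open>x\<close>, conjugated by an automorphism \<open>f\<close>, is the inner automorphism of the
  image of \<open>x\<close> under \<open>f\<close>; so \<open>h\<close> acts on \<open>G\<close> by
  conjugation as \<open>A h\<close>.\<close>

lemma aut_ext_of_is_Aut_over:
  assumes G: "is_group G" and GH: "is_Aut_over G H"
  shows "aut_ext G H"
proof -
  have H: "is_group H" using GH by (simp add: is_Aut_over_def)
  note vf = vfst_group[OF G] vfst_group[OF H]
  have sub: "elems G \<subseteq> elems H" using GH by (simp add: is_Aut_over_def vf)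
  have in_H: "x \<in> elems H" if "x \<in> elems G" for x using sub that by blast
  obtain j where j: "fun_on j (car H)" "app j \<in> iso (struct H) (Aut G)"
    and j_inner: "\<And>x. x \<in> elems G \<Longrightarrow> app j x = inner_aut G x"
    using GH by (auto simp: is_Aut_over_def vf)
  define A where "A h = appl (app j h)" for h
  have j_hom: "app j \<in> hom (struct H) (Aut G)" and j_bij: "bij_betw (app j) (elems H) (carrier (Aut G))"
    using j(2) by (auto simp: iso_def carrier_struct[OF H])
  have aut: "is_aut G (app j h)" if "h \<in> elems H" for h
    using j_bij that carrier_Aut[OF G] by (auto simp: bij_betw_def)
  have Acl: "A h x \<in> elems G" if "h \<in> elems H" "x \<in> elems G" for h x
    unfolding A_def using aut_closed[OF G aut[OF that(1)] that(2)] .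
  have Amul: "A (mul H h h') x = A h (A h' x)"
    if "h \<in> elems H" "h' \<in> elems H" "x \<in> elems G" for h h' x
  proof -
    have "app j (mul H h h') = app j h \<otimes>\<^bsub>Aut G\<^esub> app j h'"
      using j_hom that by (auto simp: hom_def carrier_struct[OF H] mult_struct[OF H])
    also have "\<dots> = vlam (car G) (\<lambda>x. appl (app j h) (appl (app j h') x))"
      using that by (intro mult_Aut G aut)
    finally show ?thesis
      unfolding A_def using that(3) by (subst appl_vlam[symmetric, where A = "car G"]) (intro def_intro | simp)+
  qed
  have eqI: "h = h'" if "h \<in> elems H" "h' \<in> elems H" "\<And>x. x \<in> elems G \<Longrightarrow> A h x = A h' x" for h h'
  proof -
    have "app j h = app j h'"
      by (rule aut_eqI[OF aut_fun_on[OF G aut[OF that(1)]] aut_fun_on[OF G aut[OF that(2)]]])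
        (use that(3) in \<open>simp add: A_def\<close>)
    then show ?thesis using j_bij that(1,2) by (simp add: bij_betw_def inj_on_def)
  qed
  have Ahom: "A h (mul G x y) = mul G (A h x) (A h y)"
    if "h \<in> elems H" "x \<in> elems G" "y \<in> elems G" for h x y
    unfolding A_def using aut_mul[OF G aut[OF that(1)] that(2,3)] .
  have Ain: "A g x = mul G (mul G g x) (ginv G g)" if "g \<in> elems G" "x \<in> elems G" for g x
    using that j_inner[OF that(1)] by (simp add: A_def inner_aut_eq[OF G] appl_conj_map conj_in_self[OF G])
  have Ain2: "mul G (A g x) g = mul G g x" if "g \<in> elems G" "x \<in> elems G" for g x
    using that G by (simp add: Ain group_simps)
  have mul: "mul H x y = mul G x y" if xy: "x \<in> elems G" "y \<in> elems G" for x y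
  proof (rule eqI)
    fix z assume z: "z \<in> elems G"
    have A: "A x (A y z) \<in> elems G" "A y z \<in> elems G" "A (mul G x y) z \<in> elems G"
      using xy z G by (auto intro!: Acl in_H mul_closed)
    have "mul G (A x (A y z)) (mul G x y) = mul G (mul G (A x (A y z)) x) y"
      using A xy G by (simp add: mul_assoc)
    also have "\<dots> = mul G x (mul G (A y z) y)" using A xy G by (simp add: Ain2 mul_assoc)
    also have "\<dots> = mul G (mul G x y) z" using z xy G by (simp add: Ain2 mul_assoc)
    also have "\<dots> = mul G (A (mul G x y) z) (mul G x y)" using z xy G by (simp add: Ain2 mul_closed)
    finally have "A x (A y z) = A (mul G x y) z"
      using A xy by (subst (asm) mul_right_cancel[OF G]) (auto simp: mul_closed[OF G])
    then show "A (mul H x y) z = A (mul G x y) z" using xy z in_H by (simp add: Amul)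
  qed (use xy in_H mul_closed[OF G] mul_closed[OF H] in auto)
  have key: "mul H h x = mul H (A h x) h" if h: "h \<in> elems H" and x: "x \<in> elems G" for h x
  proof (rule eqI)
    fix z assume z: "z \<in> elems G"
    have c: "A x z \<in> elems G" "A h x \<in> elems G" "A h z \<in> elems G"
      using h x z in_H by (auto intro!: Acl)
    have "mul G (A h (A x z)) (A h x) = A h (mul G (A x z) x)" using c x h by (simp add: Ahom)
    also have "\<dots> = A h (mul G x z)" using x z by (simp add: Ain2)
    also have "\<dots> = mul G (A h x) (A h z)" using x z h by (simp add: Ahom)
    also have "\<dots> = mul G (A (A h x) (A h z)) (A h x)" using c by (simp add: Ain2)
    finally have "A h (A x z) = A (A h x) (A h z)"
      using c h in_H by (subst (asm) mul_right_cancel[OF G]) (auto intro!: Acl)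
    then show "A (mul H h x) z = A (mul H (A h x) h) z"
      using x z h c in_H by (simp add: Amul)
  qed (use h x in_H Acl[OF h x] mul_closed[OF H] in auto)
  show ?thesis
    unfolding aut_ext_def normal_ext_def
  proof (intro conjI ballI allI impI H sub mul)
    fix h x assume "h \<in> elems H" "x \<in> elems G"
    then show "\<exists>y\<in>elems G. mul H h x = mul H y h" using key Acl by blast
  next
    fix h assume h: "h \<in> elems H" and comm: "\<forall>x\<in>elems G. mul H h x = mul H x h"
    \<comment> \<open>Commuting with \<open>G\<close> means that \<open>A h\<close> fixes
      \<open>G\<close> pointwise, so \<open>A h\<close> is the identity and \<open>h\<close> is
      idempotent.\<close>
    have Ah: "A h x = x" if "x \<in> elems G" for x
      using key[OF h that] comm that h in_H Acl[OF h that]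
      by (metis mul_right_cancel[OF H])
    show "mul H h h = h"
      by (rule eqI[OF mul_closed[OF H h h] h]) (simp add: Amul[OF h h] Ah)
  next
    fix f assume "is_aut G f"
    then have "f \<in> app j ` elems H"
      using j_bij carrier_Aut[OF G, of f] by (simp add: bij_betw_def)
    then obtain h where h: "h \<in> elems H" "app j h = f" by blast
    then show "\<exists>h\<in>elems H. \<forall>x\<in>elems G. mul H h x = mul H (appl f x) h"
      using key[OF h(1)] by (intro bexI[of _ h]) (auto simp: A_def)
  qed
qed

text \<open>The isomorphism \<open>j\<close> is conjugation on \<open>G\<close>. It is injective
  because the centralizer of \<open>G\<close> in \<open>H\<close> is trivial, and surjective by the
  last clause of \<open>aut_ext\<close>.\<close>

lemma is_Aut_over_of_aut_ext:
  assumes G: "is_group G" and E: "aut_ext G H"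
  shows "is_Aut_over G H"
proof -
  have H: "is_group H" and sub: "elems G \<subseteq> elems H"
    and mul: "\<And>x y. x \<in> elems G \<Longrightarrow> y \<in> elems G \<Longrightarrow> mul H x y = mul G x y"
    using E by (simp_all add: aut_ext_def normal_ext_def)
  have N: "normal_ext G H" using E by (simp add: aut_ext_def)
  have in_H: "x \<in> elems H" if "x \<in> elems G" for x using sub that by blast
  define J where "J = conj_map (car G) H"
  have dJ: "definable_fn1 J" unfolding J_def by (intro def_intro)
  let ?c = "conj_in (car G) H"
  have aut: "is_aut G (J h)" if "h \<in> elems H" for h
    unfolding J_def by (rule is_aut_conj_map[OF N G that])
  have Jx: "appl (J h) x = ?c h x" if "x \<in> elems G" for h x
    unfolding J_def by (rule appl_conj_map[OF that])
  have J_fun: "fun_on (J h) (car G)" for h unfolding J_def by (rule fun_on_conj_map)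
  have Jmul: "J (mul H h h') = J h \<otimes>\<^bsub>Aut G\<^esub> J h'" if h: "h \<in> elems H" "h' \<in> elems H" for h h'
  proof (rule aut_eqI[OF J_fun])
    have d: "definable_fn1 (\<lambda>x. appl (J h) (appl (J h') x))" by (intro def_intro)
    show "fun_on (J h \<otimes>\<^bsub>Aut G\<^esub> J h') (car G)"
      unfolding mult_Aut[OF G aut[OF h(1)] aut[OF h(2)]] by (rule fun_on_vlam[OF d])
    fix x assume x: "x \<in> elems G"
    then show "appl (J (mul H h h')) x = appl (J h \<otimes>\<^bsub>Aut G\<^esub> J h') x"
      unfolding mult_Aut[OF G aut[OF h(1)] aut[OF h(2)]] appl_vlam[OF d x]
      using conj_in_conj_in[OF N h x] maps_conj_in(1)[OF N h(2) x] by (simp add: Jx)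
  qed
  have inj: "h = h'" if h: "h \<in> elems H" "h' \<in> elems H" and eq: "J h = J h'" for h h'
  proof -
    let ?i = "ginv H h'"
    have i: "?i \<in> elems H" using H h(2) by (rule ginv_closed)
    \<comment> \<open>If \<open>h\<close> and \<open>h'\<close> conjugate \<open>G\<close> in the
      same way, this quotient centralizes \<open>G\<close>.\<close>
    let ?u = "mul H ?i h"
    have u: "?u \<in> elems H" using H i h(1) by (rule mul_closed)
    have "mul H ?u x = mul H x ?u" if x: "x \<in> elems G" for x
    proof -
      have "?c h x = ?c h' x" using Jx[OF x] eq by metis
      then have "?c ?u x = ?c (unit H) x"
        using conj_in_conj_in[OF N i h(1) x] conj_in_conj_in[OF N i h(2) x] H h
        by (simp add: group_simps)
      also have "\<dots> = x" using H x sub in_H by (intro conj_in_eqI) (auto simp: group_simps)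
      finally show ?thesis using maps_conj_in(2)[OF N u x] by simp
    qed
    then have "?u = unit H" using E u idem_unit[OF H u] unfolding aut_ext_def normal_ext_def by blast
    then have "mul H h' ?u = h'" using H h by (simp add: group_simps)
    moreover have "mul H h' ?u = h"
      using H h i mul_assoc[OF H h(2) i h(1)] by (simp add: group_simps)
    ultimately show ?thesis by simp
  qed
  have surj: "\<exists>h\<in>elems H. J h = f" if f: "is_aut G f" for f
  proof -
    obtain h where h: "h \<in> elems H" "\<And>x. x \<in> elems G \<Longrightarrow> mul H h x = mul H (appl f x) h"
      using E f unfolding aut_ext_def normal_ext_def by blast
    have "J h = f"
    proof (rule aut_eqI[OF J_fun aut_fun_on[OF G f]])
      fix x assume x: "x \<in> elems G"
      show "appl (J h) x = appl f x"
        unfolding Jx[OF x] using aut_closed[OF G f x] h(2)[OF x]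
        by (intro conj_in_eqI[OF H sub h(1)]) simp_all
    qed
    then show ?thesis using h(1) by blast
  qed
  have inner: "J g = inner_aut G g" if g: "g \<in> elems G" for g
    unfolding inner_aut_eq[OF G g]
  proof (rule aut_eqI[OF J_fun fun_on_conj_map])
    fix x assume x: "x \<in> elems G"
    let ?y = "conj_in (car G) G g x"
    have y: "?y \<in> elems G" using G g x by (simp add: conj_in_self group_simps)
    have "mul G ?y g = mul G g x" using G g x by (simp add: conj_in_self group_simps)
    then have "?c g x = ?y"
      using g x y by (intro conj_in_eqI[OF H sub in_H]) (simp_all add: mul)
    then show "appl (J g) x = appl (conj_map (car G) G g) x"
      by (simp add: Jx x appl_conj_map)
  qed
  let ?j = "vlam (car H) J"
  have j: "app ?j h = J h" if "h \<in> elems H" for h by (rule app_vlam[OF dJ that])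
  have "app ?j \<in> iso (struct H) (Aut G)"
  proof -
    have "app ?j \<in> hom (struct H) (Aut G)"
      unfolding hom_def
      using aut by (auto simp: carrier_struct[OF H] mult_struct[OF H] carrier_Aut[OF G] j Jmul mul_closed[OF H])
    moreover have "bij_betw (app ?j) (elems H) (carrier (Aut G))"
      unfolding bij_betw_def inj_on_def
    proof (intro conjI ballI impI)
      show "app ?j ` elems H = carrier (Aut G)"
      proof -
        have "app ?j ` elems H = J ` elems H" by (rule image_cong[OF refl j])
        also have "\<dots> = carrier (Aut G)" using surj aut carrier_Aut[OF G] by blast
        finally show ?thesis .
      qed
    qed (use inj j in auto)
    ultimately show ?thesis by (simp add: iso_def carrier_struct[OF H])
  qed
  moreover have "app ?j x = inner_aut G x" if "x \<in> elems G" for x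
    using j[OF in_H[OF that]] inner[OF that] by simp
  ultimately show ?thesis
    unfolding is_Aut_over_def vfst_group[OF G] vfst_group[OF H]
    using H sub fun_on_vlam[OF dJ] by blast
qed

lemma centerless_group_iff:
  "centerless_group G \<longleftrightarrow> is_group G \<and>
     (\<forall>z\<in>elems G. (\<forall>x\<in>elems G. mul G z x = mul G x z) \<longrightarrow> mul G z z = z)"
proof (cases "is_group G")
  case True
  have 1: "z \<otimes>\<^bsub>struct G\<^esub> x = x \<otimes>\<^bsub>struct G\<^esub> z \<longleftrightarrow> mul G z x = mul G x z"
    if "z \<in> elems G" "x \<in> elems G" for x z
    using mult_struct[OF True that] mult_struct[OF True that(2,1)] by simp
  have 2: "z = unit G \<longleftrightarrow> mul G z z = z" if "z \<in> elems G" for z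
    using idem_unit[OF True that] by simp
  show ?thesis
    unfolding centerless_group_def carrier_struct[OF True]
    using True 1 2 by blast
next
  case False
  then show ?thesis unfolding centerless_group_def by blast
qed

lemma definable_centerless_group [def_intro]:
  assumes "definable_fn A" shows "definable (\<lambda>s. centerless_group (A s))"
  by (rule definable_sub1[OF _ assms], unfold centerless_group_iff, intro def_intro)

lemma
  assumes "aut_ext G H"
  shows aut_ext_group: "is_group H"
    and aut_ext_subset: "elems G \<subseteq> elems H"
    and aut_ext_mul: "x \<in> elems G \<Longrightarrow> y \<in> elems G \<Longrightarrow> mul H x y = mul G x y"
  using assms unfolding aut_ext_def normal_ext_def by blast+

text \<open>A step of the tower that changes the group therefore adds an element, and such an
  element is what a code describes.\<close>

lemma aut_ext_car_eq: "is_group G \<Longrightarrow> aut_ext G H \<Longrightarrow> car H = car G \<Longrightarrow> H = G"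
  by (rule group_eqI) (simp_all add: aut_ext_group aut_ext_mul)

lemma group_axI:
  assumes "\<And>x y. x \<in> elts c \<Longrightarrow> y \<in> elts c \<Longrightarrow> f x y \<in> elts c"
    and "\<And>x y z. x \<in> elts c \<Longrightarrow> y \<in> elts c \<Longrightarrow> z \<in> elts c \<Longrightarrow> f (f x y) z = f x (f y z)"
    and e: "e \<in> elts c" "\<And>x. x \<in> elts c \<Longrightarrow> f e x = x" "\<And>x. x \<in> elts c \<Longrightarrow> f x e = x"
    and inv: "\<And>x. x \<in> elts c \<Longrightarrow> \<exists>y\<in>elts c. f y x = e \<and> f x y = e"
  shows "group_ax c f"
proof -
  have "\<forall>x\<in>elts c. f e x = x \<and> f x e = x \<and> (\<exists>y\<in>elts c. f y x = e \<and> f x y = e)"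
    using e inv by simp
  then show ?thesis unfolding group_ax_def using assms(1,2) e(1) by (intro conjI) (simp, simp, rule bexI)
qed

section \<open>The automorphism group as an extension\<close>

definition comp_on :: "'v::zf \<Rightarrow> 'v \<Rightarrow> 'v \<Rightarrow> 'v" where
  "comp_on c f g = vlam c (\<lambda>x. appl f (appl g x))"

text \<open>Inner automorphisms are left out because the members of \<open>H\<close> themselves
  stand for them; this keeps \<open>H\<close> a literal subgroup of the next group.\<close>

definition outer_auts :: "'v::zf \<Rightarrow> 'v" where
  "outer_auts H = vsep (VPow (vprod (car H) (car H)))
     (\<lambda>f. is_aut H f \<and> \<not> (\<exists>g\<in>elems H. f = conj_map (car H) H g))"

text \<open>The pairs are fresh: by foundation no pair with first component \<open>c\<close> is a member of \<open>c\<close>.\<close>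

definition aut_carrier :: "'v::zf \<Rightarrow> 'v" where
  "aut_carrier H = vun (car H) (vimg (outer_auts H) (opair (car H)))"

definition aut_rep :: "'v::zf \<Rightarrow> 'v \<Rightarrow> 'v" where
  "aut_rep H h = (if h \<in> elems H then conj_map (car H) H h else psnd h)"

text \<open>Composition, carried over to names along \<open>aut_rep\<close>, which for a centerless
  \<open>H\<close> is a bijection between \<open>aut_carrier H\<close> and the automorphisms of
  \<open>H\<close>.\<close>

definition next_mul :: "'v::zf \<Rightarrow> 'v \<Rightarrow> 'v \<Rightarrow> 'v" where
  "next_mul H g h = the_or (\<lambda>k. k \<in> elts (aut_carrier H) \<and>
     aut_rep H k = comp_on (car H) (aut_rep H g) (aut_rep H h))"

definition next_group :: "'v::zf \<Rightarrow> 'v" where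
  "next_group H = mk_group (aut_carrier H) (next_mul H)"

lemma definable_fn_comp_on [def_intro]:
  assumes "definable_fn A" "definable_fn B" "definable_fn C"
  shows "definable_fn (\<lambda>s. comp_on (A s) (B s) (C s))"
  by (rule definable_fn_sub3[OF _ assms], unfold comp_on_def, intro def_intro)

lemma definable_fn_aut_carrier [def_intro]:
  assumes "definable_fn A" shows "definable_fn (\<lambda>s. aut_carrier (A s))"
  by (rule definable_fn_sub1[OF _ assms], unfold aut_carrier_def outer_auts_def, intro def_intro)

lemma definable_fn_aut_rep [def_intro]:
  assumes "definable_fn A" "definable_fn B" shows "definable_fn (\<lambda>s. aut_rep (A s) (B s))"
  by (rule definable_fn_sub2[OF _ assms], unfold aut_rep_def, intro def_intro)

lemma definable_fn_next_mul [def_intro]: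
  assumes "definable_fn A" "definable_fn B" "definable_fn C"
  shows "definable_fn (\<lambda>s. next_mul (A s) (B s) (C s))"
  by (rule definable_fn_sub3[OF _ assms], unfold next_mul_def, intro def_intro)

lemma definable_fn_next_group [def_intro]:
  assumes "definable_fn A" shows "definable_fn (\<lambda>s. next_group (A s))"
  by (rule definable_fn_sub1[OF _ assms], unfold next_group_def mk_group_def, intro def_intro)

lemma fun_on_comp: "fun_on (comp_on c f g) c"
  unfolding comp_on_def by (rule fun_on_vlam) (intro def_intro)

lemma appl_comp: "x \<in> elts c \<Longrightarrow> appl (comp_on c f g) x = appl f (appl g x)"
  unfolding comp_on_def by (rule appl_vlam) (intro def_intro | assumption)+

lemma elts_outer_auts:
  "f \<in> elts (outer_auts H) \<longleftrightarrow> is_aut H f \<and> (\<forall>g\<in>elems H. f \<noteq> conj_map (car H) H g)"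
proof -
  have d: "definable1 (\<lambda>f. is_aut H f \<and> \<not> (\<exists>g\<in>elems H. f = conj_map (car H) H g))"
    by (intro def_intro)
  show ?thesis
    unfolding outer_auts_def elts_vsep[OF d]
    using fun_subset_prod[of f "car H" "car H"] by (auto simp: is_aut_def)
qed

lemma elts_aut_carrier:
  "elts (aut_carrier H) = elems H \<union> opair (car H) ` elts (outer_auts H)"
proof -
  have "elts (vimg (outer_auts H) (opair (car H))) = opair (car H) ` elts (outer_auts H)"
    by (rule elts_vimg) (intro def_intro)
  then show ?thesis by (simp add: aut_carrier_def)
qed

lemma aut_rep_simps:
  "h \<in> elems H \<Longrightarrow> aut_rep H h = conj_map (car H) H h"
  "aut_rep H (opair (car H) f) = f"
  using opair_not_mem[of "car H" f] by (simp_all add: aut_rep_def)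

context
  fixes H :: "'v::zf"
  assumes centerless: "centerless_group H"
begin

lemma group_H: "is_group H"
  using centerless unfolding centerless_group_iff by blast

lemma is_aut_inner:
  assumes h: "h \<in> elems H" shows "is_aut H (conj_map (car H) H h)"
proof (rule is_aut_conj_map[OF _ group_H h])
  have "\<exists>y\<in>elems H. mul H g x = mul H y g" if "g \<in> elems H" "x \<in> elems H" for g x
    using that group_H by (intro bexI[of _ "mul H (mul H g x) (ginv H g)"]) (simp_all add: group_simps)
  then show "normal_ext H H" unfolding normal_ext_def using group_H by blast
qed

lemma is_aut_comp: assumes "is_aut H f" "is_aut H g" shows "is_aut H (comp_on (car H) f g)"
proof -
  note cl = aut_closed[OF group_H assms(1)] aut_closed[OF group_H assms(2)]
  have inj: "x = y" if "x \<in> elems H" "y \<in> elems H" "appl f (appl g x) = appl f (appl g y)" for x y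
    using assms that cl unfolding is_aut_def by blast
  have surj: "\<exists>x\<in>elems H. appl f (appl g x) = y" if "y \<in> elems H" for y
    using assms that unfolding is_aut_def by metis
  show ?thesis
    unfolding is_aut_def maps_iff
  proof (intro conjI ballI impI fun_on_comp)
    fix y assume "y \<in> elems H"
    then show "\<exists>x\<in>elems H. appl (comp_on (car H) f g) x = y"
      using surj[of y] appl_comp by metis
  qed (simp_all add: appl_comp cl inj mul_closed[OF group_H] aut_mul[OF group_H assms(1)]
      aut_mul[OF group_H assms(2)])
qed

lemma aut_rep_is_aut: "h \<in> elts (aut_carrier H) \<Longrightarrow> is_aut H (aut_rep H h)"
  using is_aut_inner by (auto simp: elts_aut_carrier aut_rep_simps elts_outer_auts)

text \<open>Equal conjugations make the quotient of \<open>g\<close> by \<open>g'\<close> central,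
  and the center of \<open>H\<close> is trivial.\<close>

lemma conj_map_inj:
  assumes g: "g \<in> elems H" "g' \<in> elems H" and eq: "conj_map (car H) H g = conj_map (car H) H g'"
  shows "g = g'"
proof -
  let ?i = "ginv H g'"
  let ?u = "mul H ?i g"
  have i: "?i \<in> elems H" and u: "?u \<in> elems H" using g group_H by (simp_all add: group_simps)
  have "mul H ?u x = mul H x ?u" if x: "x \<in> elems H" for x
  proof -
    let ?y = "conj_in (car H) H g x"
    have y: "?y \<in> elems H" "mul H ?y g = mul H g x"
      using g x group_H by (simp_all add: conj_in_self group_simps)
    have "?y = conj_in (car H) H g' x" using appl_conj_map[OF x] eq by metis
    then have y': "mul H ?y g' = mul H g' x" using g x group_H by (simp add: conj_in_self group_simps)
    have *: "mul H ?i ?y = mul H x ?i"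
    proof (rule mul_right_cancel[OF group_H, THEN iffD1])
      have "mul H (mul H ?i ?y) g' = mul H ?i (mul H g' x)"
        using group_H g i y(1) by (simp add: mul_assoc y')
      also have "\<dots> = mul H (mul H ?i g') x" using group_H g i x by (simp only: mul_assoc)
      also have "\<dots> = mul H (mul H x ?i) g'" using group_H g i x by (simp add: group_simps)
      finally show "mul H (mul H ?i ?y) g' = mul H (mul H x ?i) g'" .
    qed (use group_H g i x y(1) in \<open>simp_all add: mul_closed\<close>)
    have "mul H ?u x = mul H ?i (mul H ?y g)" using group_H g x i y by (simp add: mul_assoc)
    also have "\<dots> = mul H (mul H ?i ?y) g" using group_H g x i y(1) by (simp only: mul_assoc)
    finally show ?thesis using * group_H g x i by (simp add: mul_assoc)
  qed
  then have "?u = unit H" using centerless u idem_unit[OF group_H u] unfolding centerless_group_iff by blast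
  then have "mul H g' ?u = g'" using group_H g by (simp add: group_simps)
  moreover have "mul H g' ?u = g"
    using mul_assoc[OF group_H g(2) i g(1)] group_H g by (simp add: group_simps)
  ultimately show ?thesis by simp
qed

lemma aut_rep_inj:
  assumes "h \<in> elts (aut_carrier H)" "h' \<in> elts (aut_carrier H)" "aut_rep H h = aut_rep H h'"
  shows "h = h'"
  using assms conj_map_inj by (auto simp: elts_aut_carrier aut_rep_simps elts_outer_auts)

lemma aut_rep_surj:
  assumes "is_aut H f" shows "\<exists>h\<in>elts (aut_carrier H). aut_rep H h = f"
proof (cases "f \<in> elts (outer_auts H)")
  case True
  then show ?thesis
    by (intro bexI[of _ "opair (car H) f"]) (auto simp: aut_rep_simps elts_aut_carrier)
next
  case False
  then obtain g where "g \<in> elems H" "f = conj_map (car H) H g"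
    using assms by (auto simp: elts_outer_auts)
  then show ?thesis by (intro bexI[of _ g]) (auto simp: aut_rep_simps elts_aut_carrier)
qed

lemma next_mul:
  assumes "g \<in> elts (aut_carrier H)" "h \<in> elts (aut_carrier H)"
  shows "next_mul H g h \<in> elts (aut_carrier H)"
    and "aut_rep H (next_mul H g h) = comp_on (car H) (aut_rep H g) (aut_rep H h)"
proof -
  have "\<exists>k\<in>elts (aut_carrier H). aut_rep H k = comp_on (car H) (aut_rep H g) (aut_rep H h)"
    using assms by (intro aut_rep_surj is_aut_comp aut_rep_is_aut)
  then have "\<exists>!k. k \<in> elts (aut_carrier H) \<and>
      aut_rep H k = comp_on (car H) (aut_rep H g) (aut_rep H h)"
    using aut_rep_inj by metis
  from the_orI[OF this] show "next_mul H g h \<in> elts (aut_carrier H)"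
    "aut_rep H (next_mul H g h) = comp_on (car H) (aut_rep H g) (aut_rep H h)"
    unfolding next_mul_def by blast+
qed

lemma appl_next_mul:
  assumes "g \<in> elts (aut_carrier H)" "h \<in> elts (aut_carrier H)" "x \<in> elems H"
  shows "appl (aut_rep H (next_mul H g h)) x = appl (aut_rep H g) (appl (aut_rep H h) x)"
  using next_mul(2)[OF assms(1,2)] appl_comp[OF assms(3)] by simp

lemma aut_rep_eqI:
  assumes h: "h \<in> elts (aut_carrier H)" "h' \<in> elts (aut_carrier H)"
    and "\<And>x. x \<in> elems H \<Longrightarrow> appl (aut_rep H h) x = appl (aut_rep H h') x"
  shows "h = h'"
  by (rule aut_rep_inj[OF h], rule aut_eqI)
    (use aut_fun_on[OF group_H aut_rep_is_aut] h assms(3) in blast)+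

lemma aut_rep_closed:
  "h \<in> elts (aut_carrier H) \<Longrightarrow> x \<in> elems H \<Longrightarrow> appl (aut_rep H h) x \<in> elems H"
  using aut_closed[OF group_H aut_rep_is_aut] .

lemma aut_inverse:
  assumes h: "h \<in> elts (aut_carrier H)"
  obtains k where "k \<in> elts (aut_carrier H)"
    "\<And>x. x \<in> elems H \<Longrightarrow> appl (aut_rep H k) (appl (aut_rep H h) x) = x"
    "\<And>x. x \<in> elems H \<Longrightarrow> appl (aut_rep H h) (appl (aut_rep H k) x) = x"
proof -
  let ?f = "appl (aut_rep H h)"
  define F where "F = (\<lambda>y. the_or (\<lambda>x. x \<in> elems H \<and> ?f x = y))"
  have dF: "definable_fn1 F" unfolding F_def by (intro def_intro)
  note aut = aut_rep_is_aut[OF h]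
  have ex1: "\<exists>!x. x \<in> elems H \<and> ?f x = y" if "y \<in> elems H" for y
    using aut that unfolding is_aut_def by blast
  have F: "F y \<in> elems H" "?f (F y) = y" if "y \<in> elems H" for y
    using the_orI[OF ex1[OF that]] by (simp_all add: F_def)
  have F': "F (?f x) = x" if "x \<in> elems H" for x
    using F[OF aut_rep_closed[OF h that]] aut that unfolding is_aut_def by blast
  have F_mul: "F (mul H x y) = mul H (F x) (F y)" if xy: "x \<in> elems H" "y \<in> elems H" for x y
  proof -
    have "?f (mul H (F x) (F y)) = mul H x y"
      using aut_mul[OF group_H aut F(1) F(1)] F(2) xy by simp
    then show ?thesis using F' F(1) xy mul_closed[OF group_H] by metis
  qed
  have "is_aut H (vlam (car H) F)"
    unfolding is_aut_def maps_iff
  proof (intro conjI ballI impI fun_on_vlam dF)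
    fix x y assume "x \<in> elems H" "y \<in> elems H"
      "appl (vlam (car H) F) x = appl (vlam (car H) F) y"
    then show "x = y" using F(2) by (simp add: appl_vlam[OF dF]) metis
  next
    fix y assume y: "y \<in> elems H"
    show "\<exists>x\<in>elems H. appl (vlam (car H) F) x = y"
      using F'[OF y] aut_rep_closed[OF h y] by (auto simp: appl_vlam[OF dF])
  qed (simp_all add: appl_vlam[OF dF] F F_mul mul_closed[OF group_H])
  then obtain k where k: "k \<in> elts (aut_carrier H)" "aut_rep H k = vlam (car H) F"
    using aut_rep_surj by blast
  show thesis
    by (rule that[OF k(1)]) (simp_all add: k(2) appl_vlam[OF dF] F F' aut_rep_closed[OF h])
qed

lemma is_aut_id: "is_aut H (vlam (car H) (\<lambda>x. x))"
proof -
  have d: "definable_fn1 (\<lambda>x. x)" by (intro def_intro)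
  show ?thesis
    unfolding is_aut_def maps_iff
    by (simp add: fun_on_vlam[OF d] appl_vlam[OF d] mul_closed[OF group_H])
qed

lemma group_ax_next_mul: "group_ax (aut_carrier H) (next_mul H)"
proof -
  obtain e where e: "e \<in> elts (aut_carrier H)" "aut_rep H e = vlam (car H) (\<lambda>x. x)"
    using aut_rep_surj[OF is_aut_id] by blast
  have e_id: "appl (aut_rep H e) x = x" if "x \<in> elems H" for x
    unfolding e(2) by (rule appl_vlam) (use that in \<open>auto intro: def_intro\<close>)
  have inv: "\<exists>k\<in>elts (aut_carrier H). next_mul H k h = e \<and> next_mul H h k = e"
    if h: "h \<in> elts (aut_carrier H)" for h
  proof -
    obtain k where k: "k \<in> elts (aut_carrier H)"
      "\<And>x. x \<in> elems H \<Longrightarrow> appl (aut_rep H k) (appl (aut_rep H h) x) = x"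
      "\<And>x. x \<in> elems H \<Longrightarrow> appl (aut_rep H h) (appl (aut_rep H k) x) = x"
      using aut_inverse[OF h] by blast
    have "next_mul H k h = e"
      by (rule aut_rep_eqI[OF next_mul(1)[OF k(1) h] e(1)]) (simp add: appl_next_mul[OF k(1) h] e_id k(2))
    moreover have "next_mul H h k = e"
      by (rule aut_rep_eqI[OF next_mul(1)[OF h k(1)] e(1)]) (simp add: appl_next_mul[OF h k(1)] e_id k(3))
    ultimately show ?thesis using k(1) by blast
  qed
  have "next_mul H (next_mul H x y) z = next_mul H x (next_mul H y z)"
    if "x \<in> elts (aut_carrier H)" "y \<in> elts (aut_carrier H)" "z \<in> elts (aut_carrier H)" for x y z
    by (rule aut_rep_eqI) (use that in \<open>simp_all add: next_mul(1) appl_next_mul aut_rep_closed\<close>)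
  moreover have "next_mul H e x = x" if x: "x \<in> elts (aut_carrier H)" for x
    by (rule aut_rep_eqI[OF next_mul(1)[OF e(1) x] x])
      (simp add: appl_next_mul[OF e(1) x] e_id aut_rep_closed[OF x])
  moreover have "next_mul H x e = x" if x: "x \<in> elts (aut_carrier H)" for x
    by (rule aut_rep_eqI[OF next_mul(1)[OF x e(1)] x])
      (simp add: appl_next_mul[OF x e(1)] e_id aut_rep_closed[OF x])
  ultimately show ?thesis
    by (intro group_axI[of _ _ e]) (simp_all add: next_mul(1) e(1) inv)
qed

lemma aut_ext_next_group: "aut_ext H (next_group H)"
proof -
  have d: "definable_fn (\<lambda>s. next_mul H (s 0) (s 1))" by (intro def_intro)
  have grp: "is_group (next_group H)"
    unfolding next_group_def using d group_ax_next_mul by (rule is_group_mk_group)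
  have mul: "mul (next_group H) x y = next_mul H x y"
    if "x \<in> elts (aut_carrier H)" "y \<in> elts (aut_carrier H)" for x y
    unfolding next_group_def by (rule mul_mk_group[OF d that])
  have car: "car (next_group H) = aut_carrier H" by (simp add: next_group_def)
  have dr: "definable_fn1 (aut_rep H)" by (intro def_intro)
  let ?j = "vlam (aut_carrier H) (aut_rep H)"
  have j: "app ?j x = aut_rep H x" if "x \<in> elts (aut_carrier H)" for x
    by (rule app_vlam[OF dr that])
  have "app ?j ` elts (aut_carrier H) = aut_rep H ` elts (aut_carrier H)"
    by (rule image_cong[OF refl j])
  also have "\<dots> = carrier (Aut H)"
    using aut_rep_surj aut_rep_is_aut carrier_Aut[OF group_H] by blast
  finally have "bij_betw (app ?j) (carrier (struct (next_group H))) (carrier (Aut H))"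
    using aut_rep_inj by (simp add: bij_betw_def inj_on_def j carrier_struct[OF grp] car)
  moreover have "app ?j \<in> hom (struct (next_group H)) (Aut H)"
  proof -
    have "aut_rep H (next_mul H x y) = aut_rep H x \<otimes>\<^bsub>Aut H\<^esub> aut_rep H y"
      if "x \<in> elts (aut_carrier H)" "y \<in> elts (aut_carrier H)" for x y
      using next_mul(2)[OF that] mult_Aut[OF group_H aut_rep_is_aut aut_rep_is_aut] that
      by (simp add: comp_on_def)
    then show ?thesis
      by (auto simp: hom_def carrier_struct[OF grp] car mult_struct[OF grp] mul j next_mul(1)
          carrier_Aut[OF group_H] aut_rep_is_aut)
  qed
  moreover have "app ?j x = inner_aut H x" if "x \<in> elems H" for x
    using that by (simp add: j elts_aut_carrier aut_rep_simps inner_aut_eq[OF group_H])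
  ultimately have "is_Aut_over H (next_group H)"
    unfolding is_Aut_over_def vfst_group[OF group_H] vfst_group[OF grp] car
    using grp fun_on_vlam[OF dr] by (auto simp: iso_def elts_aut_carrier)
  then show ?thesis by (rule aut_ext_of_is_Aut_over[OF group_H])
qed

end

section \<open>Towers\<close>

definition subgrp :: "'v::zf \<Rightarrow> 'v \<Rightarrow> bool" where
  "subgrp G H \<longleftrightarrow> elems G \<subseteq> elems H \<and>
     (\<forall>x\<in>elems G. \<forall>y\<in>elems G. mul H x y = mul G x y)"

lemma definable_subgrp [def_intro]:
  assumes "definable_fn A" "definable_fn B" shows "definable (\<lambda>s. subgrp (A s) (B s))"
  by (rule definable_sub2[OF _ assms], unfold subgrp_def, intro def_intro)

lemma subgrp_refl: "subgrp G G"
  by (simp add: subgrp_def)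

lemma subgrp_trans: "subgrp G H \<Longrightarrow> subgrp H K \<Longrightarrow> subgrp G K"
  by (simp add: subgrp_def subset_iff)

lemma subgrp_mem: "subgrp G H \<Longrightarrow> x \<in> elems G \<Longrightarrow> x \<in> elems H"
  by (auto simp: subgrp_def)

lemma subgrp_mul: "subgrp G H \<Longrightarrow> x \<in> elems G \<Longrightarrow> y \<in> elems G \<Longrightarrow> mul H x y = mul G x y"
  by (simp add: subgrp_def)

lemma aut_ext_subgrp: "aut_ext G H \<Longrightarrow> subgrp G H"
  by (simp add: subgrp_def aut_ext_subset aut_ext_mul)

lemma subgrp_unit:
  assumes "is_group G" "is_group H" "subgrp G H" shows "unit G = unit H"
  using idem_unit[OF assms(2), of "unit G"] assms
  by (simp add: subgrp_mem subgrp_mul unit_closed mul_unit_left)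

lemma subgrp_ginv:
  assumes GH: "is_group G" "is_group H" "subgrp G H" and x: "x \<in> elems G"
  shows "ginv H x = ginv G x"
proof -
  have "mul H (ginv H x) x = mul H (ginv G x) x"
    using assms by (simp add: subgrp_mem subgrp_mul ginv_closed mul_ginv_left subgrp_unit)
  then show ?thesis
    using GH x by (subst (asm) mul_right_cancel) (auto simp: subgrp_mem ginv_closed)
qed

section \<open>Unions of chains of groups\<close>

definition union_group :: "'v::zf \<Rightarrow> ('v \<Rightarrow> 'v) \<Rightarrow> 'v" where
  "union_group A F = opair (vUN A (\<lambda>b. car (F b))) (vUN A (\<lambda>b. psnd (F b)))"

text \<open>Any two elements lie in a common group of the chain. Hence the union of the graphs of
  the multiplications is again a function, and each group law is inherited from a group that
  contains the elements involved.\<close>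

lemma union_group_chain:
  assumes F: "definable_fn1 F" and ne: "a0 \<in> elts A"
    and grp: "\<And>b. b \<in> elts A \<Longrightarrow> is_group (F b)"
    and chain: "\<And>b c. b \<in> elts A \<Longrightarrow> c \<in> elts A \<Longrightarrow> subgrp (F b) (F c) \<or> subgrp (F c) (F b)"
  shows "is_group (union_group A F)"
    and "\<And>b. b \<in> elts A \<Longrightarrow> subgrp (F b) (union_group A F)"
    and "elems (union_group A F) = (\<Union>b\<in>elts A. elems (F b))"
proof -
  let ?U = "union_group A F"
  have "definable_fn1 (\<lambda>b. car (F b))" "definable_fn1 (\<lambda>b. psnd (F b))"
    by (intro def_intro definable_fn_sub1[OF F])+
  then have C: "elems ?U = (\<Union>b\<in>elts A. elems (F b))"
    and M: "elts (psnd ?U) = (\<Union>b\<in>elts A. elts (psnd (F b)))"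
    by (simp_all add: union_group_def elts_vUN)
  show "elems ?U = (\<Union>b\<in>elts A. elems (F b))" by (rule C)
  have mem: "p \<in> elts (psnd ?U) \<longleftrightarrow> (\<exists>b\<in>elts A. \<exists>x\<in>elems (F b). \<exists>y\<in>elems (F b).
      p = opair (opair x y) (mul (F b) x y))" for p
    unfolding M using mem_psnd_iff[OF grp] by blast
  have two: "\<exists>c\<in>elts A. x \<in> elems (F c) \<and> y \<in> elems (F c)"
    if "x \<in> elems ?U" "y \<in> elems ?U" for x y
  proof -
    obtain b c where "b \<in> elts A" "x \<in> elems (F b)" "c \<in> elts A" "y \<in> elems (F c)"
      using \<open>x \<in> _\<close> \<open>y \<in> _\<close> C by auto
    then show ?thesis using chain[of b c] subgrp_mem by blast
  qed
  have agree: "mul (F b) x y = mul (F c) x y"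
    if "b \<in> elts A" "c \<in> elts A" "x \<in> elems (F b)" "y \<in> elems (F b)"
      "x \<in> elems (F c)" "y \<in> elems (F c)" for b c x y
    using chain[OF that(1,2)] that subgrp_mul by metis
  have ex1: "\<exists>!z. opair (opair x y) z \<in> elts (psnd ?U)" if xy: "x \<in> elems ?U" "y \<in> elems ?U" for x y
    using two[OF xy] agree unfolding mem opair_eq by metis
  have dom: "\<exists>q\<in>elts (vprod (car ?U) (car ?U)). \<exists>z. p = opair q z" if "p \<in> elts (psnd ?U)" for p
    using that unfolding mem elts_vprod C by blast
  have f: "fun_on (psnd ?U) (vprod (car ?U) (car ?U))"
    unfolding fun_on_def
  proof (intro conjI ballI)
    fix q assume "q \<in> elts (vprod (car ?U) (car ?U))"
    then obtain x y where "q = opair x y" "x \<in> elems ?U" "y \<in> elems ?U"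
      unfolding elts_vprod by blast
    then show "\<exists>!z. opair q z \<in> elts (psnd ?U)" using ex1 by metis
  qed (use dom in blast)
  have mul: "mul ?U x y = mul (F b) x y"
    if "b \<in> elts A" "x \<in> elems (F b)" "y \<in> elems (F b)" for b x y
  proof -
    have "opair x y \<in> elts (vprod (car ?U) (car ?U))" using that C by auto
    moreover have "opair (opair x y) (mul (F b) x y) \<in> elts (psnd ?U)" unfolding mem using that by blast
    ultimately show ?thesis using app_eqI[OF f] appl_eq[OF f] by (simp add: mul_def)
  qed
  have closed: "mul ?U x y \<in> elems ?U" if "x \<in> elems ?U" "y \<in> elems ?U" for x y
    using two[OF that] mul mul_closed[OF grp] C by (metis (no_types, lifting) UN_iff)
  show sub: "subgrp (F b) ?U" if "b \<in> elts A" for b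
    unfolding subgrp_def using mul[OF that] that C by auto
  have "group_ax (car ?U) (mul ?U)"
  proof (rule group_axI)
    show "mul ?U x y \<in> elems ?U" if "x \<in> elems ?U" "y \<in> elems ?U" for x y
      by (rule closed[OF that])
    show "mul ?U (mul ?U x y) z = mul ?U x (mul ?U y z)"
      if "x \<in> elems ?U" "y \<in> elems ?U" "z \<in> elems ?U" for x y z
    proof -
      obtain b c where "b \<in> elts A" "x \<in> elems (F b)" "y \<in> elems (F b)"
        "c \<in> elts A" "z \<in> elems (F c)"
        using two[OF \<open>x \<in> _\<close> \<open>y \<in> _\<close>] \<open>z \<in> _\<close> C by auto
      then obtain d where "d \<in> elts A" "x \<in> elems (F d)" "y \<in> elems (F d)" "z \<in> elems (F d)"
        using chain[of b c] subgrp_mem by blast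
      then show ?thesis by (simp add: mul mul_closed[OF grp] mul_assoc[OF grp])
    qed
    show "unit (F a0) \<in> elems ?U" using unit_closed[OF grp[OF ne]] ne C by auto
    \<comment> \<open>The unit of the union is taken from \<open>F a0\<close>. The unit laws are
      checked in a group of the chain that contains \<open>x\<close> and has the same unit.\<close>
    have ex: "\<exists>b\<in>elts A. x \<in> elems (F b) \<and> unit (F a0) \<in> elems (F b) \<and> unit (F b) = unit (F a0)"
      if x: "x \<in> elems ?U" for x
    proof -
      obtain b where b: "b \<in> elts A" "x \<in> elems (F b)" using x C by auto
      show ?thesis
      proof (cases "subgrp (F b) (F a0)")
        case True
        then have "unit (F b) = unit (F a0)" using grp b ne by (intro subgrp_unit) auto
        then show ?thesis using b unit_closed[OF grp[OF b(1)]] by auto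
      next
        case False
        then have "subgrp (F a0) (F b)" using chain[OF b(1) ne] by blast
        then have "unit (F a0) = unit (F b)" using grp b ne by (intro subgrp_unit) auto
        then show ?thesis using b unit_closed[OF grp[OF b(1)]] by auto
      qed
    qed
    show "mul ?U (unit (F a0)) x = x" "mul ?U x (unit (F a0)) = x" if x: "x \<in> elems ?U" for x
    proof -
      obtain b where b: "b \<in> elts A" "x \<in> elems (F b)" "unit (F a0) \<in> elems (F b)"
        "unit (F b) = unit (F a0)" using ex[OF x] by blast
      show "mul ?U (unit (F a0)) x = x" "mul ?U x (unit (F a0)) = x"
        using mul[OF b(1) b(3,2)] mul[OF b(1) b(2,3)] mul_unit_left[OF grp[OF b(1)] b(2)]
          mul_unit_right[OF grp[OF b(1)] b(2)] b(4) by simp_all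
    qed
    show "\<exists>y\<in>elems ?U. mul ?U y x = unit (F a0) \<and> mul ?U x y = unit (F a0)"
      if x: "x \<in> elems ?U" for x
    proof -
      obtain b where b: "b \<in> elts A" "x \<in> elems (F b)" "unit (F b) = unit (F a0)" using ex[OF x] by blast
      have i: "ginv (F b) x \<in> elems (F b)" using ginv_closed[OF grp[OF b(1)] b(2)] .
      then have "ginv (F b) x \<in> elems ?U" using b(1) C by auto
      then show ?thesis
        using mul[OF b(1) i b(2)] mul[OF b(1) b(2) i] mul_ginv_left[OF grp[OF b(1)] b(2)]
          mul_ginv_right[OF grp[OF b(1)] b(2)] b(3) by auto
    qed
  qed
  moreover have "maps (psnd ?U) (vprod (car ?U) (car ?U)) (car ?U)"
    unfolding maps_iff using f closed by (auto simp: mul_def)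
  moreover have "?U = opair (car ?U) (psnd ?U)" by (simp add: union_group_def)
  ultimately show "is_group ?U" unfolding is_group_iff by blast
qed

text \<open>\<open>mul H g a = mul H b g\<close> says that conjugation by \<open>g\<close> takes
  \<open>a\<close> to \<open>b\<close>. This lemma composes such statements and the next one
  reverses them, so that conjugation by a long product can be treated factor by factor.\<close>

lemma conj_rel_comp:
  assumes H: "is_group H" and "g \<in> elems H" "h \<in> elems H" "a \<in> elems H" "b \<in> elems H" "c \<in> elems H"
    and ab: "mul H g a = mul H b g" and bc: "mul H h b = mul H c h"
  shows "mul H (mul H h g) a = mul H c (mul H h g)"
proof -
  have "mul H (mul H h g) a = mul H h (mul H b g)" using assms by (simp add: mul_assoc)
  also have "\<dots> = mul H (mul H c h) g" using assms by (simp add: mul_assoc[symmetric])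
  also have "\<dots> = mul H c (mul H h g)" using assms by (simp add: mul_assoc)
  finally show ?thesis .
qed

lemma conj_rel_inv:
  assumes H: "is_group H" and g: "g \<in> elems H" and ab: "a \<in> elems H" "b \<in> elems H"
    and eq: "mul H g a = mul H b g"
  shows "mul H (ginv H g) b = mul H a (ginv H g)"
proof -
  have i: "ginv H g \<in> elems H" using H g by (rule ginv_closed)
  have "mul H (mul H (ginv H g) b) g = mul H (ginv H g) (mul H g a)"
    using H g ab i by (simp add: mul_assoc eq)
  also have "\<dots> = mul H (mul H (ginv H g) g) a" using H g ab i by (simp only: mul_assoc)
  also have "\<dots> = mul H (mul H a (ginv H g)) g" using H g ab i by (simp add: group_simps)
  finally show ?thesis
    using H g ab i by (subst (asm) mul_right_cancel) (simp_all add: mul_closed)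
qed

text \<open>Conjugate \<open>x\<close> by the factors of \<open>u\<close> from right to left: the
  inverse of \<open>z\<close> fixes \<open>x\<close>, \<open>y\<close> takes \<open>x\<close> to
  \<open>w\<close>, \<open>z\<close> fixes \<open>w\<close>, and the inverse of \<open>y\<close>
  takes \<open>w\<close> back to \<open>x\<close>.\<close>

lemma commutator_commutes:
  assumes H: "is_group H" and c: "z \<in> elems H" "y \<in> elems H" "x \<in> elems H" "w \<in> elems H"
    and zx: "mul H z x = mul H x z" and yx: "mul H y x = mul H w y" and zw: "mul H z w = mul H w z"
  defines "u \<equiv> mul H (ginv H y) (mul H z (mul H y (ginv H z)))"
  shows "mul H u x = mul H x u"
proof -
  have i: "ginv H y \<in> elems H" "ginv H z \<in> elems H" using H c by (simp_all add: ginv_closed)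
  note cl = mul_closed[OF H]
  have yk: "mul H y (ginv H z) \<in> elems H" "mul H z (mul H y (ginv H z)) \<in> elems H"
    using c i by (simp_all add: cl)
  have "mul H (ginv H z) x = mul H x (ginv H z)" by (rule conj_rel_inv[OF H c(1) c(3) c(3) zx])
  from conj_rel_comp[OF H i(2) c(2) c(3) c(3) c(4) this yx]
  have "mul H (mul H y (ginv H z)) x = mul H w (mul H y (ginv H z))" .
  from conj_rel_comp[OF H yk(1) c(1) c(3) c(4) c(4) this zw]
  have "mul H (mul H z (mul H y (ginv H z))) x = mul H w (mul H z (mul H y (ginv H z)))" .
  from conj_rel_comp[OF H yk(2) i(1) c(3) c(4) c(3) this conj_rel_inv[OF H c(2,3,4) yx]]
  show ?thesis unfolding u_def .
qed

lemma aut_ext_conj_closed: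
  assumes E: "aut_ext G H" and h: "h \<in> elems H" and x: "x \<in> elems G"
  shows "mul H h (mul H x (ginv H h)) \<in> elems G"
proof -
  note H = aut_ext_group[OF E]
  have x': "x \<in> elems H" using aut_ext_subset[OF E] x by blast
  obtain y where y: "y \<in> elems G" "mul H h x = mul H y h"
    using E h x unfolding aut_ext_def normal_ext_def by blast
  have y': "y \<in> elems H" using aut_ext_subset[OF E] y(1) by blast
  have "mul H h (mul H x (ginv H h)) = mul H (mul H h x) (ginv H h)"
    using H h x' by (simp add: group_simps)
  also have "\<dots> = y" using H h y' by (simp add: y(2) group_simps)
  finally show ?thesis using y(1) by simp
qed

definition central_triv :: "'v::zf \<Rightarrow> 'v \<Rightarrow> bool" where
  "central_triv G H \<longleftrightarrow> (\<forall>z\<in>elems H. (\<forall>x\<in>elems G. mul H z x = mul H x z) \<longrightarrow> mul H z z = z)"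

lemma definable_central_triv [def_intro]:
  assumes "definable_fn A" "definable_fn B" shows "definable (\<lambda>s. central_triv (A s) (B s))"
  by (rule definable_sub2[OF _ assms], unfold central_triv_def, intro def_intro)

lemma central_trivD:
  "central_triv G H \<Longrightarrow> is_group H \<Longrightarrow> z \<in> elems H \<Longrightarrow>
    (\<And>x. x \<in> elems G \<Longrightarrow> mul H z x = mul H x z) \<Longrightarrow> z = unit H"
  unfolding central_triv_def using idem_unit by blast

text \<open>The function \<open>F\<close> restricted to the ordinal \<open>d\<close> is a tower; unlike in \<open>aut_tower\<close>, all clauses
  are definable.\<close>

locale tower =
  fixes F :: "'v::zf \<Rightarrow> 'v" and d :: 'v
  assumes Ord_d: "Ord d" and F: "definable_fn1 F"
    and base: "vzero \<in> elts d \<Longrightarrow> centerless_group (F vzero)"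
    and succ: "\<And>a. vsucc a \<in> elts d \<Longrightarrow> centerless_group (F a) \<Longrightarrow> aut_ext (F a) (F (vsucc a))"
    and lim: "\<And>a. a \<in> elts d \<Longrightarrow> Limit_Ord a \<Longrightarrow> (\<And>b. b \<in> elts a \<Longrightarrow> is_group (F b)) \<Longrightarrow>
      F a = union_group a F"
begin

text \<open>The clauses are proved by one simultaneous induction: \<open>succ\<close> applies only
  once the current level is known to be centerless, and this follows from the trivial centralizer of
  the base group.\<close>

definition good :: "'v \<Rightarrow> bool" where
  "good a \<longleftrightarrow> is_group (F a) \<and> (\<forall>b\<in>elts a. subgrp (F b) (F a)) \<and> central_triv (F vzero) (F a)"

lemma Ord_below: "a \<in> elts d \<Longrightarrow> Ord a"
  using Ord_mem[OF Ord_d] .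

lemma good_centerless:
  assumes "good a" "Ord a" shows "centerless_group (F a)"
proof -
  have "subgrp (F vzero) (F a)"
  proof (cases "a = vzero")
    case False
    then show ?thesis using assms Ord_vzero_mem unfolding good_def by blast
  qed (simp add: subgrp_refl)
  then show ?thesis
    using assms subgrp_mem unfolding good_def central_triv_def centerless_group_iff by blast
qed

text \<open>An inner induction on \<open>c\<close> up to \<open>a\<close> shows that
  \<open>z\<close> centralizes \<open>F c\<close>. For \<open>c\<close> equal to \<open>a\<close>
  the conclusion is the centralizer clause of \<open>aut_ext\<close>.\<close>

lemma succ_central:
  assumes sa: "vsucc a \<in> elts d" and good: "\<And>b. b \<in> elts (vsucc a) \<Longrightarrow> good b"
  shows "central_triv (F vzero) (F (vsucc a))"
  unfolding central_triv_def
proof (intro ballI impI)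
  let ?H = "F (vsucc a)"
  fix z assume z: "z \<in> elems ?H" and z0: "\<forall>x\<in>elems (F vzero). mul ?H z x = mul ?H x z"
  have Oa: "Ord a" using Ord_below[OF sa] by (rule Ord_vsucc_D)
  have ga: "good a" using good by simp
  have Fa: "is_group (F a)" using ga by (simp add: good_def)
  have E: "aut_ext (F a) ?H" by (rule succ[OF sa good_centerless[OF ga Oa]])
  note H = aut_ext_group[OF E]
  have sub: "subgrp (F b) (F a)" if "b \<in> elts (vsucc a)" for b
    using that ga subgrp_refl unfolding good_def elts_vsucc by blast
  have sub': "subgrp (F b) ?H" if "b \<in> elts (vsucc a)" for b
    using subgrp_trans[OF sub[OF that] aut_ext_subgrp[OF E]] .
  have "c \<in> elts (vsucc a) \<longrightarrow> (\<forall>y\<in>elems (F c). mul ?H z y = mul ?H y z)" if "Ord c" for c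
    using _ that
  proof (rule Ord_induct)
    show "definable (\<lambda>s. s 0 \<in> elts (vsucc a) \<longrightarrow> (\<forall>y\<in>elems (F (s 0)). mul ?H z y = mul ?H y z))"
      by (intro def_intro definable_fn_sub1[OF F])
  next
    fix c assume c: "Ord c"
      and IH: "\<And>b. b \<in> elts c \<Longrightarrow> b \<in> elts (vsucc a) \<longrightarrow> (\<forall>y\<in>elems (F b). mul ?H z y = mul ?H y z)"
    show "c \<in> elts (vsucc a) \<longrightarrow> (\<forall>y\<in>elems (F c). mul ?H z y = mul ?H y z)"
    proof (intro impI ballI)
      fix y assume ca: "c \<in> elts (vsucc a)" and y: "y \<in> elems (F c)"
      have below: "b \<in> elts (vsucc a)" if "b \<in> elts c" for b
        using Ord_trans[OF Ord_vsucc[OF Oa] that ca] .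
      have cd: "c \<in> elts d"
        using ca Ord_trans[OF Ord_d, of c "vsucc a"] sa by simp
      from c show "mul ?H z y = mul ?H y z"
      proof (cases rule: Ord_cases3)
        case 1
        then show ?thesis using z0 y by blast
      next
        case 3
        have "F c = union_group c F"
          by (rule lim[OF cd 3]) (use good below in \<open>auto simp: good_def\<close>)
        moreover have "elems (union_group c F) = (\<Union>b\<in>elts c. elems (F b))"
          unfolding union_group_def pfst_opair by (rule elts_vUN) (intro def_intro definable_fn_sub1[OF F])
        ultimately obtain b where "b \<in> elts c" "y \<in> elems (F b)" using y by auto
        then show ?thesis using IH[of b] below[of b] by blast
      next
        case (2 b)
        have bc: "b \<in> elts c" using 2 by simp
        have bd: "vsucc b \<in> elts d" using cd 2 by simp
        have Eb: "aut_ext (F b) (F c)"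
          using succ[OF bd good_centerless[OF good[OF below[OF bc]] 2(1)]] 2(2) by simp
        have yH: "y \<in> elems ?H" and ya: "y \<in> elems (F a)"
          using y sub'[OF ca] sub[OF ca] subgrp_mem by blast+
        \<comment> \<open>This commutator lies in \<open>F a\<close>, because \<open>z\<close>
          normalizes \<open>F a\<close>, and it commutes with \<open>F b\<close>, because
          \<open>z\<close> does and \<open>y\<close> normalizes \<open>F b\<close>. In
          \<open>F a\<close> the centralizer of the base is already known to be trivial.\<close>
        let ?u = "mul ?H (ginv ?H y) (mul ?H z (mul ?H y (ginv ?H z)))"
        let ?p = "mul ?H z (mul ?H y (ginv ?H z))"
        have p: "?p \<in> elems (F a)" by (rule aut_ext_conj_closed[OF E z ya])
        have iy: "ginv ?H y \<in> elems (F a)"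
          using subgrp_ginv[OF Fa H aut_ext_subgrp[OF E] ya] ginv_closed[OF Fa ya] by simp
        have u: "?u \<in> elems (F a)"
          using aut_ext_mul[OF E iy p] mul_closed[OF Fa iy p] by simp
        have ux: "mul ?H ?u x = mul ?H x ?u" if x: "x \<in> elems (F b)" for x
        proof -
          have xc: "x \<in> elems (F c)" using aut_ext_subset[OF Eb] x by blast
          obtain w where w: "w \<in> elems (F b)" "mul (F c) y x = mul (F c) w y"
            using Eb y x unfolding aut_ext_def normal_ext_def by blast
          have wc: "w \<in> elems (F c)" using aut_ext_subset[OF Eb] w(1) by blast
          have yx: "mul ?H y x = mul ?H w y"
            using w(2) subgrp_mul[OF sub'[OF ca] y xc] subgrp_mul[OF sub'[OF ca] wc y] by simp
          have "mul ?H z x = mul ?H x z" "mul ?H z w = mul ?H w z"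
            using IH[OF bc] below[OF bc] x w(1) by blast+
          moreover have "x \<in> elems ?H" "w \<in> elems ?H"
            using subgrp_mem[OF sub'[OF below[OF bc]]] x w(1) by blast+
          ultimately show ?thesis using commutator_commutes[OF H z yH _ _ _ yx] by blast
        qed
        have "?u = unit (F a)"
        proof (rule central_trivD[OF _ Fa u])
          show "central_triv (F vzero) (F a)" using ga by (simp add: good_def)
          fix x assume x0: "x \<in> elems (F vzero)"
          have xb: "x \<in> elems (F b)"
          proof (cases "b = vzero")
            case False
            then have "subgrp (F vzero) (F b)"
              using Ord_vzero_mem[OF 2(1)] good[OF below[OF bc]] by (simp add: good_def)
            then show ?thesis using x0 subgrp_mem by blast
          qed (use x0 in simp)
          have xa: "x \<in> elems (F a)" using subgrp_mem[OF sub[OF below[OF bc]] xb] .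
          show "mul (F a) ?u x = mul (F a) x ?u"
            using ux[OF xb] aut_ext_mul[OF E u xa] aut_ext_mul[OF E xa u] by simp
        qed
        also have "\<dots> = unit ?H" by (rule subgrp_unit[OF Fa H aut_ext_subgrp[OF E]])
        finally have u1: "?u = unit ?H" .
        have pH: "?p \<in> elems ?H" using p aut_ext_subset[OF E] by blast
        have "?p = mul ?H (mul ?H y (ginv ?H y)) ?p"
          using H yH pH by (simp add: mul_ginv_right mul_unit_left)
        also have "\<dots> = mul ?H y ?u" using H yH pH by (simp only: mul_assoc ginv_closed)
        also have "\<dots> = y" using H yH u1 by (simp add: mul_unit_right)
        finally have "mul ?H ?p z = mul ?H y z" by simp
        moreover have "mul ?H ?p z = mul ?H z y"
          using H z yH by (simp add: group_simps)
        ultimately show ?thesis by simp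
      qed
    qed
  qed
  then have "\<forall>y\<in>elems (F a). mul ?H z y = mul ?H y z" using Oa by simp
  then show "mul ?H z z = z" using E z unfolding aut_ext_def normal_ext_def by blast
qed

lemma good: "a \<in> elts d \<Longrightarrow> good a"
proof -
  assume ad: "a \<in> elts d"
  have "a \<in> elts d \<longrightarrow> good a"
    using _ Ord_below[OF ad]
  proof (rule Ord_induct)
    show "definable (\<lambda>s. s 0 \<in> elts d \<longrightarrow> good (s 0))"
      unfolding good_def by (intro def_intro definable_fn_sub1[OF F])
  next
    fix a assume a: "Ord a" and IH: "\<And>b. b \<in> elts a \<Longrightarrow> b \<in> elts d \<longrightarrow> good b"
    show "a \<in> elts d \<longrightarrow> good a"
    proof
      assume ad: "a \<in> elts d"
      have gb: "good b" if "b \<in> elts a" for b using IH[OF that] Ord_trans[OF Ord_d that ad] by blast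
      from a show "good a"
      proof (cases rule: Ord_cases3)
        case 1
        then have "centerless_group (F vzero)" using base ad by simp
        then show ?thesis
          unfolding good_def 1 centerless_group_iff central_triv_def elts_vzero by blast
      next
        case (2 b)
        have E: "aut_ext (F b) (F a)"
          using succ[of b] ad 2 good_centerless[OF gb] by simp
        have "subgrp (F c) (F a)" if "c \<in> elts a" for c
        proof -
          have "subgrp (F c) (F b)"
            using that gb[of b] 2 subgrp_refl unfolding good_def by auto
          then show ?thesis using aut_ext_subgrp[OF E] subgrp_trans by blast
        qed
        moreover have "central_triv (F vzero) (F a)"
          using succ_central[of b] ad gb 2 by simp
        ultimately show ?thesis using aut_ext_group[OF E] by (simp add: good_def)
      next
        case 3
        have gr: "is_group (F b)" if "b \<in> elts a" for b using gb[OF that] by (simp add: good_def)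
        have eq: "F a = union_group a F" by (rule lim[OF ad 3 gr])
        have a0: "vzero \<in> elts a" using a 3 Ord_vzero_mem Limit_Ord_not_vzero by blast
        have chain: "subgrp (F b) (F c) \<or> subgrp (F c) (F b)" if bc: "b \<in> elts a" "c \<in> elts a" for b c
          using Ord_mem[OF a bc(1)] Ord_mem[OF a bc(2)]
          by (cases rule: Ord_linear) (use gb[OF bc(1)] gb[OF bc(2)] subgrp_refl in \<open>auto simp: good_def\<close>)
        have U1: "is_group (F a)"
          unfolding eq by (rule union_group_chain(1)[OF F a0]) (use gr chain in blast)+
        have U2: "subgrp (F b) (F a)" if "b \<in> elts a" for b
          unfolding eq by (rule union_group_chain(2)[OF F a0 _ _ that]) (use gr chain in blast)+
        have U3: "elems (F a) = (\<Union>b\<in>elts a. elems (F b))"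
          unfolding eq by (rule union_group_chain(3)[OF F a0]) (use gr chain in blast)+
        have "central_triv (F vzero) (F a)"
          unfolding central_triv_def
        proof (intro ballI impI)
          fix z assume z: "z \<in> elems (F a)"
            and z0: "\<forall>x\<in>elems (F vzero). mul (F a) z x = mul (F a) x z"
          \<comment> \<open>A member of the union already lies in some \<open>F b\<close>, where the
            induction hypothesis applies.\<close>
          obtain b where b: "b \<in> elts a" "z \<in> elems (F b)" using z U3 by auto
          have "subgrp (F vzero) (F b)"
          proof (cases "b = vzero")
            case False
            then show ?thesis using Ord_vzero_mem[OF Ord_mem[OF a b(1)]] gb[OF b(1)] by (simp add: good_def)
          qed (simp add: subgrp_refl)
          then have "\<forall>x\<in>elems (F vzero). mul (F b) z x = mul (F b) x z"
            using z0 subgrp_mul[OF U2[OF b(1)]] b(2) subgrp_mem by metis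
          then have "mul (F b) z z = z"
            using gb[OF b(1)] b(2) unfolding good_def central_triv_def by blast
          then show "mul (F a) z z = z" using subgrp_mul[OF U2[OF b(1)] b(2) b(2)] by simp
        qed
        then show ?thesis using U1 U2 by (simp add: good_def)
      qed
    qed
  qed
  then show ?thesis using ad by blast
qed

lemma tower_group: "a \<in> elts d \<Longrightarrow> is_group (F a)"
  using good by (simp add: good_def)

lemma tower_centerless: "a \<in> elts d \<Longrightarrow> centerless_group (F a)"
  using good good_centerless Ord_below by blast

lemma tower_subgrp: "a \<in> elts d \<Longrightarrow> b \<in> elts (vsucc a) \<Longrightarrow> subgrp (F b) (F a)"
  using good subgrp_refl unfolding good_def elts_vsucc by blast

lemma tower_succ: "vsucc a \<in> elts d \<Longrightarrow> aut_ext (F a) (F (vsucc a))"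
  using succ tower_centerless vsucc_mem_D[OF Ord_d] by blast

lemma tower_central:
  "a \<in> elts d \<Longrightarrow> z \<in> elems (F a) \<Longrightarrow>
    (\<And>x. x \<in> elems (F vzero) \<Longrightarrow> mul (F a) z x = mul (F a) x z) \<Longrightarrow> z = unit (F a)"
  using good[of a] central_trivD unfolding good_def by blast

lemma tower_limit_mem:
  assumes "a \<in> elts d" "Limit_Ord a" "x \<in> elems (F a)"
  obtains b where "b \<in> elts a" "x \<in> elems (F b)"
proof -
  have "F a = union_group a F"
    using assms(1,2) tower_group Ord_trans[OF Ord_d] by (intro lim) auto
  moreover have "elems (union_group a F) = (\<Union>b\<in>elts a. elems (F b))"
    unfolding union_group_def pfst_opair by (rule elts_vUN) (intro def_intro definable_fn_sub1[OF F])
  ultimately show thesis using assms(3) that by auto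
qed

end

section \<open>The canonical tower over a group, by recursion\<close>

lemma definable_fn_union_group:
  assumes "definable_fn A" "definable_fn (\<lambda>s. F (\<lambda>n. s (Suc n)) (s 0))"
  shows "definable_fn (\<lambda>s. union_group (A s) (F s))"
  unfolding union_group_def by (intro def_intro assms)

lemma union_group_cong: "(\<And>b. b \<in> elts a \<Longrightarrow> F b = F' b) \<Longrightarrow> union_group a F = union_group a F'"
  unfolding union_group_def vUN_def by simp

text \<open>\<open>next_group\<close> names the elements of each successor explicitly, so no choice
  among isomorphic copies is made, and the whole tower is definable from \<open>G\<close>. The
  description in the last case is the predecessor of \<open>a\<close>.\<close>

definition tow_step :: "'v::zf \<Rightarrow> 'v \<Rightarrow> 'v \<Rightarrow> 'v" where
  "tow_step G a f = (if a = vzero then G else if Limit_Ord a then union_group a (appl f)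
     else next_group (appl f (the_or (\<lambda>b. a = vsucc b))))"

definition tow :: "'v::zf \<Rightarrow> 'v \<Rightarrow> 'v" where
  "tow = ord_rec tow_step"

lemma tow_step_definable: "definable_fn (\<lambda>s. tow_step (s 0) (s 1) (s 2))"
  unfolding tow_step_def by (intro def_intro definable_fn_union_group)

lemma definable_fn_tow [def_intro]:
  assumes "definable_fn A" "definable_fn B" shows "definable_fn (\<lambda>s. tow (A s) (B s))"
  unfolding tow_def by (rule definable_fn_ord_rec[OF tow_step_definable assms])

lemma tow_eq: "Ord a \<Longrightarrow> tow G a = tow_step G a (vlam a (tow G))"
  using ord_rec_eq[OF tow_step_definable, of a G] by (simp add: tow_def)

lemma definable_fn1_tow: "definable_fn1 (tow G)"
  by (intro def_intro)

lemma tow_vzero [simp]: "tow G vzero = G"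
  by (simp add: tow_eq tow_step_def)

lemma tow_vsucc:
  assumes "Ord a" shows "tow G (vsucc a) = next_group (tow G a)"
proof -
  have "the_or (\<lambda>b. vsucc a = vsucc b) = a"
    by (rule the_or_eq) (auto dest: vsucc_inject)
  then show ?thesis
    using tow_eq[OF Ord_vsucc[OF assms], of G] appl_vlam[OF definable_fn1_tow, of a "vsucc a" G]
    by (simp add: tow_step_def Limit_Ord_not_vsucc)
qed

lemma tow_Limit:
  assumes "Ord a" "Limit_Ord a" shows "tow G a = union_group a (tow G)"
proof -
  have "tow G a = union_group a (appl (vlam a (tow G)))"
    using assms Limit_Ord_not_vzero by (auto simp: tow_eq tow_step_def)
  also have "\<dots> = union_group a (tow G)"
    by (rule union_group_cong) (rule appl_vlam[OF definable_fn1_tow])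
  finally show ?thesis .
qed

lemma tower_tow:
  assumes "centerless_group G" "Ord d" shows "tower (tow G) d"
proof
  show "definable_fn1 (tow G)" by (rule definable_fn1_tow)
  fix a assume "vsucc a \<in> elts d" "centerless_group (tow G a)"
  then show "aut_ext (tow G a) (tow G (vsucc a))"
    using aut_ext_next_group tow_vsucc[of a G] Ord_mem[OF assms(2)] Ord_vsucc_D by metis
next
  fix a assume "a \<in> elts d" "Limit_Ord a"
  then show "tow G a = union_group a (tow G)" using tow_Limit Ord_mem[OF assms(2)] by blast
qed (use assms in simp_all)

section \<open>Finite sequences\<close>

text \<open>Each finite sequence is a subset of \<open>vprod vomega k\<close>, so Power Set and
  Separation suffice.\<close>

lemma small_fin_seqs: "small {s. \<exists>n\<in>elts vomega. maps s n k}"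
proof (rule small_subset)
  show "definable1 (\<lambda>s. \<exists>n\<in>elts vomega. maps s n k)" by (intro def_intro)
  fix s assume "\<exists>n\<in>elts vomega. maps s n k"
  then obtain n where n: "n \<in> elts vomega" "maps s n k" by blast
  have "elts (vprod n k) \<subseteq> elts (vprod vomega k)"
    using Ord_trans[OF Ord_vomega _ n(1)] by auto
  then show "s \<in> elts (VPow (vprod vomega k))" using fun_subset_prod[OF n(2)] by auto
qed

lemma elts_fin_seqs: "elts (fin_seqs k) = {s. \<exists>n\<in>elts vomega. maps s n k}"
  unfolding fin_seqs_def by (rule elts_vset[OF small_fin_seqs])

definition seq_snoc :: "'v::zf \<Rightarrow> 'v \<Rightarrow> 'v \<Rightarrow> 'v" where
  "seq_snoc s n a = vlam (vsucc n) (\<lambda>i. if i = n then a else appl s i)"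

lemma
  shows appl_seq_snoc: "i \<in> elts (vsucc n) \<Longrightarrow> appl (seq_snoc s n a) i = (if i = n then a else appl s i)"
    and maps_seq_snoc: "maps s n c \<Longrightarrow> a \<in> elts c \<Longrightarrow> maps (seq_snoc s n a) (vsucc n) c"
proof -
  have d: "definable_fn1 (\<lambda>i. if i = n then a else appl s i)" by (intro def_intro)
  show "i \<in> elts (vsucc n) \<Longrightarrow> appl (seq_snoc s n a) i = (if i = n then a else appl s i)"
    unfolding seq_snoc_def by (rule appl_vlam[OF d])
  show "maps s n c \<Longrightarrow> a \<in> elts c \<Longrightarrow> maps (seq_snoc s n a) (vsucc n) c"
    unfolding seq_snoc_def by (rule maps_vlam[OF d]) (auto simp: maps_iff)
qed

abbreviation vone :: "'v::zf" where "vone \<equiv> vsucc vzero"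
abbreviation vtwo :: "'v::zf" where "vtwo \<equiv> vsucc vone"
abbreviation vthree :: "'v::zf" where "vthree \<equiv> vsucc vtwo"

lemma vthree_omega: "vthree \<in> elts vomega"
  by (intro vsucc_omega) simp

lemma vtwo_not_vone [simp]: "vtwo \<noteq> vone"
  by (metis vsucc_inject vsucc_not_vzero(1))

definition triple :: "'v::zf \<Rightarrow> 'v \<Rightarrow> 'v \<Rightarrow> 'v" where
  "triple a b c = vlam vthree (\<lambda>i. if i = vzero then a else if i = vone then b else c)"

lemma
  shows appl_triple: "appl (triple a b c) vzero = a" "appl (triple a b c) vone = b" "appl (triple a b c) vtwo = c"
    and maps_triple: "a \<in> elts X \<Longrightarrow> b \<in> elts X \<Longrightarrow> c \<in> elts X \<Longrightarrow> maps (triple a b c) vthree X"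
proof -
  have d: "definable_fn1 (\<lambda>i. if i = vzero then a else if i = vone then b else c)" by (intro def_intro)
  show "appl (triple a b c) vzero = a" "appl (triple a b c) vone = b" "appl (triple a b c) vtwo = c"
    unfolding triple_def by (simp_all add: appl_vlam[OF d])
  show "a \<in> elts X \<Longrightarrow> b \<in> elts X \<Longrightarrow> c \<in> elts X \<Longrightarrow> maps (triple a b c) vthree X"
    unfolding triple_def by (rule maps_vlam[OF d]) auto
qed

section \<open>Coding members of a tower\<close>

text \<open>The first three entries of \<open>s\<close> are ignored by a path, since sequences of length three code
  the multiplication table.\<close>

definition path :: "'v::zf \<Rightarrow> 'v \<Rightarrow> 'v \<Rightarrow> 'v \<Rightarrow> 'v \<Rightarrow> bool" where
  "path M x s n w \<longleftrightarrow> maps w (vsucc n) (car M) \<and> appl w vthree = x \<and>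
     (\<forall>i\<in>elts n. i \<notin> elts vthree \<longrightarrow>
        mul M (appl w i) (appl s i) = mul M (appl w (vsucc i)) (appl w i))"

text \<open>The two kinds of sequences are told apart by their length. Length three records a
  product in \<open>G\<close>. Length \<open>vsucc m\<close> with \<open>m\<close> at least three
  says that repeated conjugation, starting with \<open>x\<close> and prescribed by the entries from
  \<open>vthree\<close> to before \<open>m\<close>, ends at the element of \<open>G\<close> stored
  as last entry.\<close>

definition in_code :: "'v::zf \<Rightarrow> 'v \<Rightarrow> 'v \<Rightarrow> 'v \<Rightarrow> bool" where
  "in_code G M x s \<longleftrightarrow> (\<exists>n\<in>elts vomega. maps s n (car G) \<and>
     ((n = vthree \<and> mul G (appl s vzero) (appl s vone) = appl s vtwo) \<or>
      (\<exists>m\<in>elts vomega. n = vsucc m \<and> m \<notin> elts vthree \<and> (\<exists>w. path M x s m w \<and> appl w m = appl s m))))"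

definition code :: "'v::zf \<Rightarrow> 'v \<Rightarrow> 'v \<Rightarrow> 'v \<Rightarrow> 'v" where
  "code k G M x = vsep (fin_seqs k) (in_code G M x)"

lemma definable_in_code: "definable1 (in_code G M x)"
  unfolding in_code_def path_def by (intro def_intro)

lemma in_code_iff:
  assumes "elems G \<subseteq> elts k"
  shows "in_code G M x s \<longleftrightarrow> s \<in> elts (code k G M x)"
proof -
  have "s \<in> elts (fin_seqs k)" if "in_code G M x s"
    using that assms unfolding in_code_def elts_fin_seqs maps_def by blast
  then show ?thesis
    unfolding code_def elts_vsep[OF definable_in_code] by blast
qed

lemma vsucc_eq_vthreeD: "vsucc n = vthree \<Longrightarrow> n \<in> elts vthree"
  using vsucc_inject[of n vtwo] by simp

lemma in_code_triple:
  assumes "is_group G" "a \<in> elems G" "b \<in> elems G"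
  shows "in_code G M x (triple a b (mul G a b))"
  unfolding in_code_def using vthree_omega
  by (intro bexI[of _ vthree]) (simp_all add: maps_triple appl_triple assms mul_closed)

lemma in_code_tripleD:
  assumes "in_code G M x s" "maps s vthree X"
  shows "maps s vthree (car G)" "mul G (appl s vzero) (appl s vone) = appl s vtwo"
proof -
  obtain n where n: "maps s n (car G)" "n = vthree \<and> mul G (appl s vzero) (appl s vone) = appl s vtwo \<or>
      (\<exists>m. n = vsucc m \<and> m \<notin> elts vthree)"
    using assms(1) unfolding in_code_def by blast
  have "n = vthree" using n(1) assms(2) fun_on_domain_unique unfolding maps_def by blast
  moreover from this have "\<nexists>m. n = vsucc m \<and> m \<notin> elts vthree" using vsucc_eq_vthreeD by metis
  ultimately show "maps s vthree (car G)" "mul G (appl s vzero) (appl s vone) = appl s vtwo"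
    using n by blast+
qed

text \<open>The sequences of length three in a code are exactly the triples of \<open>a\<close>,
  \<open>b\<close> and \<open>mul G a b\<close>. They show which elements belong to the group and
  how these multiply.\<close>

lemma code_group:
  assumes G: "is_group G" "is_group G'" and k: "elems G \<subseteq> elts k" "elems G' \<subseteq> elts k"
    and eq: "code k G M x = code k G' M' x'"
  shows "G = G'"
proof -
  have iff: "in_code G M x s \<longleftrightarrow> in_code G' M' x' s" for s
    using in_code_iff[OF k(1), of M x] in_code_iff[OF k(2), of M' x'] eq by simp
  have mem: "a \<in> elems H' \<and> b \<in> elems H' \<and> mul H' a b = mul H a b"
    if H: "is_group H" and ab: "a \<in> elems H" "b \<in> elems H"
      and sub: "\<And>s. in_code H N y s \<Longrightarrow> in_code H' N' y' s" for H H' N N' y y' a b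
  proof -
    let ?t = "triple a b (mul H a b)"
    have m: "maps ?t vthree (car H)" using ab H by (intro maps_triple mul_closed)
    have "in_code H' N' y' ?t" by (intro sub in_code_triple H ab)
    note t = in_code_tripleD[OF this m]
    have "appl ?t vzero \<in> elems H'" "appl ?t vone \<in> elems H'"
      using t(1) by (simp_all add: maps_iff)
    then show ?thesis using t(2) by (simp add: appl_triple)
  qed
  have 1: "a \<in> elems G' \<and> b \<in> elems G' \<and> mul G' a b = mul G a b"
    if "a \<in> elems G" "b \<in> elems G" for a b
    by (rule mem[OF G(1) that]) (use iff in blast)
  have 2: "a \<in> elems G" if "a \<in> elems G'" for a
    using mem[OF G(2) that that, of M' x' G M x] iff by blast
  have "car G = car G'" by (rule extensionality) (use 1 2 in blast)
  then show ?thesis using 1 by (intro group_eqI[OF G]) simp_all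
qed

lemma path_cong:
  assumes "\<And>i. i \<in> elts n \<Longrightarrow> appl s i = appl s' i"
  shows "path M x s n w \<longleftrightarrow> path M x s' n w"
  unfolding path_def using assms by simp

lemma path_unique:
  assumes M: "is_group M" and n: "n \<in> elts vomega" and s: "\<And>i. i \<in> elts n \<Longrightarrow> appl s i \<in> elems M"
    and w: "path M x s n w" and v: "path M x s n v" and "n \<notin> elts vthree"
  shows "appl w n = appl v n"
proof -
  have "i \<in> elts (vsucc n) \<longrightarrow> i \<notin> elts vthree \<longrightarrow> appl w i = appl v i" if "i \<in> elts vomega" for i
    using _ that
  proof (rule omega_induct)
    show "definable (\<lambda>s. s 0 \<in> elts (vsucc n) \<longrightarrow> s 0 \<notin> elts vthree \<longrightarrow> appl w (s 0) = appl v (s 0))"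
      by (intro def_intro)
  next
    fix i assume i: "i \<in> elts vomega" "i \<in> elts (vsucc n) \<longrightarrow> i \<notin> elts vthree \<longrightarrow> appl w i = appl v i"
    show "vsucc i \<in> elts (vsucc n) \<longrightarrow> vsucc i \<notin> elts vthree \<longrightarrow> appl w (vsucc i) = appl v (vsucc i)"
    proof (intro impI)
      assume si: "vsucc i \<in> elts (vsucc n)" "vsucc i \<notin> elts vthree"
      have On: "Ord n" using omega_Ord[OF n] .
      have i_n: "i \<in> elts n"
        using si(1) Ord_trans[OF On, of i "vsucc i"] vsucc_mem_D by auto
      show "appl w (vsucc i) = appl v (vsucc i)"
      proof (cases "i \<in> elts vthree")
        case True
        \<comment> \<open>The conditions on a path start at \<open>vthree\<close>. Here
          \<open>vsucc i\<close> is \<open>vthree\<close>, where both paths have the value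
          \<open>x\<close>.\<close>
        then have "i = vtwo" using si(2) by auto
        then show ?thesis using w v by (simp add: path_def)
      next
        case False
        then have wi: "appl w i = appl v i" using i(2) i_n by simp
        have cl: "appl w i \<in> elems M" "appl w (vsucc i) \<in> elems M" "appl v (vsucc i) \<in> elems M"
          using w v i_n si(1) unfolding path_def maps_iff by auto
        have "mul M (appl w (vsucc i)) (appl w i) = mul M (appl v (vsucc i)) (appl w i)"
          using w v i_n False wi unfolding path_def by metis
        then show ?thesis using mul_right_cancel[OF M cl(2,3,1)] by blast
      qed
    qed
  qed simp
  then show ?thesis using n assms(6) by simp
qed

lemma path_snoc:
  assumes M: "is_group M" and n: "n \<in> elts vomega" "n \<notin> elts vthree"
    and w: "path M x s n w" and y: "y \<in> elems M" "mul M (appl w n) g = mul M y (appl w n)"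
  shows "path M x (seq_snoc s n g) (vsucc n) (seq_snoc w (vsucc n) y)"
  unfolding path_def
proof (intro conjI ballI impI)
  let ?s = "seq_snoc s n g" and ?w = "seq_snoc w (vsucc n) y"
  have On: "Ord n" using omega_Ord[OF n(1)] .
  show "maps ?w (vsucc (vsucc n)) (car M)"
    using w y by (intro maps_seq_snoc) (simp_all add: path_def)
  have w_old: "appl ?w i = appl w i" if "i \<in> elts (vsucc n)" for i
    using that not_mem_self[of "vsucc n"] by (auto simp: appl_seq_snoc)
  have "vthree \<in> elts (vsucc n)"
    using Ord_linear[OF On, of vthree] n(2) omega_Ord[OF vthree_omega] by (metis elts_vsucc insert_iff)
  then show "appl ?w vthree = x" using w w_old by (simp add: path_def)
  fix i assume i: "i \<in> elts (vsucc n)" "i \<notin> elts vthree"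
  show "mul M (appl ?w i) (appl ?s i) = mul M (appl ?w (vsucc i)) (appl ?w i)"
  proof (cases "i = n")
    case True
    then show ?thesis using y(2) w_old[OF i(1)] by (simp add: appl_seq_snoc)
  next
    case False
    then have "i \<in> elts n" using i by simp
    moreover from this have "vsucc i \<in> elts (vsucc n)" by (rule vsucc_mem_vsucc[OF On])
    ultimately show ?thesis
      using w i w_old False by (simp add: path_def appl_seq_snoc)
  qed
qed

text \<open>By induction on \<open>c\<close> up to \<open>a\<close>: if a path from \<open>x\<close>
  ends in \<open>F c\<close>, then a path from \<open>y\<close> along the same sequence ends in the
  same element. Applied to paths that stop at index three, which is their starting point, this gives
  \<open>x = y\<close>.\<close>

lemma (in tower) code_separates:
  assumes b: "b \<in> elts d" and a: "a \<in> elts b" and x: "x \<in> elems (F a)" and y: "y \<in> elems (F b)"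
    and k: "elems (F vzero) \<subseteq> elts k"
    and eq: "code k (F vzero) (F a) x = code k (F vzero) (F b) y"
  shows "x = y"
proof -
  let ?G = "F vzero" and ?M = "F a" and ?M' = "F b"
  have ad: "a \<in> elts d" using Ord_trans[OF Ord_d a b] .
  have Oa: "Ord a" using Ord_below[OF ad] .
  note M = tower_group[OF ad] and M' = tower_group[OF b]
  have MM': "subgrp ?M ?M'" using tower_subgrp[OF b] a by simp
  have sub: "subgrp (F c) ?M" if "c \<in> elts (vsucc a)" for c using tower_subgrp[OF ad that] .
  have G0: "subgrp ?G (F c)" if "c \<in> elts d" for c
    using tower_subgrp[OF that vzero_mem_vsucc[OF Ord_below[OF that]]] .
  have GM: "g \<in> elems ?M" if "g \<in> elems ?G" for g using subgrp_mem[OF G0[OF ad] that] .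
  have GM': "g \<in> elems ?M'" if "g \<in> elems ?G" for g using subgrp_mem[OF G0[OF b] that] .
  have code_iff: "in_code ?G ?M x s \<longleftrightarrow> in_code ?G ?M' y s" for s
    using in_code_iff[OF k, of ?M x] in_code_iff[OF k, of ?M' y] eq by simp
  define claim where "claim = (\<lambda>c. \<forall>n\<in>elts vomega. \<forall>s w w'. n \<notin> elts vthree \<longrightarrow> maps s n (car ?G) \<longrightarrow>
    path ?M x s n w \<longrightarrow> path ?M' y s n w' \<longrightarrow> appl w n \<in> elems (F c) \<longrightarrow> appl w n = appl w' n)"
  have "c \<in> elts (vsucc a) \<longrightarrow> claim c" if "Ord c" for c
    using _ that
  proof (rule Ord_induct)
    show "definable (\<lambda>s. s 0 \<in> elts (vsucc a) \<longrightarrow> claim (s 0))"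
      unfolding claim_def path_def by (intro def_intro definable_fn_sub1[OF F])
  next
    fix c assume c: "Ord c" and IH: "\<And>e. e \<in> elts c \<Longrightarrow> e \<in> elts (vsucc a) \<longrightarrow> claim e"
    show "c \<in> elts (vsucc a) \<longrightarrow> claim c"
    proof
      assume ca: "c \<in> elts (vsucc a)"
      have IH': "claim e" if "e \<in> elts c" for e
        using IH[OF that] Ord_trans[OF Ord_vsucc[OF Oa] that ca] by blast
      have cd: "c \<in> elts d" using ca Ord_trans[OF Ord_d _ ad] ad by auto
      show "claim c"
        unfolding claim_def
      proof (intro ballI allI impI)
        fix n s w w'
        assume n: "n \<in> elts vomega" "n \<notin> elts vthree" and s: "maps s n (car ?G)"
          and w: "path ?M x s n w" and w': "path ?M' y s n w'" and wc: "appl w n \<in> elems (F c)"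
        let ?z = "appl w n" and ?z' = "appl w' n"
        have zM: "?z \<in> elems ?M" and zM': "?z' \<in> elems ?M'"
          using w w' by (simp_all add: path_def maps_iff)
        from c show "?z = ?z'"
        proof (cases rule: Ord_cases3)
          case 1
          \<comment> \<open>The path ends in the base group, so \<open>s\<close> with this end point
            appended belongs to the code of \<open>x\<close>, hence to the code of
            \<open>y\<close>.\<close>
          let ?s = "seq_snoc s n ?z"
          have zG: "?z \<in> elems ?G" using wc 1 by simp
          have same: "appl s i = appl ?s i" if "i \<in> elts n" for i
            using that not_mem_self[of n] by (auto simp: appl_seq_snoc)
          have "path ?M x ?s n w" using w path_cong[OF same] by blast
          moreover have "appl w n = appl ?s n" by (simp add: appl_seq_snoc)
          ultimately have "in_code ?G ?M x ?s"
            unfolding in_code_def using n maps_seq_snoc[OF s zG] vsucc_omega[OF n(1)] by blast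
          then have "in_code ?G ?M' y ?s" using code_iff by blast
          then obtain p where p: "maps ?s p (car ?G)"
            "p = vthree \<or> (\<exists>m. p = vsucc m \<and> (\<exists>v. path ?M' y ?s m v \<and> appl v m = appl ?s m))"
            unfolding in_code_def by blast
          have "p = vsucc n"
            using p(1) maps_seq_snoc[OF s zG] fun_on_domain_unique unfolding maps_def by blast
          then obtain v where v: "path ?M' y ?s n v" "appl v n = appl ?s n"
            using p(2) n(2) vsucc_eq_vthreeD vsucc_inject by metis
          have "path ?M' y s n v" using v(1) path_cong[OF same] by blast
          then have "appl v n = appl w' n"
            using s GM' by (intro path_unique[OF M' n(1) _ _ w' n(2)]) (simp_all add: maps_iff)
          then show ?thesis using v(2) by (simp add: appl_seq_snoc)
        next
          case 3
          then obtain e where "e \<in> elts c" "?z \<in> elems (F e)"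
            using tower_limit_mem[OF cd] wc by blast
          then show ?thesis using IH'[of e] n s w w' unfolding claim_def by blast
        next
          case (2 e)
          have ec: "e \<in> elts c" using 2(2) by simp
          have ed: "e \<in> elts d" using Ord_trans[OF Ord_d ec cd] .
          have E: "aut_ext (F e) (F c)" using tower_succ[of e] cd 2(2) by simp
          have cM: "subgrp (F c) ?M" by (rule sub[OF ca])
          \<comment> \<open>The conjugate \<open>q\<close> of \<open>g\<close> by \<open>?z\<close>
            lies one level lower. Both paths are prolonged by \<open>g\<close>, and the hypothesis
            for \<open>e\<close> identifies \<open>q\<close> with the conjugate of \<open>g\<close>
            by \<open>?z'\<close>. So \<open>?z\<close> and \<open>?z'\<close> act on the base in
            the same way.\<close>
          have conj: "\<exists>q\<in>elems ?M'. mul ?M' ?z g = mul ?M' q ?z \<and> mul ?M' ?z' g = mul ?M' q ?z'"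
            if g: "g \<in> elems ?G" for g
          proof -
            have ge: "g \<in> elems (F e)" using subgrp_mem[OF G0[OF ed] g] .
            obtain q where q: "q \<in> elems (F e)" "mul (F c) ?z g = mul (F c) q ?z"
              using E wc ge unfolding aut_ext_def normal_ext_def by blast
            have c': "g \<in> elems (F c)" "q \<in> elems (F c)"
              using aut_ext_subset[OF E] ge q(1) by auto
            have qM: "q \<in> elems ?M" using subgrp_mem[OF cM c'(2)] .
            have zq: "mul ?M ?z g = mul ?M q ?z"
              using subgrp_mul[OF cM wc c'(1)] subgrp_mul[OF cM c'(2) wc] q(2) by simp
            let ?q' = "mul ?M' (mul ?M' ?z' g) (ginv ?M' ?z')"
            have q': "?q' \<in> elems ?M'" "mul ?M' ?z' g = mul ?M' ?q' ?z'"
              using M' zM' GM'[OF g] by (simp_all add: group_simps)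
            let ?s = "seq_snoc s n g"
            let ?v = "seq_snoc w (vsucc n) q" and ?v' = "seq_snoc w' (vsucc n) ?q'"
            have v: "path ?M x ?s (vsucc n) ?v" by (rule path_snoc[OF M n w qM zq])
            have v': "path ?M' y ?s (vsucc n) ?v'" by (rule path_snoc[OF M' n w' q'])
            have vn: "appl ?v (vsucc n) = q" "appl ?v' (vsucc n) = ?q'"
              by (simp_all add: appl_seq_snoc)
            have sn: "vsucc n \<notin> elts vthree"
              using n(2) Ord_trans[OF omega_Ord[OF vthree_omega], of n "vsucc n"] by auto
            have "q = ?q'"
              using IH'[OF ec, unfolded claim_def, rule_format, OF vsucc_omega[OF n(1)] sn
                  maps_seq_snoc[OF s g] v v'] q(1) by (simp add: vn)
            moreover have "mul ?M' ?z g = mul ?M' q ?z"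
              using zq subgrp_mul[OF MM' zM GM[OF g]] subgrp_mul[OF MM' qM zM] by simp
            ultimately show ?thesis using q' by metis
          qed
          have zM'2: "?z \<in> elems ?M'" using subgrp_mem[OF MM' zM] .
          have i: "ginv ?M' ?z' \<in> elems ?M'" using ginv_closed[OF M' zM'] .
          \<comment> \<open>This quotient centralizes the base, so it is trivial by
            \<open>tower_central\<close>, applied in the larger of the two groups.\<close>
          let ?u = "mul ?M' (ginv ?M' ?z') ?z"
          have "?u = unit ?M'"
          proof (rule tower_central[OF b mul_closed[OF M' i zM'2]])
            fix g assume g: "g \<in> elems ?G"
            obtain q where q: "q \<in> elems ?M'" "mul ?M' ?z g = mul ?M' q ?z" "mul ?M' ?z' g = mul ?M' q ?z'"
              using conj[OF g] by blast
            show "mul ?M' ?u g = mul ?M' g ?u"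
              by (rule conj_rel_comp[OF M' zM'2 i GM'[OF g] q(1) GM'[OF g] q(2)
                    conj_rel_inv[OF M' zM' GM'[OF g] q(1) q(3)]])
          qed
          then have "mul ?M' ?z' ?u = ?z'" using M' zM' by (simp add: group_simps)
          moreover have "mul ?M' ?z' ?u = ?z"
            using mul_assoc[OF M' zM' i zM'2] M' zM' zM'2 by (simp add: group_simps)
          ultimately show ?thesis by simp
        qed
      qed
    qed
  qed
  then have claim: "claim a" using Oa by simp
  \<comment> \<open>Any sequence of length three in the base would do, since a path does not read
    its first three entries. Likewise only the value at \<open>vthree\<close> matters for the paths,
    so constant functions serve.\<close>
  let ?s = "triple (unit ?G) (unit ?G) (unit ?G)"
  have G: "is_group ?G" using tower_group[of vzero] Ord_trans[OF Ord_d, of vzero a] ad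
    by (metis Ord_vzero_mem Oa)
  have const: "maps (vlam (vsucc vthree) (\<lambda>_. p)) (vsucc vthree) X" "appl (vlam (vsucc vthree) (\<lambda>_. p)) vthree = p"
    if "p \<in> elts X" for p X
    using that by (auto intro!: maps_vlam simp: appl_vlam def_intro)
  have p: "path ?M x ?s vthree (vlam (vsucc vthree) (\<lambda>_. x))" "path ?M' y ?s vthree (vlam (vsucc vthree) (\<lambda>_. y))"
    unfolding path_def using const[OF x] const[OF y] by blast+
  show ?thesis
    using claim[unfolded claim_def, rule_format, OF vthree_omega not_mem_self maps_triple p]
      unit_closed[OF G] x const(2)[OF x] const(2)[OF y] by simp
qed

section \<open>Levels at which coded elements appear\<close>

definition birth :: "'v::zf \<Rightarrow> 'v \<Rightarrow> 'v \<Rightarrow> bool" where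
  "birth k X a \<longleftrightarrow> Ord a \<and> (\<exists>G x. centerless_group G \<and> elems G \<subseteq> elts k \<and>
     x \<in> elems (tow G (vsucc a)) \<and> x \<notin> elems (tow G a) \<and> X = code k G (tow G (vsucc a)) x)"

lemma definable_birth [def_intro]:
  assumes "definable_fn A" "definable_fn B" shows "definable (\<lambda>s. birth k (A s) (B s))"
  by (rule definable_sub2[OF _ assms], unfold birth_def code_def in_code_def path_def, intro def_intro)

text \<open>Equal codes yield the same group, hence the same tower, and then the same element. But
  the element that appears at \<open>vsucc a\<close> already belongs to stage \<open>b\<close>,
  where the other one must not occur.\<close>

lemma birth_not_less:
  assumes "birth k X a" "birth k X b" shows "a \<notin> elts b"
proof
  assume ab: "a \<in> elts b"
  obtain G x where G: "centerless_group G" "elems G \<subseteq> elts k"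
    and x: "x \<in> elems (tow G (vsucc a))" and X: "X = code k G (tow G (vsucc a)) x" and Oa: "Ord a"
    using assms(1) unfolding birth_def by blast
  obtain H y where H: "centerless_group H" "elems H \<subseteq> elts k"
    and y: "y \<in> elems (tow H (vsucc b))" "y \<notin> elems (tow H b)"
    and X': "X = code k H (tow H (vsucc b)) y" and Ob: "Ord b"
    using assms(2) unfolding birth_def by blast
  have "is_group G" "is_group H" using G(1) H(1) unfolding centerless_group_iff by blast+
  from code_group[OF this G(2) H(2)] have "G = H" using X X' by metis
  interpret tower "tow G" "vsucc (vsucc b)"
    by (rule tower_tow[OF G(1) Ord_vsucc[OF Ord_vsucc[OF Ob]]])
  have sab: "vsucc a \<in> elts (vsucc b)" by (rule vsucc_mem_vsucc[OF Ob ab])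
  have "x = y"
    using code_separates[of "vsucc b" "vsucc a" x y k] x y(1) sab X X' G(2) \<open>G = H\<close> by simp
  moreover have "x \<in> elems (tow G b)"
    using subgrp_mem[OF tower_subgrp[of b "vsucc a"] x] sab by simp
  ultimately show False using y(2) \<open>G = H\<close> by simp
qed

lemma birth_unique: "birth k X a \<Longrightarrow> birth k X b \<Longrightarrow> a = b"
  using birth_not_less[of k X a b] birth_not_less[of k X b a] Ord_linear[of a b]
  unfolding birth_def by blast

section \<open>Renaming the members of a tower\<close>

text \<open>Used in both directions: to move a group into \<open>k\<close>, where it can be coded,
  and to carry the tower of this copy back to a tower over the original group.\<close>

definition rename :: "('v::zf \<Rightarrow> 'v) \<Rightarrow> 'v \<Rightarrow> 'v" where
  "rename r G = opair (vimg (car G) r)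
     (vimg (psnd G) (\<lambda>p. opair (opair (r (pfst (pfst p))) (r (psnd (pfst p)))) (r (psnd p))))"

lemma definable_fn_rename_group:
  assumes "definable_fn1 r" "definable_fn A" shows "definable_fn (\<lambda>s. rename r (A s))"
  by (rule definable_fn_sub1[OF _ assms(2)], unfold rename_def,
      intro def_intro definable_fn_sub1[OF assms(1)])

lemma
  assumes r: "definable_fn1 r"
  shows elts_car_rename: "elems (rename r G) = r ` elems G"
    and elts_psnd_rename: "elts (psnd (rename r G)) =
      (\<lambda>p. opair (opair (r (pfst (pfst p))) (r (psnd (pfst p)))) (r (psnd p))) ` elts (psnd G)"
proof -
  have "definable_fn1 (\<lambda>p. opair (opair (r (pfst (pfst p))) (r (psnd (pfst p)))) (r (psnd p)))"
    by (intro def_intro definable_fn_sub1[OF r])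
  then show "elems (rename r G) = r ` elems G"
    "elts (psnd (rename r G)) =
      (\<lambda>p. opair (opair (r (pfst (pfst p))) (r (psnd (pfst p)))) (r (psnd p))) ` elts (psnd G)"
    using r by (simp_all add: rename_def elts_vimg)
qed

lemma rename_union_group:
  assumes r: "definable_fn1 r" and F: "definable_fn1 F"
  shows "rename r (union_group a F) = union_group a (\<lambda>b. rename r (F b))"
proof -
  have dF: "definable_fn1 (\<lambda>b. car (F b))" "definable_fn1 (\<lambda>b. psnd (F b))"
    by (intro def_intro F)+
  have dR: "definable_fn1 (\<lambda>b. car (rename r (F b)))" "definable_fn1 (\<lambda>b. psnd (rename r (F b)))"
    by (intro def_intro definable_fn_rename_group r F)+
  have "elems (rename r (union_group a F)) = elems (union_group a (\<lambda>b. rename r (F b)))"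
    by (simp add: elts_car_rename[OF r] union_group_def elts_vUN[OF dF(1)] elts_vUN[OF dR(1)] image_UN)
  moreover have "elts (psnd (rename r (union_group a F))) = elts (psnd (union_group a (\<lambda>b. rename r (F b))))"
    by (simp add: elts_psnd_rename[OF r] union_group_def elts_vUN[OF dF(2)] elts_vUN[OF dR(2)] image_UN)
  ultimately have "car (rename r (union_group a F)) = car (union_group a (\<lambda>b. rename r (F b)))"
    "psnd (rename r (union_group a F)) = psnd (union_group a (\<lambda>b. rename r (F b)))"
    by (blast intro: extensionality)+
  then show ?thesis by (simp add: rename_def union_group_def)
qed

lemma
  assumes G: "is_group G" and r: "definable_fn1 r" and inj: "inj_on r (elems G)"
  shows mul_rename: "x \<in> elems G \<Longrightarrow> y \<in> elems G \<Longrightarrow> mul (rename r G) (r x) (r y) = r (mul G x y)"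
    and is_group_rename: "is_group (rename r G)"
proof -
  let ?R = "rename r G"
  note C = elts_car_rename[OF r, of G]
  have mem: "p \<in> elts (psnd ?R) \<longleftrightarrow> (\<exists>x\<in>elems G. \<exists>y\<in>elems G.
      p = opair (opair (r x) (r y)) (r (mul G x y)))" for p
    unfolding elts_psnd_rename[OF r] image_iff Bex_def mem_psnd_iff[OF G]
    by (metis pfst_opair psnd_opair)
  have ex1: "\<exists>!z. opair (opair (r x) (r y)) z \<in> elts (psnd ?R)"
    if "x \<in> elems G" "y \<in> elems G" for x y
    unfolding mem opair_eq using that inj by (metis inj_onD)
  have f: "fun_on (psnd ?R) (vprod (car ?R) (car ?R))"
    unfolding fun_on_def
  proof (intro conjI ballI)
    fix p assume "p \<in> elts (psnd ?R)"
    then show "\<exists>q\<in>elts (vprod (car ?R) (car ?R)). \<exists>z. p = opair q z"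
      unfolding mem elts_vprod C by blast
  next
    fix q assume "q \<in> elts (vprod (car ?R) (car ?R))"
    then obtain x y where "q = opair (r x) (r y)" "x \<in> elems G" "y \<in> elems G"
      unfolding elts_vprod C by blast
    then show "\<exists>!z. opair q z \<in> elts (psnd ?R)" using ex1 by metis
  qed
  show mul: "mul ?R (r x) (r y) = r (mul G x y)" if xy: "x \<in> elems G" "y \<in> elems G" for x y
  proof -
    have "opair (r x) (r y) \<in> elts (vprod (car ?R) (car ?R))" using xy C by auto
    moreover have "opair (opair (r x) (r y)) (r (mul G x y)) \<in> elts (psnd ?R)" unfolding mem using xy by blast
    ultimately show ?thesis using app_eqI[OF f] appl_eq[OF f] by (simp add: mul_def)
  qed
  note cl = mul_closed[OF G]
  have "group_ax (car ?R) (mul ?R)"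
  proof (rule group_axI)
    show "r (unit G) \<in> elems ?R" using unit_closed[OF G] C by blast
    fix x' assume "x' \<in> elems ?R"
    then obtain x where x: "x \<in> elems G" "x' = r x" using C by auto
    show "mul ?R (r (unit G)) x' = x'" "mul ?R x' (r (unit G)) = x'"
      using G x by (simp_all add: mul unit_closed mul_unit_left mul_unit_right)
    show "\<exists>y\<in>elems ?R. mul ?R y x' = r (unit G) \<and> mul ?R x' y = r (unit G)"
      using G x C by (intro bexI[of _ "r (ginv G x)"])
        (simp_all add: mul ginv_closed mul_ginv_left mul_ginv_right)
    fix y' assume "y' \<in> elems ?R"
    then obtain y where y: "y \<in> elems G" "y' = r y" using C by auto
    show "mul ?R x' y' \<in> elems ?R" using x y C by (simp add: mul cl)
    fix z' assume "z' \<in> elems ?R"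
    then obtain z where z: "z \<in> elems G" "z' = r z" using C by auto
    show "mul ?R (mul ?R x' y') z' = mul ?R x' (mul ?R y' z')"
      using x y z by (simp add: mul cl mul_assoc[OF G])
  qed
  moreover have "maps (psnd ?R) (vprod (car ?R) (car ?R)) (car ?R)"
    unfolding maps_iff
  proof (intro conjI f ballI)
    fix p assume "p \<in> elts (vprod (car ?R) (car ?R))"
    then obtain x y where p: "p = opair (r x) (r y)" "x \<in> elems G" "y \<in> elems G"
      unfolding elts_vprod C by blast
    then have "appl (psnd ?R) p = r (mul G x y)" using mul by (simp add: mul_def)
    then show "appl (psnd ?R) p \<in> elems ?R" using p C cl by auto
  qed
  moreover have "?R = opair (car ?R) (psnd ?R)" by (simp add: rename_def)
  ultimately show "is_group ?R" unfolding is_group_iff by blast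
qed

lemma centerless_rename:
  assumes G: "centerless_group G" and r: "definable_fn1 r" and inj: "inj_on r (elems G)"
  shows "centerless_group (rename r G)"
proof -
  have g: "is_group G" using G unfolding centerless_group_iff by blast
  note C = elts_car_rename[OF r, of G] and mul = mul_rename[OF g r inj] and cl = mul_closed[OF g]
  show ?thesis
    unfolding centerless_group_iff
  proof (intro conjI ballI impI is_group_rename g r inj)
    fix z' assume "z' \<in> elems (rename r G)"
      and comm: "\<forall>x\<in>elems (rename r G). mul (rename r G) z' x = mul (rename r G) x z'"
    then obtain z where z: "z \<in> elems G" "z' = r z" using C by auto
    have "mul G z x = mul G x z" if x: "x \<in> elems G" for x
    proof -
      have "r (mul G z x) = r (mul G x z)"
        using comm x z C mul[OF z(1) x] mul[OF x z(1)] by (metis imageI)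
      then show ?thesis using inj cl x z(1) by (simp add: inj_on_eq_iff)
    qed
    then have "mul G z z = z" using G z(1) unfolding centerless_group_iff by blast
    then show "mul (rename r G) z' z' = z'" using mul[OF z(1) z(1)] z(2) by metis
  qed
qed

lemma aut_ext_rename:
  assumes G: "is_group G" and E: "aut_ext G H" and r: "definable_fn1 r" and inj: "inj_on r (elems H)"
  shows "aut_ext (rename r G) (rename r H)"
proof -
  note H = aut_ext_group[OF E] and sub = aut_ext_subset[OF E]
  have injG: "inj_on r (elems G)" using inj_on_subset[OF inj sub] .
  note CG = elts_car_rename[OF r, of G] and CH = elts_car_rename[OF r, of H]
  note mG = mul_rename[OF G r injG] and mH = mul_rename[OF H r inj]
  have in_H: "x \<in> elems H" if "x \<in> elems G" for x using sub that by blast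
  have reflect: "mul H a b = mul H c e"
    if "mul (rename r H) (r a) (r b) = mul (rename r H) (r c) (r e)"
      "a \<in> elems H" "b \<in> elems H" "c \<in> elems H" "e \<in> elems H" for a b c e
    using that mH inj mul_closed[OF H] by (simp add: inj_on_eq_iff)
  show ?thesis
    unfolding aut_ext_def normal_ext_def
  proof (intro conjI ballI allI impI is_group_rename H r inj)
    show "elems (rename r G) \<subseteq> elems (rename r H)" using CG CH sub by blast
  next
    fix x' y' assume "x' \<in> elems (rename r G)" "y' \<in> elems (rename r G)"
    then obtain x y where "x \<in> elems G" "x' = r x" "y \<in> elems G" "y' = r y" using CG by auto
    then show "mul (rename r H) x' y' = mul (rename r G) x' y'"
      using mG mH in_H aut_ext_mul[OF E] by simp
  next
    fix h' x' assume "h' \<in> elems (rename r H)" "x' \<in> elems (rename r G)"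
    then obtain h x where hx: "h \<in> elems H" "h' = r h" "x \<in> elems G" "x' = r x"
      using CG CH by auto
    obtain y where "y \<in> elems G" "mul H h x = mul H y h"
      using E hx unfolding aut_ext_def normal_ext_def by blast
    then show "\<exists>y\<in>elems (rename r G). mul (rename r H) h' x' = mul (rename r H) y h'"
      using hx mH in_H CG by (intro bexI[of _ "r y"]) simp_all
  next
    fix h' assume "h' \<in> elems (rename r H)"
      and comm: "\<forall>x\<in>elems (rename r G). mul (rename r H) h' x = mul (rename r H) x h'"
    then obtain h where h: "h \<in> elems H" "h' = r h" using CH by auto
    have "mul H h x = mul H x h" if "x \<in> elems G" for x
      by (rule reflect) (use comm h that in_H CG in blast)+
    then have "mul H h h = h" using E h(1) unfolding aut_ext_def normal_ext_def by blast
    then show "mul (rename r H) h' h' = h'" using mH[OF h(1) h(1)] h(2) by metis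
  next
    fix f assume f: "is_aut (rename r G) f"
    note R = is_group_rename[OF G r injG]
    \<comment> \<open>\<open>s\<close> undoes \<open>r\<close> on \<open>G\<close>. With it an
      automorphism of the renamed group is pulled back to \<open>G\<close>, where \<open>H\<close>
      provides an element inducing it.\<close>
    define s where "s = (\<lambda>x'. the_or (\<lambda>x. x \<in> elems G \<and> r x = x'))"
    have ds: "definable_fn1 s" unfolding s_def by (intro def_intro definable_fn_sub1[OF r])
    have sr: "s (r x) = x" if "x \<in> elems G" for x
      unfolding s_def using that injG by (intro the_or_eq) (auto simp: inj_on_def)
    have rs: "s x' \<in> elems G" "r (s x') = x'" if "x' \<in> elems (rename r G)" for x'
      using that sr CG by auto
    define g where "g = (\<lambda>x. s (appl f (r x)))"
    have dg: "definable_fn1 g" unfolding g_def by (intro def_intro definable_fn_sub1[OF ds] definable_fn_sub1[OF r])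
    have rx: "r x \<in> elems (rename r G)" if "x \<in> elems G" for x using CG that by blast
    have frx: "appl f (r x) \<in> elems (rename r G)" if "x \<in> elems G" for x
      using aut_closed[OF R f rx[OF that]] .
    have g: "g x \<in> elems G" "r (g x) = appl f (r x)" if "x \<in> elems G" for x
      using rs[OF frx[OF that]] by (simp_all add: g_def)
    have "is_aut G (vlam (car G) g)"
      unfolding is_aut_def maps_iff
    proof (intro conjI ballI impI fun_on_vlam[OF dg])
      fix x assume x: "x \<in> elems G"
      show "appl (vlam (car G) g) x \<in> elems G" using g x by (simp add: appl_vlam[OF dg])
      fix y assume y: "y \<in> elems G"
      have "r (g (mul G x y)) = appl f (mul (rename r G) (r x) (r y))"
        using g(2)[OF mul_closed[OF G x y]] mG[OF x y] by simp
      also have "\<dots> = mul (rename r G) (r (g x)) (r (g y))"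
        using aut_mul[OF R f rx[OF x] rx[OF y]] g x y by simp
      also have "\<dots> = r (mul G (g x) (g y))" by (rule mG[OF g(1)[OF x] g(1)[OF y]])
      finally have "g (mul G x y) = mul G (g x) (g y)"
        using injG g(1) x y mul_closed[OF G] by (simp add: inj_on_eq_iff)
      then show "appl (vlam (car G) g) (mul G x y) = mul G (appl (vlam (car G) g) x) (appl (vlam (car G) g) y)"
        using x y by (simp add: appl_vlam[OF dg] mul_closed[OF G])
      assume "appl (vlam (car G) g) x = appl (vlam (car G) g) y"
      then have "appl f (r x) = appl f (r y)" using g x y by (simp add: appl_vlam[OF dg]) metis
      then have "r x = r y" using f rx x y unfolding is_aut_def by blast
      then show "x = y" using injG x y by (simp add: inj_on_eq_iff)
    next
      fix y assume y: "y \<in> elems G"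
      then obtain x' where x': "x' \<in> elems (rename r G)" "appl f x' = r y"
        using f rx unfolding is_aut_def by blast
      then have "g (s x') = y" using rs[OF x'(1)] sr[OF y] by (simp add: g_def)
      then show "\<exists>x\<in>elems G. appl (vlam (car G) g) x = y"
        using rs[OF x'(1)] by (intro bexI[of _ "s x'"]) (simp_all add: appl_vlam[OF dg])
    qed
    then obtain h where h: "h \<in> elems H"
      "\<And>x. x \<in> elems G \<Longrightarrow> mul H h x = mul H (appl (vlam (car G) g) x) h"
      using E unfolding aut_ext_def normal_ext_def by blast
    show "\<exists>h\<in>elems (rename r H). \<forall>x\<in>elems (rename r G).
        mul (rename r H) h x = mul (rename r H) (appl f x) h"
    proof (rule bexI, rule ballI)
      show "r h \<in> elems (rename r H)" using CH h(1) by blast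
      fix x' assume "x' \<in> elems (rename r G)"
      then obtain x where x: "x \<in> elems G" "x' = r x" using CG by auto
      have "mul H h x = mul H (g x) h" using h(2)[OF x(1)] x(1) by (simp add: appl_vlam[OF dg])
      then have "mul (rename r H) (r h) (r x) = mul (rename r H) (r (g x)) (r h)"
        using mH h(1) in_H x(1) g(1)[OF x(1)] by simp
      then show "mul (rename r H) (r h) x' = mul (rename r H) (appl f x') (r h)"
        using g(2)[OF x(1)] x(2) by simp
    qed
  qed
qed

text \<open>All groups of the tower are contained in the last one, \<open>F d\<close>, so
  injectivity of \<open>r\<close> there passes to each of them.\<close>

lemma tower_rename:
  assumes T: "tower F (vsucc d)" and r: "definable_fn1 r" and inj: "inj_on r (elems (F d))"
  shows "tower (\<lambda>a. rename r (F a)) (vsucc d)"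
proof -
  interpret tower F "vsucc d" by (rule T)
  have sub: "elems (F a) \<subseteq> elems (F d)" if "a \<in> elts (vsucc d)" for a
    using tower_subgrp[of d a] that by (simp add: subgrp_def)
  have inj': "inj_on r (elems (F a))" if "a \<in> elts (vsucc d)" for a
    using inj_on_subset[OF inj sub[OF that]] .
  show ?thesis
  proof
    show "Ord (vsucc d)" by (rule Ord_d)
    show "definable_fn1 (\<lambda>a. rename r (F a))" by (rule definable_fn_rename_group[OF r F])
    show "centerless_group (rename r (F vzero))" if "vzero \<in> elts (vsucc d)"
      using centerless_rename[OF base r inj'] that by blast
    fix a
    show "aut_ext (rename r (F a)) (rename r (F (vsucc a)))" if "vsucc a \<in> elts (vsucc d)"
      using aut_ext_rename[OF tower_group tower_succ r inj'] that vsucc_mem_D[OF Ord_d] by blast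
    show "rename r (F a) = union_group a (\<lambda>b. rename r (F b))"
      if "a \<in> elts (vsucc d)" "Limit_Ord a"
    proof -
      have "F a = union_group a F"
        using that tower_group Ord_trans[OF Ord_d] by (intro lim) blast+
      then show ?thesis using rename_union_group[OF r F] by simp
    qed
  qed
qed

section \<open>Automorphism towers are towers\<close>

lemma union_group_vset:
  assumes F: "definable_fn1 F" and eq: "\<And>b. b \<in> elts a \<Longrightarrow> T b = F b"
    and grp: "\<And>b. b \<in> elts a \<Longrightarrow> is_group (F b)"
  shows "opair (vset (\<Union>b\<in>elts a. elts (vfst (T b)))) (vset (\<Union>b\<in>elts a. elts (vsnd (T b)))) = union_group a F"
  unfolding union_group_def vUN_def using vfst_group[OF grp] vsnd_group[OF grp] eq by simp

text \<open>A translation into definable terms: over a group, \<open>aut_ext\<close> and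
  \<open>is_Aut_over\<close> are equivalent, and by \<open>tower_group\<close> all members of a
  tower are groups.\<close>

lemma aut_tower_iff:
  assumes G: "centerless_group G"
  shows "aut_tower G d T \<longleftrightarrow> fun_on T d \<and> tower (appl T) d \<and> (vzero \<in> elts d \<longrightarrow> appl T vzero = G)"
proof
  assume A: "aut_tower G d T"
  then have d: "Ord d" and T: "fun_on T d" by (simp_all add: aut_tower_def)
  note e = appl_eq[OF T]
  have dT: "definable_fn1 (appl T)" by (intro def_intro)
  have "tower (appl T) d"
  proof
    show "centerless_group (appl T vzero)" if "vzero \<in> elts d"
      using A G e that by (simp add: aut_tower_def)
    fix a
    show "aut_ext (appl T a) (appl T (vsucc a))" if "vsucc a \<in> elts d" "centerless_group (appl T a)"
    proof -
      have "is_group (appl T a)" using that(2) unfolding centerless_group_iff by blast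
      moreover have "is_Aut_over (appl T a) (appl T (vsucc a))"
        using A that(1) e vsucc_mem_D[OF d that(1)] by (simp add: aut_tower_def)
      ultimately show ?thesis by (rule aut_ext_of_is_Aut_over)
    qed
    show "appl T a = union_group a (appl T)"
      if a: "a \<in> elts d" "Limit_Ord a" "\<And>b. b \<in> elts a \<Longrightarrow> is_group (appl T b)"
    proof -
      have "app T b = appl T b" if "b \<in> elts a" for b using e Ord_trans[OF d that a(1)] by simp
      from union_group_vset[OF dT this a(3)] show ?thesis
        using A a(1,2) e by (simp add: aut_tower_def)
    qed
  qed (use d dT in simp_all)
  then show "fun_on T d \<and> tower (appl T) d \<and> (vzero \<in> elts d \<longrightarrow> appl T vzero = G)"
    using A T e by (simp add: aut_tower_def)
next
  assume *: "fun_on T d \<and> tower (appl T) d \<and> (vzero \<in> elts d \<longrightarrow> appl T vzero = G)"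
  then have T: "fun_on T d" by blast
  note e = appl_eq[OF T]
  interpret tower "appl T" d using * by blast
  show "aut_tower G d T"
    unfolding aut_tower_def
  proof (intro conjI allI ballI impI Ord_d T)
    show "app T vzero = G" if "vzero \<in> elts d" using * e that by simp
  next
    fix a assume a: "vsucc a \<in> elts d"
    then show "is_Aut_over (app T a) (app T (vsucc a))"
      using is_Aut_over_of_aut_ext[OF tower_group tower_succ[OF a]] vsucc_mem_D[OF Ord_d a] e by simp
  next
    fix a assume a: "a \<in> elts d" "Limit_Ord a"
    have b: "b \<in> elts d" if "b \<in> elts a" for b using Ord_trans[OF Ord_d that a(1)] .
    then have "appl T a = union_group a (appl T)" using lim[OF a] tower_group by blast
    also have "\<dots> = opair (vset (\<Union>b\<in>elts a. elts (vfst (app T b)))) (vset (\<Union>b\<in>elts a. elts (vsnd (app T b))))"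
      using e b tower_group by (intro union_group_vset[symmetric, OF F]) auto
    finally show "app T a = opair (vset (\<Union>b\<in>elts a. elts (vfst (app T b)))) (vset (\<Union>b\<in>elts a. elts (vsnd (app T b))))"
      using e a(1) by simp
  qed
qed

lemma tower_cong:
  assumes T: "tower F d" and F': "definable_fn1 F'" and eq: "\<And>a. a \<in> elts d \<Longrightarrow> F' a = F a"
  shows "tower F' d"
proof -
  interpret tower F d by (rule T)
  show ?thesis
  proof
    fix a
    show "aut_ext (F' a) (F' (vsucc a))" if "vsucc a \<in> elts d"
      using tower_succ[OF that] eq[OF that] eq[OF vsucc_mem_D[OF Ord_d that]] by simp
    show "F' a = union_group a F'" if a: "a \<in> elts d" "Limit_Ord a"
    proof -
      have "F a = union_group a F" using lim[OF a] tower_group Ord_trans[OF Ord_d _ a(1)] by blast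
      also have "\<dots> = union_group a F'"
        using eq Ord_trans[OF Ord_d _ a(1)] by (intro union_group_cong) simp
      finally show ?thesis using eq a(1) by simp
    qed
  qed (use Ord_d F' base eq in simp_all)
qed

lemma is_tau_tower:
  assumes T: "tower F (vsucc (vsucc t))" and stop: "F (vsucc t) = F t"
    and go: "\<And>a. a \<in> elts t \<Longrightarrow> F (vsucc a) \<noteq> F a"
  shows "is_tau (F vzero) t"
proof -
  interpret tower F "vsucc (vsucc t)" by (rule T)
  let ?d = "vsucc (vsucc t)"
  have Ot: "Ord t" using Ord_d Ord_vsucc_D by blast
  let ?T = "vlam ?d F"
  have T_eq: "appl ?T a = F a" "app ?T a = F a" if "a \<in> elts ?d" for a
    using that by (simp_all only: appl_vlam[OF F] app_vlam[OF F])
  have zero: "vzero \<in> elts ?d" by (rule vzero_mem_vsucc[OF Ord_vsucc[OF Ot]])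
  have "tower (appl ?T) ?d"
    by (rule tower_cong[OF T]) (use T_eq in \<open>intro def_intro | simp\<close>)+
  then have "aut_tower (F vzero) ?d ?T"
    using aut_tower_iff[OF base[OF zero]] T_eq(1)[OF zero] fun_on_vlam[OF F] by blast
  moreover have "app ?T (vsucc t) = app ?T t" using stop T_eq by simp
  moreover have "app ?T (vsucc a) \<noteq> app ?T a" if a: "a \<in> elts t" for a
  proof -
    have "vsucc a \<in> elts ?d" using vsucc_mem_vsucc[OF Ot a] by simp
    moreover have "a \<in> elts ?d" using a by simp
    ultimately show ?thesis using go[OF a] T_eq by simp
  qed
  ultimately show ?thesis unfolding is_tau_def using Ot by blast
qed

section \<open>Definability of \<open>bounds_taus\<close>\<close>

lemma tower_appl_iff:
  "tower (appl T) d \<longleftrightarrow> Ord d \<and> (vzero \<in> elts d \<longrightarrow> centerless_group (appl T vzero)) \<and>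
     (\<forall>a. vsucc a \<in> elts d \<longrightarrow> centerless_group (appl T a) \<longrightarrow> aut_ext (appl T a) (appl T (vsucc a))) \<and>
     (\<forall>a. a \<in> elts d \<longrightarrow> Limit_Ord a \<longrightarrow> (\<forall>b\<in>elts a. is_group (appl T b)) \<longrightarrow>
        appl T a = union_group a (appl T))"
proof -
  have "definable_fn1 (appl T)" by (intro def_intro)
  then show ?thesis unfolding tower_def by blast
qed

text \<open>\<open>Ord_least\<close> needs this to produce a least bound. The definable variant
  \<open>tau\<close> agrees with \<open>is_tau\<close> on centerless groups, the only ones to which
  it is applied.\<close>

lemma definable_bounds_taus: "definable1 (bounds_taus k)"
proof -
  define tau :: "'a \<Rightarrow> 'a \<Rightarrow> bool" where "tau = (\<lambda>G t. Ord t \<and>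
    (\<exists>T. (fun_on T (vsucc (vsucc t)) \<and> tower (appl T) (vsucc (vsucc t)) \<and>
      (vzero \<in> elts (vsucc (vsucc t)) \<longrightarrow> appl T vzero = G)) \<and>
      appl T (vsucc t) = appl T t \<and> (\<forall>a\<in>elts t. appl T (vsucc a) \<noteq> appl T a)))"
  have tau: "is_tau G t \<longleftrightarrow> tau G t" if G: "centerless_group G" for G t
  proof -
    have "app T (vsucc t) = app T t \<and> (\<forall>a\<in>elts t. app T (vsucc a) \<noteq> app T a) \<longleftrightarrow>
        appl T (vsucc t) = appl T t \<and> (\<forall>a\<in>elts t. appl T (vsucc a) \<noteq> appl T a)"
      if "Ord t" "fun_on T (vsucc (vsucc t))" for T
    proof -
      have "appl T a = app T a" "appl T (vsucc a) = app T (vsucc a)" if "a \<in> elts t" for a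
        using that appl_eq[OF \<open>fun_on T _\<close>] vsucc_mem_vsucc[OF \<open>Ord t\<close>] by auto
      then show ?thesis using appl_eq[OF \<open>fun_on T _\<close>] by simp
    qed
    then show ?thesis unfolding is_tau_def aut_tower_iff[OF G] tau_def by blast
  qed
  have vfst: "vfst G = car G" if "centerless_group G" for G :: 'a
    using vfst_group that unfolding centerless_group_iff by blast
  have card: "card_le A B \<longleftrightarrow> (\<exists>f. maps f A B \<and> (\<forall>x\<in>elts A. \<forall>y\<in>elts A. appl f x = appl f y \<longrightarrow> x = y))"
    for A B :: 'a
    unfolding card_le_def inj_on_def using appl_eq maps_fun_on by metis
  have eq: "bounds_taus k a \<longleftrightarrow> (\<forall>G. centerless_group G \<longrightarrow> card_le (car G) k \<longrightarrow> (\<exists>t. tau G t \<and> t \<in> elts a))"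
    for a
    unfolding bounds_taus_def by (auto simp: tau vfst)
  show ?thesis
    unfolding eq card tau_def tower_appl_iff by (intro def_intro definable_fn_union_group)
qed

section \<open>Bounding the height of the towers\<close>

text \<open>Every code contains the triple recording the product of the unit with itself, so the
  empty set is not a code.\<close>

lemma code_nonempty:
  assumes "centerless_group G" "elems G \<subseteq> elts k" shows "code k G M x \<noteq> vzero"
proof -
  have G: "is_group G" using assms(1) unfolding centerless_group_iff by blast
  have "triple (unit G) (unit G) (mul G (unit G) (unit G)) \<in> elts (code k G M x)"
    using in_code_triple[OF G unit_closed[OF G] unit_closed[OF G]] in_code_iff[OF assms(2)] by blast
  then show ?thesis by auto
qed

lemma birth_code:
  assumes "birth k X a" shows "X \<in> elts (VPow (fin_seqs k))" "X \<noteq> vzero"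
proof -
  obtain G M x where *: "centerless_group G" "elems G \<subseteq> elts k" "X = code k G M x"
    using assms unfolding birth_def by blast
  show "X \<noteq> vzero" using code_nonempty[OF *(1,2), of M x] *(3) by simp
  show "X \<in> elts (VPow (fin_seqs k))" using *(3) by (auto simp: code_def elts_vsep[OF definable_in_code])
qed

lemma birth_exists:
  assumes G: "centerless_group G" "elems G \<subseteq> elts k" and a: "Ord a" "tow G (vsucc a) \<noteq> tow G a"
  shows "\<exists>X. birth k X a"
proof -
  interpret tower "tow G" "vsucc (vsucc a)"
    by (rule tower_tow[OF G(1) Ord_vsucc[OF Ord_vsucc[OF a(1)]]])
  have E: "aut_ext (tow G a) (tow G (vsucc a))" by (rule tower_succ) simp
  have "is_group (tow G a)" by (rule tower_group) simp
  then have "car (tow G (vsucc a)) \<noteq> car (tow G a)" using aut_ext_car_eq[OF _ E] a(2) by blast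
  then obtain x where "x \<in> elems (tow G (vsucc a))" "x \<notin> elems (tow G a)"
    using aut_ext_subset[OF E] extensionality by blast
  then show ?thesis unfolding birth_def using G a(1) by blast
qed

definition birth_of :: "'v::zf \<Rightarrow> 'v \<Rightarrow> 'v" where
  "birth_of k X = the_or (birth k X)"

lemma birth_of_eq: "birth k X a \<Longrightarrow> birth_of k X = a"
  unfolding birth_of_def using birth_unique by (blast intro: the_or_eq)

lemma definable_fn_birth_of [def_intro]:
  assumes "definable_fn A" shows "definable_fn (\<lambda>s. birth_of k (A s))"
  by (rule definable_fn_sub1[OF _ assms], unfold birth_of_def, intro def_intro)

definition births :: "'v::zf \<Rightarrow> 'v" where
  "births k = vimg (VPow (fin_seqs k)) (birth_of k)"

lemma births: "birth k X a \<Longrightarrow> a \<in> elts (births k)"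
proof -
  assume X: "birth k X a"
  have "definable_fn1 (birth_of k)" by (intro def_intro)
  then show ?thesis
    unfolding births_def using birth_code(1)[OF X] birth_of_eq[OF X] by (subst elts_vimg) auto
qed

definition stops :: "'v::zf \<Rightarrow> 'v \<Rightarrow> bool" where
  "stops G t \<longleftrightarrow> least_Ord (\<lambda>a. tow G (vsucc a) = tow G a) t"

text \<open>\<open>births k\<close> is a set, so some ordinal lies outside it, and at that stage no
  element can be added. Definability of the tower then gives a least stage of this kind.\<close>

lemma ex_stops:
  assumes G: "centerless_group G" "elems G \<subseteq> elts k" shows "\<exists>t. stops G t"
proof -
  obtain a where a: "Ord a" "a \<notin> elts (births k)" using Ord_not_bounded by blast
  then have "tow G (vsucc a) = tow G a" using birth_exists[OF G a(1)] births by blast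
  moreover have "definable1 (\<lambda>a. tow G (vsucc a) = tow G a)" by (intro def_intro)
  ultimately show ?thesis unfolding stops_def using Ord_least[of "\<lambda>a. tow G (vsucc a) = tow G a" a] a(1) by blast
qed

text \<open>This is the supremum of the heights of the towers in question. Cutting it out of
  \<open>births k\<close> loses nothing, because every stage below a height adds an element.\<close>

definition tau_bound :: "'v::zf \<Rightarrow> 'v" where
  "tau_bound k = vsep (births k)
     (\<lambda>a. \<exists>G t. centerless_group G \<and> elems G \<subseteq> elts k \<and> stops G t \<and> a \<in> elts t)"

lemma stops_birth:
  assumes "centerless_group G" "elems G \<subseteq> elts k" "stops G t" "a \<in> elts t"
  shows "\<exists>X. birth k X a"
proof -
  have "Ord a" "tow G (vsucc a) \<noteq> tow G a"
    using assms(3,4) Ord_mem unfolding stops_def least_Ord_def by blast+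
  then show ?thesis using birth_exists assms(1,2) by blast
qed

lemma elts_tau_bound:
  "elts (tau_bound k) =
    {a. \<exists>G t. centerless_group G \<and> elems G \<subseteq> elts k \<and> stops G t \<and> a \<in> elts t}"
proof -
  have d: "definable1 (\<lambda>a. \<exists>G t. centerless_group G \<and> elems G \<subseteq> elts k \<and> stops G t \<and> a \<in> elts t)"
    unfolding stops_def least_Ord_def by (intro def_intro)
  show ?thesis unfolding tau_bound_def elts_vsep[OF d] using stops_birth births by blast
qed

lemma Ord_tau_bound: "Ord (tau_bound k)"
  unfolding Ord_def[of "tau_bound k"] elts_tau_bound
proof (intro conjI ballI subsetI)
  fix a c assume "a \<in> {a. \<exists>G t. centerless_group G \<and> elems G \<subseteq> elts k \<and> stops G t \<and> a \<in> elts t}" "c \<in> elts a"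
  then show "c \<in> {a. \<exists>G t. centerless_group G \<and> elems G \<subseteq> elts k \<and> stops G t \<and> a \<in> elts t}"
    unfolding stops_def least_Ord_def using Ord_trans by blast
next
  fix a c assume "a \<in> {a. \<exists>G t. centerless_group G \<and> elems G \<subseteq> elts k \<and> stops G t \<and> a \<in> elts t}"
    "c \<in> {a. \<exists>G t. centerless_group G \<and> elems G \<subseteq> elts k \<and> stops G t \<and> a \<in> elts t}"
  then have "Ord a" "Ord c" unfolding stops_def least_Ord_def using Ord_mem by blast+
  then show "a \<in> elts c \<or> a = c \<or> c \<in> elts a" by (rule Ord_linear) blast+
qed

lemma maps_onto_iff:
  "maps_onto f A B \<longleftrightarrow> maps f A B \<and> (\<forall>y\<in>elts B. \<exists>x\<in>elts A. appl f x = y)"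
proof (cases "fun_on f A")
  case True
  have e: "app f ` elts A = appl f ` elts A" by (simp add: appl_eq[OF True])
  show ?thesis
    unfolding maps_onto_def maps_iff e set_eq_subset image_subset_iff subset_iff[of "elts B"] image_iff
    by (simp add: eq_commute) blast
qed (simp add: maps_onto_def maps_def)

lemma definable_maps_onto [def_intro]:
  assumes "definable_fn F" "definable_fn A" "definable_fn B"
  shows "definable (\<lambda>s. maps_onto (F s) (A s) (B s))"
  by (rule definable_sub3[OF _ assms], unfold maps_onto_iff, intro def_intro)

lemma maps_onto_vlam:
  assumes "definable_fn1 F" "F ` elts A = elts B" shows "maps_onto (vlam A F) A B"
  unfolding maps_onto_def using fun_on_vlam[OF assms(1)] app_vlam[OF assms(1)] assms(2)
  by (metis (no_types, lifting) image_cong)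

text \<open>A set which codes no member of a tower, such as the empty set, is mapped to the top element.\<close>

lemma maps_onto_tau_bound: "\<exists>f. maps_onto f (VPow (fin_seqs k)) (vsucc (tau_bound k))"
proof -
  define F where "F = (\<lambda>X. if \<exists>a\<in>elts (tau_bound k). birth k X a then birth_of k X else tau_bound k)"
  have "definable_fn1 F" unfolding F_def by (intro def_intro)
  moreover have "F ` elts (VPow (fin_seqs k)) = elts (vsucc (tau_bound k))"
  proof (intro subset_antisym subsetI)
    fix y assume "y \<in> F ` elts (VPow (fin_seqs k))"
    then show "y \<in> elts (vsucc (tau_bound k))"
      using birth_of_eq unfolding F_def by (auto split: if_splits)
  next
    fix y assume y: "y \<in> elts (vsucc (tau_bound k))"
    show "y \<in> F ` elts (VPow (fin_seqs k))"
    proof (cases "y = tau_bound k")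
      case True
      have "F vzero = tau_bound k" unfolding F_def using birth_code(2) by auto
      moreover have "vzero \<in> elts (VPow (fin_seqs k))" by simp
      ultimately show ?thesis using True by (metis imageI)
    next
      case False
      then have y': "y \<in> elts (tau_bound k)" using y by simp
      then obtain X where X: "birth k X y" using stops_birth unfolding elts_tau_bound by blast
      then have "F X = y" unfolding F_def using y' birth_of_eq by auto
      then show ?thesis using birth_code(1)[OF X] by (metis imageI)
    qed
  qed
  ultimately show ?thesis using maps_onto_vlam by blast
qed

text \<open>The injection moves \<open>G\<close> to a copy \<open>G'\<close> inside
  \<open>k\<close>, whose height is at most \<open>tau_bound k\<close>; renaming turns the tower of
  \<open>G'\<close> into one over \<open>G\<close> of the same height. The successor makes the bound
  strict.\<close>

lemma bounds_tau_bound: "bounds_taus k (vsucc (tau_bound k))"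
  unfolding bounds_taus_def
proof (intro allI impI, elim conjE)
  fix G assume G: "centerless_group G" and le: "card_le (vfst G) k"
  have g: "is_group G" using G unfolding centerless_group_iff by blast
  obtain f where f: "maps f (car G) k" and inj: "inj_on (app f) (elems G)"
    using le unfolding card_le_def vfst_group[OF g] by blast
  define e where "e = appl f"
  have e: "definable_fn1 e" unfolding e_def by (intro def_intro)
  have e_eq: "e x = app f x" if "x \<in> elems G" for x
    unfolding e_def using appl_eq[OF maps_fun_on[OF f] that] .
  have e_inj: "inj_on e (elems G)" using inj e_eq by (simp add: inj_on_def)
  define G' where "G' = rename e G"
  have G': "centerless_group G'" unfolding G'_def by (rule centerless_rename[OF G e e_inj])
  have g': "is_group G'" using G' unfolding centerless_group_iff by blast
  have car': "elems G' = e ` elems G" unfolding G'_def by (rule elts_car_rename[OF e])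
  have sub: "elems G' \<subseteq> elts k" using car' e_eq maps_app[OF f] by auto
  obtain t where t: "stops G' t" using ex_stops[OF G' sub] by blast
  then have Ot: "Ord t" and stop: "tow G' (vsucc t) = tow G' t"
    and go: "\<And>a. a \<in> elts t \<Longrightarrow> tow G' (vsucc a) \<noteq> tow G' a"
    unfolding stops_def least_Ord_def by blast+
  \<comment> \<open>On \<open>G'\<close> this inverts \<open>e\<close>. Elsewhere its values are
    pairs with first component \<open>car G\<close>, which by foundation lie outside
    \<open>G\<close>; so \<open>r\<close> is injective on the entire tower.\<close>
  define r where "r = (\<lambda>y. if y \<in> elems G' then the_or (\<lambda>x. x \<in> elems G \<and> e x = y)
    else opair (car G) y)"
  have dr: "definable_fn1 r" unfolding r_def by (intro def_intro definable_fn_sub1[OF e])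
  have re: "r (e x) = x" if "x \<in> elems G" for x
  proof -
    have "the_or (\<lambda>z. z \<in> elems G \<and> e z = e x) = x"
      by (rule the_or_eq) (use that e_inj in \<open>auto simp: inj_on_eq_iff\<close>)
    then show ?thesis using that car' by (simp add: r_def)
  qed
  have r_in: "r y \<in> elems G \<longleftrightarrow> y \<in> elems G'" for y
    using re car' opair_not_mem by (auto simp: r_def)
  have r_inj: "inj r"
  proof (rule injI)
    fix y z assume eq: "r y = r z"
    show "y = z"
    proof (cases "y \<in> elems G'")
      case True
      then have "z \<in> elems G'" using eq r_in by metis
      then show ?thesis using True eq re car' by auto
    next
      case False
      then have "z \<notin> elems G'" using eq r_in by metis
      then show ?thesis using False eq by (simp add: r_def)
    qed
  qed
  have rinj: "inj_on r A" for A using inj_on_subset[OF r_inj subset_UNIV] .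
  have rG: "rename r G' = G"
  proof (rule group_eqI[OF is_group_rename[OF g' dr rinj] g])
    have "elems (rename r G') = elems G"
      using elts_car_rename[OF dr, of G'] car' re by (auto simp: image_iff)
    then show car: "car (rename r G') = car G" by (rule extensionality)
    fix x y assume "x \<in> elems (rename r G')" "y \<in> elems (rename r G')"
    then have xy: "x \<in> elems G" "y \<in> elems G" using car by simp_all
    have exy: "e x \<in> elems G'" "e y \<in> elems G'" using xy car' by auto
    have "mul (rename r G') x y = r (mul G' (e x) (e y))"
      using mul_rename[OF g' dr rinj exy] re xy by simp
    also have "\<dots> = r (e (mul G x y))" using mul_rename[OF g e e_inj xy] by (simp add: G'_def)
    also have "\<dots> = mul G x y" using re mul_closed[OF g xy] by blast
    finally show "mul (rename r G') x y = mul G x y" .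
  qed
  let ?F = "\<lambda>a. rename r (tow G' a)"
  have tow: "tower (tow G') (vsucc (vsucc t))" by (rule tower_tow[OF G' Ord_vsucc[OF Ord_vsucc[OF Ot]]])
  then interpret tower "tow G'" "vsucc (vsucc t)" .
  have "is_tau (?F vzero) t"
  proof (rule is_tau_tower)
    show "tower ?F (vsucc (vsucc t))" by (rule tower_rename[OF tow dr rinj])
    show "?F (vsucc t) = ?F t" using stop by simp
    fix a assume a: "a \<in> elts t"
    have sa: "vsucc a \<in> elts (vsucc (vsucc t))" using vsucc_mem_vsucc[OF Ot a] by simp
    \<comment> \<open>Consecutive groups that differ have different carriers, and an injective
      renaming keeps the carriers different.\<close>
    have "car (tow G' (vsucc a)) \<noteq> car (tow G' a)"
      using aut_ext_car_eq[OF tower_group tower_succ[OF sa]] go[OF a] a by auto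
    then have "r ` elems (tow G' (vsucc a)) \<noteq> r ` elems (tow G' a)"
      using extensionality by (auto simp: inj_image_eq_iff[OF r_inj])
    then show "?F (vsucc a) \<noteq> ?F a" using elts_car_rename[OF dr] by metis
  qed
  then have "is_tau G t" by (simp add: rG)
  moreover have "elts t \<subseteq> elts (tau_bound k)" unfolding elts_tau_bound using G' sub t by blast
  then have "t \<in> elts (vsucc (tau_bound k))" using Ord_subset_iff[OF Ot Ord_tau_bound] by blast
  ultimately show "\<exists>t. is_tau G t \<and> t \<in> elts (vsucc (tau_bound k))" by blast
qed

section \<open>Existence of \<open>\<theta>\<close>\<close>

text \<open>A map onto an ordinal is determined by the prewellordering which it induces, hence the ordinals
  which are images of \<open>S\<close> form a set.\<close>

definition prewo :: "'v::zf \<Rightarrow> 'v \<Rightarrow> 'v" where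
  "prewo S f = vsep (vprod S S) (\<lambda>p. appl f (pfst p) \<in> elts (appl f (psnd p)))"

lemma elts_prewo: "elts (prewo S f) = {p \<in> elts (vprod S S). appl f (pfst p) \<in> elts (appl f (psnd p))}"
  unfolding prewo_def by (rule elts_vsep) (intro def_intro)

lemma prewo_mem: "x \<in> elts S \<Longrightarrow> y \<in> elts S \<Longrightarrow> opair x y \<in> elts (prewo S f) \<longleftrightarrow> appl f x \<in> elts (appl f y)"
  by (simp add: elts_prewo)

text \<open>For a map onto an ordinal, the value at \<open>x\<close> is the set of the values at the
  predecessors of \<open>x\<close> in the induced ordering. Hence \<open>f\<close> and
  \<open>g\<close> agree, by induction on the value.\<close>

lemma prewo_unique:
  assumes a: "Ord a" "maps_onto f S a" and b: "Ord b" "maps_onto g S b" and eq: "prewo S f = prewo S g"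
  shows "a = b"
proof -
  have iff: "appl f x \<in> elts (appl f y) \<longleftrightarrow> appl g x \<in> elts (appl g y)" if "x \<in> elts S" "y \<in> elts S" for x y
    using prewo_mem[OF that, of f] prewo_mem[OF that, of g] eq by simp
  have f: "appl f x \<in> elts a" if "x \<in> elts S" for x using a(2) that by (simp add: maps_onto_iff maps_iff)
  have g: "appl g x \<in> elts b" if "x \<in> elts S" for x using b(2) that by (simp add: maps_onto_iff maps_iff)
  have "\<forall>x\<in>elts S. appl f x = c \<longrightarrow> appl g x = c" if "Ord c" for c
    using _ that
  proof (rule Ord_induct)
    show "definable (\<lambda>s. \<forall>x\<in>elts S. appl f x = s 0 \<longrightarrow> appl g x = s 0)" by (intro def_intro)
  next
    fix c assume IH: "\<And>e. e \<in> elts c \<Longrightarrow> \<forall>x\<in>elts S. appl f x = e \<longrightarrow> appl g x = e"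
    show "\<forall>x\<in>elts S. appl f x = c \<longrightarrow> appl g x = c"
    proof (intro ballI impI)
      fix x assume x: "x \<in> elts S" "appl f x = c"
      have "e \<in> elts (appl g x) \<longleftrightarrow> e \<in> elts c" for e
      proof
        assume e: "e \<in> elts c"
        then have "e \<in> elts a" using Ord_trans[OF a(1) e] f[OF x(1)] x(2) by blast
        then obtain y where y: "y \<in> elts S" "appl f y = e" using a(2) unfolding maps_onto_iff by blast
        then have "appl g y \<in> elts (appl g x)" using iff[OF y(1) x(1)] e x(2) by simp
        then show "e \<in> elts (appl g x)" using IH[OF e] y by simp
      next
        assume e: "e \<in> elts (appl g x)"
        then have "e \<in> elts b" using Ord_trans[OF b(1) e g[OF x(1)]] by blast
        then obtain y where y: "y \<in> elts S" "appl g y = e" using b(2) unfolding maps_onto_iff by blast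
        then have "appl f y \<in> elts c" using iff[OF y(1) x(1)] e x(2) by simp
        then show "e \<in> elts c" using IH[of "appl f y"] y by auto
      qed
      then show "appl g x = c" by (intro extensionality) blast
    qed
  qed
  then have eq: "appl g x = appl f x" if "x \<in> elts S" for x
    using Ord_mem[OF a(1) f[OF that]] that by blast
  have "elts a = elts b"
    using a(2) b(2) f g eq unfolding maps_onto_iff by (intro subset_antisym subsetI) metis+
  then show ?thesis by (rule extensionality)
qed

lemma ex_theta: "\<exists>h. is_theta S h"
proof -
  define R where "R = (\<lambda>r a. Ord a \<and> (\<exists>f. maps_onto f S a \<and> r = prewo S f))"
  have R_unique: "a = b" if "R r a" "R r b" for r a b
    using that prewo_unique unfolding R_def by blast
  define A where "A = vimg (VPow (vprod S S)) (\<lambda>r. the_or (R r))"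
  have dA: "definable_fn1 (\<lambda>r. the_or (R r))"
    unfolding R_def prewo_def by (intro def_intro)
  have "a \<in> elts A" if a: "Ord a" "maps_onto f S a" for a f
  proof -
    have "R (prewo S f) a" unfolding R_def using a by blast
    then have "the_or (R (prewo S f)) = a" using R_unique by (blast intro: the_or_eq)
    moreover have "prewo S f \<in> elts (VPow (vprod S S))" using elts_prewo[of S f] by auto
    ultimately show ?thesis unfolding A_def elts_vimg[OF dA] by (metis imageI)
  qed
  \<comment> \<open>Adding \<open>vzero\<close> to the set makes the ordinal nonzero as well, as
    \<open>is_theta\<close> requires.\<close>
  moreover obtain a where a: "Ord a" "a \<notin> elts (vun A (vset {vzero}))" using Ord_not_bounded by blast
  ultimately have "a \<noteq> vzero \<and> \<not> (\<exists>f. maps_onto f S a)" by auto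
  moreover have "definable1 (\<lambda>a. a \<noteq> vzero \<and> \<not> (\<exists>f. maps_onto f S a))" by (intro def_intro)
  ultimately show ?thesis unfolding is_theta_def using Ord_least[of "\<lambda>a. a \<noteq> vzero \<and> \<not> (\<exists>f. maps_onto f S a)" a] a(1) by blast
qed

text \<open>Values outside \<open>b\<close> are sent to \<open>vzero\<close>. Hence the nonzero
  ordinals onto which \<open>S\<close> can be mapped are closed downward, and theta lies above all
  of them.\<close>

lemma maps_onto_smaller:
  assumes f: "maps_onto f S a" and a: "Ord a" and b: "elts b \<subseteq> elts a" "vzero \<in> elts b"
  shows "\<exists>g. maps_onto g S b"
proof -
  define F where "F = (\<lambda>x. if appl f x \<in> elts b then appl f x else vzero)"
  have "definable_fn1 F" unfolding F_def by (intro def_intro)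
  moreover have "F ` elts S = elts b"
  proof (intro subset_antisym subsetI)
    fix y assume y: "y \<in> elts b"
    then obtain x where "x \<in> elts S" "appl f x = y" using f b(1) unfolding maps_onto_iff by blast
    then show "y \<in> F ` elts S" using y by (auto simp: F_def image_iff)
  qed (use b(2) in \<open>auto simp: F_def\<close>)
  ultimately show ?thesis using maps_onto_vlam by blast
qed

theorem theorem3p16:
  fixes k :: "'v::zf"
  shows "(\<exists>t h. is_tau_card k t \<and> is_theta (VPow (fin_seqs k)) h \<and> t \<in> elts h) \<and>
         (\<exists>a. Ord a \<and> (\<exists>f. maps_onto f (VPow (fin_seqs k)) a) \<and> bounds_taus k a)"
proof -
  let ?S = "VPow (fin_seqs k)" and ?a = "vsucc (tau_bound k)"
  have Oa: "Ord ?a" by (rule Ord_vsucc[OF Ord_tau_bound])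
  obtain f where f: "maps_onto f ?S ?a" using maps_onto_tau_bound by blast
  obtain t where t: "least_Ord (bounds_taus k) t" "t \<in> elts (vsucc ?a)"
    using Ord_least[OF definable_bounds_taus Oa bounds_tau_bound] by blast
  obtain h where h: "is_theta ?S h" using ex_theta by blast
  have Ot: "Ord t" using t(1) unfolding least_Ord_def by blast
  have Oh: "Ord h" and h0: "h \<noteq> vzero" and hS: "\<not> (\<exists>f. maps_onto f ?S h)"
    using h unfolding is_theta_def least_Ord_def by blast+
  \<comment> \<open>Otherwise \<open>h\<close> is at most \<open>t\<close>, hence at most
    \<open>?a\<close>, and the map onto \<open>?a\<close> would yield one onto the nonzero ordinal
    \<open>h\<close>.\<close>
  have "t \<in> elts h"
  proof (rule ccontr)
    assume "t \<notin> elts h"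
    then have "h \<in> elts (vsucc t)" using Ord_linear[OF Ot Oh] by auto
    then have "elts h \<subseteq> elts t" using Ord_subset_iff[OF Oh Ot] by blast
    also have "elts t \<subseteq> elts ?a" using Ord_subset_iff[OF Ot Oa] t(2) by blast
    finally show False using maps_onto_smaller[OF f Oa _ Ord_vzero_mem[OF Oh h0]] hS by blast
  qed
  then show ?thesis
    unfolding is_tau_card_def using t(1) h Oa f bounds_tau_bound by blast
qed

end
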